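(* Let $H$ be a finite group and let $V$ be a finitely generated virtually free group. Then the rational subset membership problem for the wreath product $H\wr V$ is decidable.
   Context: A group is virtually free if it has a free subgroup of finite index. Wreath product: for groups $G$ and $H$, let $H^{(G)}$ be the group of all mappings $f\colon G\to H$ with $f(a)=1_H$ for all but finitely many $a\in G$, with pointwise multiplication. $G$ acts on $H^{(G)}$ by $(gf)(a)=f(g^{-1}a)$. The wreath product $H\wr G$ is the semidirect product $H^{(G)}\rtimes G$: its elements are the pairs $(f,g)$ with $f\in H^{(G)}$, $g\in G$, and $(f_1,g_1)(f_2,g_2)=(f,g_1g_2)$ where $f(a)=f_1(a)f_2(g_1^{-1}a)$. Rational subset membership problem for a finitely generated group $G$ (with a fixed finite generating set $X$ closed under inverses; group elements are given as words over $X$): a finite automaton over $G$ is a tuple $A=(Q,G,E,q_0,Q_F)$ with $Q$ a finite set of states, $q_0\in Q$ the initial state, $Q_F\subseteq Q$ the set of final states, and $E\subseteq Q\times G\times Q$ a finite set of transitions. The set $L(A)\subseteq G$ consists of all products $g_1g_2\cdots g_n$ such that there are transitions $(q_0,g_1,q_1),(q_1,g_2,q_2),\ldots,(q_{n-1},g_n,q_n)\in E$ with $q_n\in Q_F$. The problem is: given a finite automaton $A$ over $G$ and an element $g\in G$, decide whether $g\in L(A)$. *)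

theory Defs
  imports
    "HOL-Algebra.Generated_Groups"
    "HOL-Library.Nat_Bijection"
begin

section \<open>Decidable sets of natural numbers\<close>

text \<open>
  Kleene's partial recursive functions. Programs carry no fixed arity: \<open>RZero\<close> accepts argument
  lists of every length, and a program has no value on a list whose length does not suit it.
  Projections count from 0.
\<close>

datatype recf =
    RZero
  | RSucc
  | RProj nat
  | RComp recf "recf list"
  | RPrec recf recf
  | RMin recf

inductive rec_eval :: "recf \<Rightarrow> nat list \<Rightarrow> nat \<Rightarrow> bool" where
  rec_zero: "rec_eval RZero xs 0"
| rec_succ: "rec_eval RSucc [x] (Suc x)"
| rec_proj: "i < length xs \<Longrightarrow> rec_eval (RProj i) xs (xs ! i)"
| rec_comp: "list_all2 (\<lambda>g y. rec_eval g xs y) gs ys \<Longrightarrow> rec_eval f ys z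
    \<Longrightarrow> rec_eval (RComp f gs) xs z"
| rec_prec_0: "rec_eval f xs y \<Longrightarrow> rec_eval (RPrec f g) (0 # xs) y"
| rec_prec_Suc: "rec_eval (RPrec f g) (n # xs) y \<Longrightarrow> rec_eval g (n # y # xs) z
    \<Longrightarrow> rec_eval (RPrec f g) (Suc n # xs) z"
| rec_min: "rec_eval f (n # xs) 0 \<Longrightarrow> (\<forall>m<n. \<exists>y. rec_eval f (m # xs) (Suc y))
    \<Longrightarrow> rec_eval (RMin f) xs n"

lemma rec_eval_deterministic:
  assumes "rec_eval f xs y" "rec_eval f xs z"
  shows "y = z"
  using assms
proof (induction arbitrary: z rule: rec_eval.induct)
  case (rec_zero xs)
  then show ?case by (auto elim: rec_eval.cases)
next
  case (rec_succ x)
  then show ?case by (auto elim: rec_eval.cases)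
next
  case (rec_proj i xs)
  from rec_proj(2) show ?case by cases auto
next
  case (rec_comp xs gs ys f z')
  from rec_comp.prems obtain ys' where
    ys': "list_all2 (\<lambda>g y. rec_eval g xs y) gs ys'" "rec_eval f ys' z"
    by cases auto
  have "ys = ys'"
    using rec_comp.IH(1) ys'(1)
    by (auto simp: list_all2_conv_all_nth intro!: nth_equalityI)
  then show ?case using rec_comp.IH(2) ys'(2) by blast
next
  case (rec_prec_0 f xs y g)
  from rec_prec_0.prems show ?case by cases (auto intro: rec_prec_0.IH)
next
  case (rec_prec_Suc f g n xs y z')
  from rec_prec_Suc.prems obtain y' where
    "rec_eval (RPrec f g) (n # xs) y'" "rec_eval g (n # y' # xs) z"
    by cases auto
  then show ?case using rec_prec_Suc.IH by blast
next
  case (rec_min f n xs)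
  from rec_min.prems have z: "rec_eval f (z # xs) 0"
    and less: "\<forall>m<z. \<exists>y. rec_eval f (m # xs) (Suc y)"
    by (cases, auto)+
  show ?case
  proof (rule linorder_cases[of n z])
    assume "n < z"
    then obtain y where "rec_eval f (n # xs) (Suc y)" using less by blast
    then show ?thesis using rec_min.IH(1) by fastforce
  next
    assume "z < n"
    then obtain y where "\<forall>w. rec_eval f (z # xs) w \<longrightarrow> Suc y = w"
      using rec_min.IH(2) by blast
    then show ?thesis using z by fastforce
  qed
qed

definition decidable :: "nat set \<Rightarrow> bool" where
  "decidable S \<longleftrightarrow> (\<exists>f. \<forall>n. rec_eval f [n] (if n \<in> S then 1 else 0))"


section \<open>Finitely generated, free and virtually free groups\<close>

definition finitely_generated :: "('a, 'b) monoid_scheme \<Rightarrow> bool" where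
  "finitely_generated G \<longleftrightarrow>
     (\<exists>X. finite X \<and> X \<subseteq> carrier G \<and> generate G X = carrier G)"

definition list_mult :: "('a, 'b) monoid_scheme \<Rightarrow> 'a list \<Rightarrow> 'a" where
  "list_mult G gs = foldr (mult G) gs (one G)"

text \<open>
  The letter \<open>(True, s)\<close> stands for the generator \<open>s\<close> and \<open>(False, s)\<close> for its formal inverse.
\<close>

fun letter_val :: "('a, 'b) monoid_scheme \<Rightarrow> bool \<times> 'a \<Rightarrow> 'a" where
  "letter_val G (b, s) = (if b then s else inv\<^bsub>G\<^esub> s)"

definition reduced_words :: "'a set \<Rightarrow> (bool \<times> 'a) list set" where
  "reduced_words S = {w. snd ` set w \<subseteq> S \<and>
     successively (\<lambda>(a, s) (b, t). s = t \<longrightarrow> a = b) w}"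

text \<open>
  A group is free on \<open>S\<close> if each of its elements is the value of exactly one reduced word over \<open>S\<close>.
\<close>

definition free_group_on :: "('a, 'b) monoid_scheme \<Rightarrow> 'a set \<Rightarrow> bool" where
  "free_group_on G S \<longleftrightarrow> group G \<and> S \<subseteq> carrier G \<and>
     bij_betw (\<lambda>w. list_mult G (map (letter_val G) w)) (reduced_words S) (carrier G)"

definition free_group :: "('a, 'b) monoid_scheme \<Rightarrow> bool" where
  "free_group G \<longleftrightarrow> (\<exists>S. free_group_on G S)"

definition virtually_free :: "('a, 'b) monoid_scheme \<Rightarrow> bool" where
  "virtually_free G \<longleftrightarrow> group G \<and>
     (\<exists>F. subgroup F G \<and> free_group (G\<lparr>carrier := F\<rparr>) \<and> finite (rcosets\<^bsub>G\<^esub> F))"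


section \<open>Wreath products\<close>

text \<open>
  Mappings from the carrier of \<open>G\<close> are represented by extensional functions, which makes the
  representation unique.
\<close>

definition finsupp_maps ::
  "('h, 'm) monoid_scheme \<Rightarrow> ('g, 'n) monoid_scheme \<Rightarrow> ('g \<Rightarrow> 'h) set" where
  "finsupp_maps H G =
     {f \<in> carrier G \<rightarrow>\<^sub>E carrier H. finite {a \<in> carrier G. f a \<noteq> \<one>\<^bsub>H\<^esub>}}"

definition wreath_product ::
  "('h, 'm) monoid_scheme \<Rightarrow> ('g, 'n) monoid_scheme \<Rightarrow> (('g \<Rightarrow> 'h) \<times> 'g) monoid" where
  "wreath_product H G =
     \<lparr>carrier = finsupp_maps H G \<times> carrier G,
      mult = (\<lambda>(f1, g1) (f2, g2).
        (\<lambda>a\<in>carrier G. f1 a \<otimes>\<^bsub>H\<^esub> f2 (inv\<^bsub>G\<^esub> g1 \<otimes>\<^bsub>G\<^esub> a), g1 \<otimes>\<^bsub>G\<^esub> g2)),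
      one = (\<lambda>a\<in>carrier G. \<one>\<^bsub>H\<^esub>, \<one>\<^bsub>G\<^esub>)\<rparr>"

lemma group_wreath_product:
  fixes H :: "('h, 'm) monoid_scheme" and G :: "('g, 'n) monoid_scheme"
  assumes "group H" "group G"
  shows "group (wreath_product H G)"
proof -
  interpret H: group H by fact
  interpret G: group G by fact
  have supp_shift: "finite {a \<in> carrier G. f (g \<otimes>\<^bsub>G\<^esub> a) \<noteq> \<one>\<^bsub>H\<^esub>}"
    if f: "f \<in> finsupp_maps H G" and g: "g \<in> carrier G" for f g
  proof (rule finite_subset)
    show "{a \<in> carrier G. f (g \<otimes>\<^bsub>G\<^esub> a) \<noteq> \<one>\<^bsub>H\<^esub>}
        \<subseteq> (\<lambda>b. inv\<^bsub>G\<^esub> g \<otimes>\<^bsub>G\<^esub> b) ` {a \<in> carrier G. f a \<noteq> \<one>\<^bsub>H\<^esub>}"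
    proof
      fix a assume a: "a \<in> {a \<in> carrier G. f (g \<otimes>\<^bsub>G\<^esub> a) \<noteq> \<one>\<^bsub>H\<^esub>}"
      then have "a = inv\<^bsub>G\<^esub> g \<otimes>\<^bsub>G\<^esub> (g \<otimes>\<^bsub>G\<^esub> a)"
        using g by (simp add: G.m_assoc[symmetric])
      then show "a \<in> (\<lambda>b. inv\<^bsub>G\<^esub> g \<otimes>\<^bsub>G\<^esub> b) ` {a \<in> carrier G. f a \<noteq> \<one>\<^bsub>H\<^esub>}"
        using a g by blast
    qed
    show "finite ((\<lambda>b. inv\<^bsub>G\<^esub> g \<otimes>\<^bsub>G\<^esub> b) ` {a \<in> carrier G. f a \<noteq> \<one>\<^bsub>H\<^esub>})"
      using f by (auto simp: finsupp_maps_def)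
  qed
  have val: "f a \<in> carrier H" if "f \<in> finsupp_maps H G" "a \<in> carrier G" for f a
    using that by (auto simp: finsupp_maps_def)
  have ext: "(\<lambda>a\<in>carrier G. f a) = f" if "f \<in> finsupp_maps H G" for f
    using that by (auto simp: finsupp_maps_def intro: extensional_restrict)
  have closed: "(\<lambda>a\<in>carrier G. f a \<otimes>\<^bsub>H\<^esub> f' (inv\<^bsub>G\<^esub> g \<otimes>\<^bsub>G\<^esub> a)) \<in> finsupp_maps H G"
    if f: "f \<in> finsupp_maps H G" and f': "f' \<in> finsupp_maps H G" and g: "g \<in> carrier G"
    for f f' g
  proof -
    have "finite ({a \<in> carrier G. f a \<noteq> \<one>\<^bsub>H\<^esub>}
        \<union> {a \<in> carrier G. f' (inv\<^bsub>G\<^esub> g \<otimes>\<^bsub>G\<^esub> a) \<noteq> \<one>\<^bsub>H\<^esub>})"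
      using f supp_shift[OF f'] g by (auto simp: finsupp_maps_def)
    then have "finite {a \<in> carrier G. f a \<otimes>\<^bsub>H\<^esub> f' (inv\<^bsub>G\<^esub> g \<otimes>\<^bsub>G\<^esub> a) \<noteq> \<one>\<^bsub>H\<^esub>}"
      by (rule rev_finite_subset) auto
    then show ?thesis
      using val[OF f] val[OF f'] g by (auto simp: finsupp_maps_def cong: conj_cong)
  qed
  show ?thesis
  proof (rule groupI)
    fix x y
    assume "x \<in> carrier (wreath_product H G)" "y \<in> carrier (wreath_product H G)"
    then show "x \<otimes>\<^bsub>wreath_product H G\<^esub> y \<in> carrier (wreath_product H G)"
      by (auto simp: wreath_product_def closed)
  next
    show "\<one>\<^bsub>wreath_product H G\<^esub> \<in> carrier (wreath_product H G)"
      by (auto simp: wreath_product_def finsupp_maps_def)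
  next
    fix x y z
    assume "x \<in> carrier (wreath_product H G)" "y \<in> carrier (wreath_product H G)"
      "z \<in> carrier (wreath_product H G)"
    then show "x \<otimes>\<^bsub>wreath_product H G\<^esub> y \<otimes>\<^bsub>wreath_product H G\<^esub> z
        = x \<otimes>\<^bsub>wreath_product H G\<^esub> (y \<otimes>\<^bsub>wreath_product H G\<^esub> z)"
      by (auto simp: wreath_product_def val H.m_assoc G.m_assoc G.inv_mult_group
          intro!: restrict_ext)
  next
    fix x assume "x \<in> carrier (wreath_product H G)"
    then show "\<one>\<^bsub>wreath_product H G\<^esub> \<otimes>\<^bsub>wreath_product H G\<^esub> x = x"
      by (auto simp: wreath_product_def val ext cong: restrict_cong)
  next
    fix x assume "x \<in> carrier (wreath_product H G)"
    then obtain f g where x: "x = (f, g)" "f \<in> finsupp_maps H G" "g \<in> carrier G"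
      by (auto simp: wreath_product_def)
    define f' where "f' = (\<lambda>a\<in>carrier G. inv\<^bsub>H\<^esub> f (g \<otimes>\<^bsub>G\<^esub> a))"
    have "finite {a \<in> carrier G. f' a \<noteq> \<one>\<^bsub>H\<^esub>}"
      by (rule finite_subset[OF _ supp_shift[OF x(2,3)]]) (auto simp: f'_def)
    then have "f' \<in> finsupp_maps H G"
      using val[OF x(2)] x(3) by (auto simp: finsupp_maps_def f'_def)
    moreover have "(f', inv\<^bsub>G\<^esub> g) \<otimes>\<^bsub>wreath_product H G\<^esub> x = \<one>\<^bsub>wreath_product H G\<^esub>"
      using x by (auto simp: wreath_product_def f'_def val intro!: restrict_ext)
    ultimately show "\<exists>y\<in>carrier (wreath_product H G).
        y \<otimes>\<^bsub>wreath_product H G\<^esub> x = \<one>\<^bsub>wreath_product H G\<^esub>"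
      using x by (intro bexI[of _ "(f', inv\<^bsub>G\<^esub> g)"]) (auto simp: wreath_product_def)
  qed
qed


section \<open>Finite automata over a group\<close>

record ('q, 'a) automaton =
  states :: "'q set"
  transitions :: "('q \<times> 'a \<times> 'q) set"
  start :: 'q
  finals :: "'q set"

definition finite_automaton :: "('a, 'b) monoid_scheme \<Rightarrow> ('q, 'a) automaton \<Rightarrow> bool" where
  "finite_automaton G A \<longleftrightarrow>
     finite (states A) \<and> start A \<in> states A \<and> finals A \<subseteq> states A \<and>
     finite (transitions A) \<and> transitions A \<subseteq> states A \<times> carrier G \<times> states A"

fun path :: "('q, 'a) automaton \<Rightarrow> 'q \<Rightarrow> 'a list \<Rightarrow> 'q \<Rightarrow> bool" where
  "path A p [] r \<longleftrightarrow> p = r"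
| "path A p (g # gs) r \<longleftrightarrow> (\<exists>q. (p, g, q) \<in> transitions A \<and> path A q gs r)"

definition lang :: "('a, 'b) monoid_scheme \<Rightarrow> ('q, 'a) automaton \<Rightarrow> 'a set" where
  "lang G A = {list_mult G gs | gs q. path A (start A) gs q \<and> q \<in> finals A}"


section \<open>The rational subset membership problem\<close>

text \<open>
  A finite generating set closed under inverses is listed as \<open>xs\<close>; words over it are
  lists of indices into \<open>xs\<close>. An automaton with state set \<open>{..<n}\<close> is presented by \<open>n\<close>, its
  transitions labelled by words, its initial state and its final states.
\<close>

type_synonym automaton_code = "nat \<times> (nat \<times> nat list \<times> nat) list \<times> nat \<times> nat list"

definition symmetric_generating_list :: "('a, 'b) monoid_scheme \<Rightarrow> 'a list \<Rightarrow> bool" where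
  "symmetric_generating_list G xs \<longleftrightarrow>
     distinct xs \<and> set xs \<subseteq> carrier G \<and> generate G (set xs) = carrier G \<and>
     (\<forall>x\<in>set xs. inv\<^bsub>G\<^esub> x \<in> set xs)"

definition word_val :: "('a, 'b) monoid_scheme \<Rightarrow> 'a list \<Rightarrow> nat list \<Rightarrow> 'a" where
  "word_val G xs u = list_mult G (map (\<lambda>i. xs ! i) u)"

fun valid_automaton_code :: "nat \<Rightarrow> automaton_code \<Rightarrow> bool" where
  "valid_automaton_code k (n, es, q0, fs) \<longleftrightarrow>
     (\<forall>(p, u, q)\<in>set es. p < n \<and> set u \<subseteq> {..<k} \<and> q < n) \<and> q0 < n \<and> set fs \<subseteq> {..<n}"

fun automaton_of_code ::
  "('a, 'b) monoid_scheme \<Rightarrow> 'a list \<Rightarrow> automaton_code \<Rightarrow> (nat, 'a) automaton" where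
  "automaton_of_code G xs (n, es, q0, fs) =
     \<lparr>states = {..<n},
      transitions = (\<lambda>(p, u, q). (p, word_val G xs u, q)) ` set es,
      start = q0,
      finals = set fs\<rparr>"

lemma list_mult_closed:
  assumes "monoid G" "set gs \<subseteq> carrier G"
  shows "list_mult G gs \<in> carrier G"
  using assms(2)
  by (induction gs) (auto simp: list_mult_def monoid.m_closed[OF assms(1)] monoid.one_closed[OF assms(1)])

lemma finite_automaton_of_code:
  assumes "monoid G" "set xs \<subseteq> carrier G" "valid_automaton_code (length xs) c"
  shows "finite_automaton G (automaton_of_code G xs c)"
proof -
  obtain n es q0 fs where c: "c = (n, es, q0, fs)"
    by (cases c) auto
  have "word_val G xs u \<in> carrier G" if "set u \<subseteq> {..<length xs}" for u
    unfolding word_val_def using that assms(2)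
    by (intro list_mult_closed[OF assms(1)]) (auto dest!: subsetD[OF that])
  then show ?thesis
    using assms(3) by (fastforce simp: c finite_automaton_def)
qed

fun transition_encode :: "nat \<times> nat list \<times> nat \<Rightarrow> nat" where
  "transition_encode (p, u, q) = prod_encode (p, prod_encode (list_encode u, q))"

fun instance_encode :: "automaton_code \<times> nat list \<Rightarrow> nat" where
  "instance_encode ((n, es, q0, fs), w) =
     list_encode [n, list_encode (map transition_encode es), q0, list_encode fs, list_encode w]"

lemma inj_instance_encode: "inj instance_encode"
proof -
  have "inj transition_encode"
    by (auto simp: inj_def list_encode_eq)
  then show ?thesis
    by (auto simp: inj_def[of instance_encode] list_encode_eq dest: map_injective)
qed

definition rational_subset_membership ::
  "('a, 'b) monoid_scheme \<Rightarrow> 'a list \<Rightarrow> nat set" where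
  "rational_subset_membership G xs =
     {instance_encode (c, w) | c w.
        valid_automaton_code (length xs) c \<and> set w \<subseteq> {..<length xs} \<and>
        word_val G xs w \<in> lang G (automaton_of_code G xs c)}"

text \<open>
  Decidability does not depend on the generating set, so all of them are covered. The first
  conjunct ensures that there is one.
\<close>

definition rational_subset_membership_decidable :: "('a, 'b) monoid_scheme \<Rightarrow> bool" where
  "rational_subset_membership_decidable G \<longleftrightarrow>
     finitely_generated G \<and>
     (\<forall>xs. symmetric_generating_list G xs \<longrightarrow> decidable (rational_subset_membership G xs))"

end

(*
Choosing representatives of the cosets of a free subgroup of V turns an automaton over H wr V
into a finite machine that walks on a tree and multiplies labels from H. Membership means that the
machine has a run that returns to its root and leaves only trivial labels. Such a run is cut into
excursions into subtrees. The words of excursions at a vertex that can be realized with trivial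
total effect form a language L. It is closed under inserting factors that are trivial under all
maps from letters to H, provided no new letters appear, and Higman's lemma shows that this
insertion order is a well-quasi-order; hence L is regular. So if there is no accepting run, then
there is a finite certificate: an automaton for a language that is closed under the rules for
composing excursions. Runs and certificates can both be searched for, and Post's theorem gives a
decision procedure.
*)

theory Submission
  imports Defs "HOL-Library.Sublist" "HOL-Library.Infinite_Set"
    "HOL-Library.Countable_Set"
begin

section \<open>Computable functions on encoded data\<close>

text \<open>The obstacle is that an excursion has no summary of bounded size: it changes labels all
  over a subtree, and later excursions into the same subtree have to undo the changes. So excursions
  cannot be judged one at a time, and the object to understand is the language of words of
  excursions whose joint effect cancels. Its regularity comes from a finite group: as
  \<open>H\<close> and the set of letters are finite, so is the relatively free group on the letters
  in the variety generated by \<open>H\<close>, and Higman's lemma is applied to words decorated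
  with the images of their prefixes. New letters are forbidden because a letter may denote an
  excursion that no run can perform. Higman's lemma gives no bound on the size of an automaton, so
  regularity yields existence but no algorithm. This is why certificates are searched for: an
  automaton for a larger language is good enough as long as finitely many local conditions hold, and
  these conditions can be checked by computation.\<close>

definition recursive :: "nat \<Rightarrow> (nat list \<Rightarrow> nat) \<Rightarrow> bool" where
  "recursive k F \<longleftrightarrow> (\<exists>r. \<forall>xs. length xs = k \<longrightarrow> rec_eval r xs (F xs))"

lemma recursive_cong:
  assumes "recursive k F" "\<And>xs. length xs = k \<Longrightarrow> F xs = G xs"
  shows "recursive k G"
  using assms unfolding recursive_def by metis

lemma recursive_proj: "i < k \<Longrightarrow> recursive k (\<lambda>xs. xs ! i)"
  unfolding recursive_def using rec_proj by blast

lemma recursive_zero: "recursive k (\<lambda>xs. 0)"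
  unfolding recursive_def using rec_zero by blast

lemma recursive_compose:
  assumes "recursive (length Fs) G" "\<And>F. F \<in> set Fs \<Longrightarrow> recursive k F"
  shows "recursive k (\<lambda>xs. G (map (\<lambda>F. F xs) Fs))"
proof -
  obtain g where g: "\<And>xs. length xs = length Fs \<Longrightarrow> rec_eval g xs (G xs)"
    using assms(1) unfolding recursive_def by blast
  obtain r where r: "\<And>F xs. F \<in> set Fs \<Longrightarrow> length xs = k \<Longrightarrow> rec_eval (r F) xs (F xs)"
    using assms(2) unfolding recursive_def by metis
  have "rec_eval (RComp g (map r Fs)) xs (G (map (\<lambda>F. F xs) Fs))" if "length xs = k" for xs
    by (rule rec_comp[where ys = "map (\<lambda>F. F xs) Fs"])
      (auto simp: list_all2_conv_all_nth r that intro!: g)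
  then show ?thesis unfolding recursive_def by blast
qed

lemma recursive_Suc:
  assumes "recursive k F" shows "recursive k (\<lambda>xs. Suc (F xs))"
proof -
  have "recursive 1 (\<lambda>xs. Suc (xs ! 0))"
    unfolding recursive_def
    by (rule exI[of _ RSucc]) (auto simp: length_Suc_conv intro: rec_succ)
  from recursive_compose[of "[F]" "\<lambda>xs. Suc (xs ! 0)" k] this assms show ?thesis by simp
qed

lemma recursive_const: "recursive k (\<lambda>xs. c)"
  by (induction c) (auto intro: recursive_zero recursive_Suc)

lemma recursive_compose2:
  assumes "recursive 2 (\<lambda>xs. G (xs ! 0) (xs ! 1))" "recursive k f" "recursive k g"
  shows "recursive k (\<lambda>xs. G (f xs) (g xs))"
proof -
  have "recursive k (\<lambda>xs. (\<lambda>ys. G (ys ! 0) (ys ! 1)) (map (\<lambda>F. F xs) [f, g]))"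
    by (rule recursive_compose) (use assms in \<open>auto simp: numeral_2_eq_2\<close>)
  then show ?thesis by simp
qed

lemma recursive_compose1:
  assumes "recursive 1 (\<lambda>xs. G (xs ! 0))" "recursive k f"
  shows "recursive k (\<lambda>xs. G (f xs))"
  using recursive_compose[of "[f]" "\<lambda>xs. G (xs ! 0)" k] assms by simp

lemma recursive_rec_nat:
  assumes f: "recursive k f" and g: "recursive (Suc (Suc k)) (\<lambda>zs. g (zs ! 0) (zs ! 1) (drop 2 zs))"
    and h: "recursive k h"
  shows "recursive k (\<lambda>xs. rec_nat (f xs) (\<lambda>n y. g n y xs) (h xs))"
proof -
  let ?P = "\<lambda>xs. rec_nat (f (tl xs)) (\<lambda>n y. g n y (tl xs)) (hd xs)"
  obtain rf where rf: "\<And>xs. length xs = k \<Longrightarrow> rec_eval rf xs (f xs)"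
    using f unfolding recursive_def by blast
  obtain rg where rg: "\<And>zs. length zs = Suc (Suc k) \<Longrightarrow> rec_eval rg zs (g (zs ! 0) (zs ! 1) (drop 2 zs))"
    using g unfolding recursive_def by blast
  have *: "rec_eval (RPrec rf rg) (n # xs) (rec_nat (f xs) (\<lambda>n y. g n y xs) n)" if "length xs = k" for n xs
  proof (induction n)
    case 0
    then show ?case using rf[OF that] by (auto intro: rec_prec_0)
  next
    case (Suc n)
    show ?case
      using rec_prec_Suc[OF Suc rg[of "n # _ # xs", simplified]] that by simp
  qed
  have P: "recursive (Suc k) ?P"
    unfolding recursive_def
    by (rule exI[of _ "RPrec rf rg"]) (auto simp: length_Suc_conv intro!: *)
  \<comment> \<open>\<open>RPrec\<close> takes the recursion argument first: \<open>h xs\<close> is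
    put in front of the parameters, which the k projections reproduce.\<close>
  have "recursive k (\<lambda>xs. ?P (map (\<lambda>F. F xs) (h # map (\<lambda>i xs. xs ! i) [0..<k])))"
    by (rule recursive_compose) (auto simp: P h intro: recursive_proj)
  then show ?thesis
  proof (rule recursive_cong)
    fix xs :: "nat list" assume "length xs = k"
    then have "map (\<lambda>F. F xs) (map (\<lambda>i xs. xs ! i) [0..<k]) = xs"
      by (auto simp: map_nth o_def)
    then show "?P (map (\<lambda>F. F xs) (h # map (\<lambda>i xs. xs ! i) [0..<k]))
       = rec_nat (f xs) (\<lambda>n y. g n y xs) (h xs)"
      by simp
  qed
qed

lemma recursive_Least:
  assumes f: "recursive (Suc k) (\<lambda>zs. f (zs ! 0) (tl zs))"
    and ex: "\<And>xs. length xs = k \<Longrightarrow> \<exists>n. f n xs = 0"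
  shows "recursive k (\<lambda>xs. LEAST n. f n xs = 0)"
proof -
  obtain r where r: "\<And>zs. length zs = Suc k \<Longrightarrow> rec_eval r zs (f (zs ! 0) (tl zs))"
    using f unfolding recursive_def by blast
  have "rec_eval (RMin r) xs (LEAST n. f n xs = 0)" if xs: "length xs = k" for xs
  proof (rule rec_min)
    have "f (LEAST n. f n xs = 0) xs = 0" by (rule LeastI_ex[OF ex[OF xs]])
    then show "rec_eval r ((LEAST n. f n xs = 0) # xs) 0"
      using r[of "(LEAST n. f n xs = 0) # xs"] xs by simp
    show "\<forall>m<LEAST n. f n xs = 0. \<exists>y. rec_eval r (m # xs) (Suc y)"
    proof (intro allI impI)
      fix m assume "m < (LEAST n. f n xs = 0)"
      then have "f m xs \<noteq> 0" using not_less_Least by blast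
      then obtain y where "f m xs = Suc y" using not0_implies_Suc by blast
      then show "\<exists>y. rec_eval r (m # xs) (Suc y)" using r[of "m # xs"] xs by auto
    qed
  qed
  then show ?thesis unfolding recursive_def by blast
qed

section \<open>Arithmetic and the Cantor pairing function\<close>

lemma recursive_add: "recursive 2 (\<lambda>xs. xs ! 0 + xs ! 1)"
proof (rule recursive_cong)
  show "recursive 2 (\<lambda>xs. rec_nat (xs ! 1) (\<lambda>n y. Suc y) (xs ! 0))"
    by (intro recursive_rec_nat recursive_proj recursive_Suc) auto
  have "rec_nat b (\<lambda>n. Suc) a = a + b" for a b by (induction a) auto
  then show "rec_nat (xs ! 1) (\<lambda>n y. Suc y) (xs ! 0) = xs ! 0 + xs ! 1" for xs by simp
qed

lemma recursive_pred: "recursive 1 (\<lambda>xs. xs ! 0 - 1)"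
proof (rule recursive_cong)
  show "recursive 1 (\<lambda>xs. rec_nat 0 (\<lambda>n y. n) (xs ! 0))"
    by (intro recursive_rec_nat recursive_proj recursive_zero) auto
  have "rec_nat 0 (\<lambda>n y. n) a = a - 1" for a :: nat by (cases a) auto
  then show "rec_nat 0 (\<lambda>n y. n) (xs ! 0) = xs ! 0 - 1" for xs by simp
qed

lemma recursive_diff: "recursive 2 (\<lambda>xs. xs ! 0 - xs ! 1)"
proof (rule recursive_cong)
  show "recursive 2 (\<lambda>xs. rec_nat (xs ! 0) (\<lambda>n y. y - 1) (xs ! 1))"
    by (intro recursive_rec_nat recursive_proj recursive_compose1[OF recursive_pred]) auto
  have "rec_nat a (\<lambda>n y. y - 1) b = a - b" for a b :: nat by (induction b) auto
  then show "rec_nat (xs ! 0) (\<lambda>n y. y - 1) (xs ! 1) = xs ! 0 - xs ! 1" for xs by simp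
qed

lemma recursive_triangle: "recursive 1 (\<lambda>xs. triangle (xs ! 0))"
proof (rule recursive_cong)
  show "recursive 1 (\<lambda>xs. rec_nat 0 (\<lambda>n y. y + Suc n) (xs ! 0))"
    by (intro recursive_rec_nat recursive_proj recursive_zero recursive_Suc recursive_compose2[OF recursive_add]) auto
  have "rec_nat 0 (\<lambda>n y. y + Suc n) a = triangle a" for a by (induction a) auto
  then show "rec_nat 0 (\<lambda>n y. y + Suc n) (xs ! 0) = triangle (xs ! 0)" for xs by simp
qed

lemma recursive_prod_encode: "recursive 2 (\<lambda>xs. prod_encode (xs ! 0, xs ! 1))"
  unfolding prod_encode_def prod.case
  by (intro recursive_compose2[OF recursive_add] recursive_compose1[OF recursive_triangle] recursive_proj) auto

text \<open>As \<open>prod_encode (a, b) = triangle (a + b) + a\<close>, the sum a + b is the least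
  k for which the code lies below the next triangular number. Truncated subtraction turns this
  inequality into an equation with 0, the form that minimisation can search for. Both components are
  then recovered from their sum.\<close>

lemma Least_triangle_prod_encode:
  "(LEAST k. Suc (prod_encode (a, b)) - triangle (Suc k) = 0) = a + b"
proof (rule Least_equality)
  show "Suc (prod_encode (a, b)) - triangle (Suc (a + b)) = 0"
    by (simp add: prod_encode_def)
next
  fix k assume *: "Suc (prod_encode (a, b)) - triangle (Suc k) = 0"
  show "a + b \<le> k"
  proof (rule ccontr)
    assume "\<not> a + b \<le> k"
    then have "triangle (Suc k) \<le> triangle (a + b)"
      unfolding triangle_def by (intro div_le_mono mult_le_mono) auto
    with * show False by (simp add: prod_encode_def)
  qed
qed

lemma
  shows recursive_fst_prod_decode: "recursive 1 (\<lambda>xs. fst (prod_decode (xs ! 0)))"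
    and recursive_snd_prod_decode: "recursive 1 (\<lambda>xs. snd (prod_decode (xs ! 0)))"
proof -
  let ?L = "\<lambda>xs. LEAST k. Suc (xs ! 0) - triangle (Suc k) = 0"
  have L: "?L xs = fst (prod_decode (xs ! 0)) + snd (prod_decode (xs ! 0))" for xs :: "nat list"
    using Least_triangle_prod_encode[of "fst (prod_decode (xs ! 0))" "snd (prod_decode (xs ! 0))"] by simp
  have rL: "recursive 1 ?L"
  proof (rule recursive_Least)
    show "recursive (Suc 1) (\<lambda>zs. Suc (tl zs ! 0) - triangle (Suc (zs ! 0)))"
    proof (rule recursive_cong)
      show "recursive (Suc 1) (\<lambda>zs. Suc (zs ! 1) - triangle (Suc (zs ! 0)))"
        by (intro recursive_compose2[OF recursive_diff] recursive_compose1[OF recursive_triangle]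
          recursive_proj recursive_Suc) auto
    qed (simp add: nth_tl)
    fix xs :: "nat list"
    show "\<exists>n. Suc (xs ! 0) - triangle (Suc n) = 0"
    proof
      show "Suc (xs ! 0) - triangle (Suc (xs ! 0)) = 0" by simp
    qed
  qed
  have 1: "recursive 1 (\<lambda>xs. xs ! 0 - triangle (?L xs))"
    by (intro recursive_compose2[OF recursive_diff] recursive_compose1[OF recursive_triangle] rL recursive_proj) auto
  have eq: "xs ! 0 - triangle (?L xs) = fst (prod_decode (xs ! 0))" for xs :: "nat list"
  proof -
    obtain a b where ab: "xs ! 0 = prod_encode (a, b)"
      by (metis prod_decode_inverse surj_pair)
    have "prod_encode (a, b) = triangle (a + b) + a" by (simp add: prod_encode_def)
    then show ?thesis unfolding L unfolding ab prod_encode_inverse fst_conv snd_conv by linarith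
  qed
  show "recursive 1 (\<lambda>xs. fst (prod_decode (xs ! 0)))" using 1 unfolding eq .
  then have "recursive 1 (\<lambda>xs. ?L xs - fst (prod_decode (xs ! 0)))"
    by (intro recursive_compose2[OF recursive_diff] rL)
  then show "recursive 1 (\<lambda>xs. snd (prod_decode (xs ! 0)))" unfolding L by simp
qed


section \<open>Types in bijection with the natural numbers\<close>

class encodable =
  fixes encode :: "'a \<Rightarrow> nat"
  assumes bij_encode: "bij encode"

definition decode :: "nat \<Rightarrow> 'a::encodable" where "decode = inv_into UNIV encode"

lemma decode_encode [simp]: "decode (encode x) = x"
  unfolding decode_def using bij_encode bij_is_inj inv_f_f by metis

lemma encode_decode [simp]: "encode (decode n :: 'a::encodable) = n"
  unfolding decode_def using bij_encode bij_is_surj surj_f_inv_f by metis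

lemma encode_eq_iff [simp]: "encode x = encode y \<longleftrightarrow> x = y"
  by (metis decode_encode)

instantiation nat :: encodable begin
definition [simp]: "encode (n::nat) = n"
instance by standard (simp add: bij_def inj_def)
end

instantiation prod :: (encodable, encodable) encodable begin
definition "encode p = prod_encode (encode (fst p), encode (snd p))"
instance
proof
  show "bij (encode :: 'a \<times> 'b \<Rightarrow> nat)"
    by (rule o_bij[where g = "\<lambda>n. (decode (fst (prod_decode n)), decode (snd (prod_decode n)))"])
      (auto simp: encode_prod_def)
qed
end

instantiation list :: (encodable) encodable begin
definition "encode xs = list_encode (map encode xs)"
instance
proof
  show "bij (encode :: 'a list \<Rightarrow> nat)"
    by (rule o_bij[where g = "\<lambda>n. map decode (list_decode n)"])
      (auto simp: encode_list_def fun_eq_iff o_def)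
qed
end

lemma encode_Nil [simp]: "encode [] = 0"
  by (simp add: encode_list_def)

lemma encode_Cons: "encode (x # xs) = Suc (prod_encode (encode x, encode xs))"
  by (simp add: encode_list_def)

lemma encode_nat_list [simp]: "encode (xs :: nat list) = list_encode xs"
  by (simp add: encode_list_def map_idI)

text \<open>Encodings are bijective, so every number is a code and no validity check is needed.\<close>

definition computable :: "('a::encodable \<Rightarrow> 'b::encodable) \<Rightarrow> bool" where
  "computable f \<longleftrightarrow> recursive 1 (\<lambda>xs. encode (f (decode (xs ! 0))))"

lemma computable_id: "computable (\<lambda>x. x)"
  unfolding computable_def by (simp add: recursive_proj)

lemma computable_const: "computable (\<lambda>x. c)"
  unfolding computable_def by (rule recursive_const)

lemma computable_compose:
  assumes "computable f" "computable g"
  shows "computable (\<lambda>x. f (g x))"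
  using recursive_compose1[of "\<lambda>n. encode (f (decode n))" 1 "\<lambda>xs. encode (g (decode (xs ! 0)))"] assms
  unfolding computable_def by simp

lemma computable_pair:
  assumes "computable f" "computable g"
  shows "computable (\<lambda>x. (f x, g x))"
  using recursive_compose2[OF recursive_prod_encode] assms
  unfolding computable_def by (simp add: encode_prod_def)

lemma encode_fst: "encode (fst x) = fst (prod_decode (encode x))"
  and encode_snd: "encode (snd x) = snd (prod_decode (encode x))"
  by (simp_all add: encode_prod_def)

lemma computable_apply2:
  assumes "computable (\<lambda>z. f (fst z) (snd z))" "computable a" "computable b"
  shows "computable (\<lambda>x. f (a x) (b x))"
  using computable_compose[OF assms(1) computable_pair[OF assms(2,3)]] by simp

lemma computable_apply3:
  assumes "computable (\<lambda>z. f (fst z) (fst (snd z)) (snd (snd z)))" "computable a" "computable b" "computable c"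
  shows "computable (\<lambda>x. f (a x) (b x) (c x))"
  using computable_compose[OF assms(1) computable_pair[OF assms(2) computable_pair[OF assms(3,4)]]] by simp

lemma computable_fst: "computable f \<Longrightarrow> computable (\<lambda>x. fst (f x))"
  and computable_snd: "computable f \<Longrightarrow> computable (\<lambda>x. snd (f x))"
  unfolding computable_def encode_fst encode_snd
  by (erule recursive_compose1[OF recursive_fst_prod_decode] recursive_compose1[OF recursive_snd_prod_decode])+

lemma computable_Suc: "computable f \<Longrightarrow> computable (\<lambda>x. Suc (f x))"
  unfolding computable_def by (auto intro: recursive_Suc)

lemma computable_diff: "computable f \<Longrightarrow> computable g \<Longrightarrow> computable (\<lambda>x. f x - g x :: nat)"
  unfolding computable_def by (auto intro: recursive_compose2[OF recursive_diff])

lemma computable_add: "computable f \<Longrightarrow> computable g \<Longrightarrow> computable (\<lambda>x. f x + g x :: nat)"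
  unfolding computable_def by (auto intro: recursive_compose2[OF recursive_add])

lemma computable_encode: "computable f \<Longrightarrow> computable (\<lambda>x. encode (f x))"
  and computable_decode: "computable g \<Longrightarrow> computable (\<lambda>x. decode (g x))"
  unfolding computable_def by simp_all

text \<open>Primitive recursion knows only numbers, so a recursion on values of another type is run
  on their codes, with a decoding and an encoding in every round.\<close>

lemma encode_rec_nat:
  "encode (rec_nat b f n) = rec_nat (encode b) (\<lambda>n y. encode (f n (decode y))) n"
  for b :: "'a::encodable"
proof (induction n)
  case (Suc n)
  have "decode (rec_nat (encode b) (\<lambda>n y. encode (f n (decode y))) n) = rec_nat b f n"
    unfolding Suc[symmetric] by simp
  then show ?case by simp
qed simp

lemma computable_rec_nat:
  assumes f: "computable f" and g: "computable (\<lambda>z. g (fst z) (fst (snd z)) (snd (snd z)))" and h: "computable h"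
  shows "computable (\<lambda>x. rec_nat (f x) (\<lambda>n y. g x n y) (h x))"
proof -
  let ?G = "\<lambda>z. g (fst z) (fst (snd z)) (snd (snd z))"
  have *: "encode (?G (decode (prod_encode (a, prod_encode (b, c)))))
     = encode (g (decode a) b (decode c))" for a b c
  proof -
    have "prod_encode (a, prod_encode (b, c)) = encode (decode a :: 'a, b, decode c :: 'b)"
      by (simp add: encode_prod_def)
    then show ?thesis by (simp del: encode_prod_def)
  qed
  \<comment> \<open>Here \<open>zs\<close> consists of the counter, the previous value and the
    parameter, whereas \<open>?G\<close> expects the parameter first.\<close>
  have "recursive (Suc (Suc 1)) (\<lambda>zs. encode (?G (decode (prod_encode (zs ! 2, prod_encode (zs ! 0, zs ! 1))))))"
    using g unfolding computable_def
    by (rule recursive_compose1)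
       (intro recursive_compose2[OF recursive_prod_encode] recursive_proj; simp)
  then have "recursive (Suc (Suc 1)) (\<lambda>zs. encode (g (decode (drop 2 zs ! 0)) (zs ! 0) (decode (zs ! 1))))"
    by (rule recursive_cong) (auto simp: *)
  then show ?thesis
    using recursive_rec_nat[of 1 "\<lambda>xs. encode (f (decode (xs ! 0)))"
        "\<lambda>n y xs. encode (g (decode (xs ! 0)) n (decode y))"
        "\<lambda>xs. encode (h (decode (xs ! 0)))"] f h
    unfolding computable_def encode_rec_nat by simp
qed

lemma computable_Cons: "computable f \<Longrightarrow> computable g \<Longrightarrow> computable (\<lambda>x. f x # g x)"
  unfolding computable_def encode_Cons
  by (intro recursive_Suc recursive_compose2[OF recursive_prod_encode])

text \<open>The value at the empty list is the one that arithmetic on codes produces: the code 0 has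
  predecessor 0, and \<open>prod_decode 0\<close> is (0, 0). This makes \<open>encode_head\<close>
  hold without a case distinction.\<close>

definition head :: "'a::encodable list \<Rightarrow> 'a" where
  "head xs = (case xs of [] \<Rightarrow> decode 0 | x # _ \<Rightarrow> x)"

lemma prod_decode_0: "prod_decode 0 = (0, 0)"
  by (simp add: prod_decode_def prod_decode_aux.simps)

lemma encode_tl: "encode (tl xs) = snd (prod_decode (encode xs - 1))"
  by (cases xs) (auto simp: encode_Cons prod_decode_0)

lemma encode_head: "encode (head xs) = fst (prod_decode (encode xs - 1))"
  by (cases xs) (auto simp: encode_Cons head_def prod_decode_0)

lemma computable_tl: "computable f \<Longrightarrow> computable (\<lambda>x. tl (f x))"
  unfolding computable_def encode_tl
  by (intro recursive_compose1[OF recursive_snd_prod_decode] recursive_compose1[OF recursive_pred])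

lemma computable_head: "computable f \<Longrightarrow> computable (\<lambda>x. head (f x))"
  unfolding computable_def encode_head
  by (intro recursive_compose1[OF recursive_fst_prod_decode] recursive_compose1[OF recursive_pred])

lemma computable_case_nat:
  assumes "computable f" "computable g" "computable n"
  shows "computable (\<lambda>x. if n x = (0::nat) then f x else g x)"
proof -
  have "computable (\<lambda>x. rec_nat (f x) (\<lambda>_ _. g x) (n x))"
    using assms(1) _ assms(3)
    by (rule computable_rec_nat) (intro computable_compose[OF assms(2)] computable_fst computable_id)
  moreover have "rec_nat (f x) (\<lambda>_ _. g x) (n x) = (if n x = 0 then f x else g x)" for x
    by (cases "n x") auto
  ultimately show ?thesis by simp
qed

lemma encode_eq_0_iff: "encode (xs :: 'a::encodable list) = 0 \<longleftrightarrow> xs = []"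
  by (cases xs) (auto simp: encode_Cons)

lemma length_le_encode: "length xs \<le> encode xs"
proof (induction xs)
  case (Cons x xs)
  then show ?case using le_prod_encode_2[of "encode xs" "encode x"] by (simp add: encode_Cons)
qed simp

text \<open>The code of the list serves as the number of rounds. It is available to a program and
  bounds the length, and once the list is used up the remaining rounds change nothing.\<close>

lemma computable_fold:
  assumes f: "computable (\<lambda>z. f (fst z) (fst (snd z)) (snd (snd z)))"
    and l: "computable l" and b: "computable b"
  shows "computable (\<lambda>x. fold (\<lambda>a y. f x a y) (l x) (b x))"
proof -
  define step where "step = (\<lambda>x p. if encode (fst p) = 0 then p else (tl (fst p), f x (head (fst p)) (snd p)))"
  have step: "rec_nat (xs, y) (\<lambda>_. step x) n = (drop n xs, fold (f x) (take n xs) y)" for x xs y n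
  proof (induction n)
    case (Suc n)
    show ?case
    proof (cases "n < length xs")
      case True
      then have "drop n xs = xs ! n # drop (Suc n) xs" by (rule Cons_nth_drop_Suc[symmetric])
      then show ?thesis using Suc True
        by (simp add: step_def encode_eq_0_iff head_def take_Suc_conv_app_nth)
    next
      case False then show ?thesis using Suc by (simp add: step_def)
    qed
  qed simp
  have "computable (\<lambda>x. rec_nat (l x, b x) (\<lambda>n y. step x y) (encode (l x)))"
    unfolding step_def
    by (intro computable_rec_nat computable_case_nat computable_pair computable_encode
        computable_apply3[OF f]
        computable_tl computable_head computable_fst computable_snd computable_id l b)
  then have "computable (\<lambda>x. snd (rec_nat (l x, b x) (\<lambda>n y. step x y) (encode (l x))))"
    by (rule computable_snd)
  then show ?thesis by (simp add: step length_le_encode)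
qed

lemma computable_rev: "computable l \<Longrightarrow> computable (\<lambda>x. rev (l x))"
  unfolding rev_conv_fold
  by (intro computable_fold computable_Cons computable_fst computable_snd computable_id computable_const)

lemma append_conv_fold: "xs @ ys = fold Cons (rev xs) ys"
  by (induction xs) auto

lemma computable_append: "computable f \<Longrightarrow> computable g \<Longrightarrow> computable (\<lambda>x. f x @ g x)"
  unfolding append_conv_fold
  by (intro computable_fold computable_Cons computable_fst computable_snd computable_id computable_rev)

lemma computable_foldr:
  assumes f: "computable (\<lambda>z. f (fst z) (fst (snd z)) (snd (snd z)))"
    and l: "computable l" and b: "computable b"
  shows "computable (\<lambda>x. foldr (f x) (l x) (b x))"
  unfolding foldr_conv_fold by (intro computable_fold computable_rev f l b)

lemma computable_map:
  assumes f: "computable (\<lambda>z. f (fst z) (snd z))" and l: "computable l"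
  shows "computable (\<lambda>x. map (f x) (l x))"
proof -
  have "map (f x) xs = foldr (\<lambda>a y. f x a # y) xs []" for x xs by (induction xs) auto
  moreover have "computable (\<lambda>x. foldr (\<lambda>a y. f x a # y) (l x) [])"
    by (intro computable_foldr computable_Cons l computable_const
      computable_apply2[OF f]
      computable_pair computable_fst computable_snd computable_id)
  ultimately show ?thesis by simp
qed


section \<open>Decidable and semidecidable predicates\<close>

text \<open>The characteristic function is 0 on \<open>P\<close>, because minimisation searches for zeros.\<close>

definition dec :: "('a::encodable \<Rightarrow> bool) \<Rightarrow> bool" where
  "dec P \<longleftrightarrow> computable (\<lambda>x. if P x then 0 else 1 :: nat)"

lemma decidableI:
  assumes "dec (\<lambda>n. n \<notin> S)" shows "decidable S"
proof -
  have d: "decode n = n" for n :: nat by (metis encode_decode encode_nat_def)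
  obtain r where r: "\<forall>xs. length xs = 1 \<longrightarrow>
      rec_eval r xs (encode (if decode (xs ! 0) \<notin> S then 0 else 1 :: nat))"
    using assms unfolding dec_def computable_def recursive_def by (elim exE)
  have "rec_eval r [n] (if n \<in> S then 1 else 0)" for n
    using r[rule_format, of "[n]"] by (cases "n \<in> S") (simp_all add: d)
  then show ?thesis unfolding decidable_def by (intro exI[of _ r] allI)
qed

lemma computable_if:
  assumes "dec P" "computable f" "computable g"
  shows "computable (\<lambda>x. if P x then f x else g x)"
proof -
  have "computable (\<lambda>x. if (if P x then 0 else 1 :: nat) = 0 then f x else g x)"
    by (rule computable_case_nat[OF assms(2,3) assms(1)[unfolded dec_def]])
  moreover have "(if (if P x then 0 else 1 :: nat) = 0 then f x else g x) = (if P x then f x else g x)" for x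
    by simp
  ultimately show ?thesis by simp
qed

lemma dec_const: "dec (\<lambda>x. c)"
  unfolding dec_def by (rule computable_const)

lemma dec_compose: "dec P \<Longrightarrow> computable f \<Longrightarrow> dec (\<lambda>x. P (f x))"
  unfolding dec_def by (rule computable_compose[where f = "\<lambda>x. if P x then 0 else 1"])

lemma dec_apply2:
  assumes "dec (\<lambda>z. P (fst z) (snd z))" "computable a" "computable b"
  shows "dec (\<lambda>x. P (a x) (b x))"
  using dec_compose[OF assms(1) computable_pair[OF assms(2,3)]] by simp

lemma dec_not:
  assumes "dec P" shows "dec (\<lambda>x. \<not> P x)"
proof -
  have "computable (\<lambda>x. if P x then 1 else (0::nat))"
    by (intro computable_if assms computable_const)
  moreover have "(if P x then 1 else 0) = (if \<not> P x then 0 else (1::nat))" for x by simp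
  ultimately show ?thesis unfolding dec_def by simp
qed

lemma dec_conj:
  assumes "dec P" "dec Q" shows "dec (\<lambda>x. P x \<and> Q x)"
proof -
  have "computable (\<lambda>x. if P x then (if Q x then 0 else 1) else (1::nat))"
    by (intro computable_if assms computable_const)
  moreover have "(if P x then (if Q x then 0 else 1) else 1) = (if P x \<and> Q x then 0 else (1::nat))" for x by simp
  ultimately show ?thesis unfolding dec_def by simp
qed

lemma dec_disj:
  assumes "dec P" "dec Q" shows "dec (\<lambda>x. P x \<or> Q x)"
proof -
  have "dec (\<lambda>x. \<not> (\<not> P x \<and> \<not> Q x))"
    by (rule dec_not, rule dec_conj; rule dec_not, rule assms)
  then show ?thesis by simp
qed

lemma dec_imp:
  assumes "dec P" "dec Q" shows "dec (\<lambda>x. P x \<longrightarrow> Q x)"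
  unfolding imp_conv_disj by (rule dec_disj, rule dec_not, (rule assms)+)

lemma dec_eq:
  assumes "computable f" "computable g" shows "dec (\<lambda>x. f x = g x)"
proof -
  let ?n = "\<lambda>x. (encode (f x) - encode (g x)) + (encode (g x) - encode (f x))"
  have "computable (\<lambda>x. if ?n x = 0 then 0 else 1 :: nat)"
    by (intro computable_case_nat computable_add computable_diff computable_encode assms computable_const)
  moreover have "?n x = 0 \<longleftrightarrow> f x = g x" for x
  proof -
    have "f x = g x \<longleftrightarrow> encode (f x) = encode (g x)" by simp
    then show ?thesis by arith
  qed
  ultimately show ?thesis unfolding dec_def by simp
qed

lemma dec_Ball:
  assumes P: "dec (\<lambda>z. P (fst z) (snd z))" and l: "computable l"
  shows "dec (\<lambda>x. \<forall>a\<in>set (l x). P x a)"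
proof -
  have *: "foldr (\<lambda>a y. if P x a then y else 1) xs 0 = (if \<forall>a\<in>set xs. P x a then 0 else 1 :: nat)" for x xs
    by (induction xs) auto
  have "computable (\<lambda>x. foldr (\<lambda>a y. if P x a then y else 1) (l x) (0::nat))"
    by (intro computable_foldr computable_if l computable_const
      dec_apply2[OF P]
      computable_pair computable_fst computable_snd computable_id)
  then show ?thesis unfolding * dec_def .
qed

lemma dec_Bex:
  assumes "dec (\<lambda>z. P (fst z) (snd z))" and "computable l"
  shows "dec (\<lambda>x. \<exists>a\<in>set (l x). P x a)"
proof -
  have "dec (\<lambda>x. \<not> (\<forall>a\<in>set (l x). \<not> P x a))"
    by (rule dec_not, rule dec_Ball, rule dec_not, (rule assms)+)
  then show ?thesis by simp
qed

lemma dec_member: 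
  assumes "computable f" "computable l" shows "dec (\<lambda>x. f x \<in> set (l x))"
proof -
  have "dec (\<lambda>x. \<exists>a\<in>set (l x). a = f x)"
    by (intro dec_Bex dec_eq computable_snd computable_id computable_compose[OF assms(1)] computable_fst assms(2))
  then show ?thesis by simp
qed

lemma dec_less: "computable f \<Longrightarrow> computable g \<Longrightarrow> dec (\<lambda>x. f x < (g x :: nat))"
proof -
  assume "computable f" "computable g"
  then have "dec (\<lambda>x. Suc (f x) - g x = 0)"
    by (intro dec_eq computable_diff computable_Suc computable_const)
  then show ?thesis by (simp add: Suc_le_eq)
qed

lemma computable_Least:
  assumes "dec (\<lambda>z. P (fst z) (snd z))" "\<And>x. \<exists>n. P x n"
  shows "computable (\<lambda>x. LEAST n. P x (n::nat))"
proof -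
  let ?f = "\<lambda>n x. if P x n then 0 else 1 :: nat"
  have "recursive (Suc 1) (\<lambda>zs. prod_encode (zs ! 1, zs ! 0))"
    by (intro recursive_compose2[OF recursive_prod_encode] recursive_proj) auto
  from recursive_compose1[OF assms(1)[unfolded dec_def computable_def] this]
  have "recursive (Suc 1) (\<lambda>zs. ?f (zs ! 0) (decode (zs ! 1)))"
  proof (rule recursive_cong)
    fix zs :: "nat list"
    have "prod_encode (zs ! 1, zs ! 0) = encode (decode (zs ! 1) :: 'a, zs ! 0)"
      by (simp add: encode_prod_def)
    then have d: "decode (prod_encode (zs ! 1, zs ! 0)) = (decode (zs ! 1) :: 'a, zs ! 0)"
      by simp
    show "encode (?f (snd (decode (prod_encode (zs ! 1, zs ! 0)) :: 'a \<times> nat)) (fst (decode (prod_encode (zs ! 1, zs ! 0)) :: 'a \<times> nat)))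
      = ?f (zs ! 0) (decode (zs ! 1))"
      unfolding d by simp
  qed
  then have "recursive (Suc 1) (\<lambda>zs. ?f (zs ! 0) (decode (tl zs ! 0)))"
    by (rule recursive_cong) (simp add: nth_tl)
  then have "recursive 1 (\<lambda>xs. LEAST n. ?f n (decode (xs ! 0)) = 0)"
    by (rule recursive_Least) (use assms(2) in auto)
  moreover have "(if P x n then 0 else 1 :: nat) = 0 \<longleftrightarrow> P x n" for x n by simp
  ultimately show ?thesis unfolding computable_def encode_nat_def by simp
qed

section \<open>Semidecidability and Post's theorem\<close>

definition semidec :: "('a::encodable \<Rightarrow> bool) \<Rightarrow> bool" where
  "semidec P \<longleftrightarrow> (\<exists>R. dec (\<lambda>z. R (fst z) (snd z)) \<and> (\<forall>x. P x \<longleftrightarrow> (\<exists>y::nat. R x y)))"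

lemma semidecI:
  fixes R :: "'a::encodable \<Rightarrow> 'b::encodable \<Rightarrow> bool"
  assumes "dec (\<lambda>z. R (fst z) (snd z))" "\<And>x. P x \<longleftrightarrow> (\<exists>y. R x y)"
  shows "semidec P"
proof -
  have "dec (\<lambda>z. R (fst z) (decode (snd z)))"
    by (intro dec_apply2[OF assms(1)]
       computable_pair computable_fst computable_decode computable_snd computable_id)
  moreover have "P x \<longleftrightarrow> (\<exists>y. R x (decode y))" for x
    unfolding assms(2) by (metis decode_encode)
  ultimately show ?thesis unfolding semidec_def by (intro exI[of _ "\<lambda>x y. R x (decode y)"]) simp
qed

text \<open>Post's theorem. A witness for \<open>P x\<close> or for its negation always exists, so
  the search for the least one terminates. If \<open>P x\<close> holds, no number is a witness
  against it, so \<open>R\<close> holds at the number found; otherwise \<open>R\<close> holds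
  nowhere.\<close>

lemma dec_if_semidec:
  assumes "semidec P" "semidec (\<lambda>x. \<not> P x)"
  shows "dec P"
proof -
  obtain R where R: "dec (\<lambda>z. R (fst z) (snd z))" "\<And>x. P x \<longleftrightarrow> (\<exists>y::nat. R x y)"
    using assms(1) unfolding semidec_def by blast
  obtain S where S: "dec (\<lambda>z. S (fst z) (snd z))" "\<And>x. \<not> P x \<longleftrightarrow> (\<exists>y::nat. S x y)"
    using assms(2) unfolding semidec_def by blast
  let ?m = "\<lambda>x. LEAST y. R x y \<or> S x y"
  have ex: "\<exists>y. R x y \<or> S x y" for x using R(2) S(2) by blast
  have m: "computable ?m"
    by (rule computable_Least[OF dec_disj[OF R(1) S(1)] ex])
  have "P = (\<lambda>x. R x (?m x))"
    by (rule ext) (use LeastI_ex[OF ex] R(2) S(2) in blast)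
  moreover have "dec (\<lambda>x. R x (?m x))"
    by (intro dec_apply2[OF R(1)]
       computable_pair computable_id m)
  ultimately show ?thesis by simp
qed


section \<open>Higman's lemma\<close>

definition bad_seq :: "'b set \<Rightarrow> (nat \<Rightarrow> 'b list) \<Rightarrow> bool" where
  "bad_seq B f \<longleftrightarrow> (\<forall>n. set (f n) \<subseteq> B) \<and> (\<forall>i j. i < j \<longrightarrow> \<not> subseq (f i) (f j))"

text \<open>The minimal bad sequence of Nash-Williams. \<open>S n g\<close> keeps the first n words
  of g and makes the next one as short as a bad continuation permits. Doing this for every n in
  turn, the diagonal m is bad because its entries up to any index j all occur in the single bad
  sequence \<open>F j\<close>.\<close>

lemma minimal_bad_seq:
  assumes "bad_seq B f"
  obtains m where "bad_seq B m"
    "\<And>n g. bad_seq B g \<Longrightarrow> (\<And>i. i < n \<Longrightarrow> g i = m i) \<Longrightarrow> length (m n) \<le> length (g n)"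
proof -
  define min_from where "min_from n g h \<longleftrightarrow> bad_seq B h \<and> (\<forall>i<n. h i = g i) \<and>
      (\<forall>h'. bad_seq B h' \<and> (\<forall>i<n. h' i = g i) \<longrightarrow> length (h n) \<le> length (h' n))" for n g h
  define S where "S n g = (SOME h. min_from n g h)" for n g
  have "min_from n g (S n g)" if g: "bad_seq B g" for n g
  proof -
    have "bad_seq B g \<and> (\<forall>i<n. g i = g i)" using g by simp
    from ex_has_least_nat[of "\<lambda>h. bad_seq B h \<and> (\<forall>i<n. h i = g i)" g "\<lambda>h. length (h n)", OF this]
    have "\<exists>h. min_from n g h" by (simp add: min_from_def conj_assoc)
    then show ?thesis unfolding S_def by (rule someI_ex)
  qed
  then have S: "\<And>n g. bad_seq B g \<Longrightarrow> bad_seq B (S n g)"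
      "\<And>n g i. bad_seq B g \<Longrightarrow> i < n \<Longrightarrow> S n g i = g i"
      "\<And>n g h. bad_seq B g \<Longrightarrow> bad_seq B h \<Longrightarrow> (\<And>i. i < n \<Longrightarrow> h i = g i) \<Longrightarrow> length (S n g n) \<le> length (h n)"
    unfolding min_from_def by simp_all
  define F where "F = rec_nat (S 0 f) (\<lambda>n g. S (Suc n) g)"
  have F0: "F 0 = S 0 f" and FS: "F (Suc n) = S (Suc n) (F n)" for n
    by (simp_all add: F_def)
  have bad: "bad_seq B (F n)" for n
    by (induction n) (auto simp: F0 FS S assms)
  have agree: "i \<le> n \<Longrightarrow> F (n + k) i = F n i" for i n k
    by (induction k) (auto simp: FS S bad)
  define m where "m n = F n n" for n
  have mF: "m i = F n i" if "i \<le> n" for i n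
    using agree[of i i "n - i"] that by (simp add: m_def)
  show thesis
  proof
    show "bad_seq B m"
      unfolding bad_seq_def
    proof (intro conjI allI impI)
      show "set (m n) \<subseteq> B" for n using bad[of n] by (simp add: m_def bad_seq_def)
      show "\<not> subseq (m i) (m j)" if "i < j" for i j
        using bad[of j] that mF[of i j] by (simp add: bad_seq_def m_def)
    qed
    fix n g assume g: "bad_seq B g" "\<And>i. i < n \<Longrightarrow> g i = m i"
    show "length (m n) \<le> length (g n)"
    proof (cases n)
      case 0
      then show ?thesis using S(3)[OF assms g(1), of 0] by (simp add: m_def F0)
    next
      case (Suc k)
      then show ?thesis using S(3)[OF bad[of k] g(1), of n] g(2) mF[of _ k] by (simp add: m_def FS)
    qed
  qed
qed

text \<open>Infinitely many words of a minimal bad sequence share their first letter, as the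
  alphabet is finite. Deleting it from these words gives another bad sequence that is shorter at the
  first changed position.\<close>

lemma higman:
  fixes f :: "nat \<Rightarrow> 'b list"
  assumes B: "finite B" and f: "\<And>n. set (f n) \<subseteq> B"
  shows "\<exists>i j. i < j \<and> subseq (f i) (f j)"
proof (rule ccontr)
  assume "\<not> ?thesis"
  then have "bad_seq B f" using f by (auto simp: bad_seq_def)
  then obtain m where m: "bad_seq B m"
    and min: "\<And>n g. bad_seq B g \<Longrightarrow> (\<And>i. i < n \<Longrightarrow> g i = m i) \<Longrightarrow> length (m n) \<le> length (g n)"
    using minimal_bad_seq by blast
  have nonempty: "m n \<noteq> []" for n
  proof
    assume "m n = []"
    then have "subseq (m n) (m (Suc n))" by simp
    then show False using m by (auto simp: bad_seq_def)
  qed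
  have "(\<lambda>n. hd (m n)) ` UNIV \<subseteq> B"
  proof
    fix b assume "b \<in> (\<lambda>n. hd (m n)) ` UNIV"
    then obtain n where "b = hd (m n)" by blast
    then have "b \<in> set (m n)" using nonempty by simp
    then show "b \<in> B" using m by (auto simp: bad_seq_def)
  qed
  then have "finite ((\<lambda>n. hd (m n)) ` UNIV)" using B by (rule finite_subset)
  from pigeonhole_infinite[OF _ this] obtain n0 where "infinite {n. hd (m n) = hd (m n0)}"
    by auto
  then obtain a where inf: "infinite {n. hd (m n) = a}" ..
  define \<psi> where "\<psi> = enumerate {n. hd (m n) = a}"
  have hd: "hd (m (\<psi> k)) = a" for k
    using enumerate_in_set[OF inf] by (simp add: \<psi>_def)
  have mono: "k < l \<Longrightarrow> \<psi> k < \<psi> l" for k l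
    using enumerate_mono[OF _ inf] by (simp add: \<psi>_def)
  have split: "m (\<psi> k) = a # tl (m (\<psi> k))" for k
    using nonempty[of "\<psi> k"] hd[of k] by (metis list.collapse)
  \<comment> \<open>The words before position \<open>\<psi> 0\<close> are kept, so that minimality
    of m can be applied to h exactly there.\<close>
  define h where "h i = (if i < \<psi> 0 then m i else tl (m (\<psi> (i - \<psi> 0))))" for i
  have h: "bad_seq B h"
    unfolding bad_seq_def
  proof (intro conjI allI impI notI)
    show "set (h n) \<subseteq> B" for n
    proof -
      have tl: "set (tl xs) \<subseteq> set xs" for xs :: "'b list" by (cases xs) auto
      have "set (m k) \<subseteq> B" for k using m by (simp add: bad_seq_def)
      then show ?thesis unfolding h_def by (simp add: order_trans[OF tl])
    qed
  next
    fix i j :: nat assume ij: "i < j" and s: "subseq (h i) (h j)"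
    consider "j < \<psi> 0" | "i < \<psi> 0" "\<psi> 0 \<le> j" | "\<psi> 0 \<le> i" "\<psi> 0 \<le> j" using ij by linarith
    then show False
    proof cases
      case 1
      then show False using m ij s by (auto simp: h_def bad_seq_def)
    next
      case 2
      let ?k = "\<psi> (j - \<psi> 0)"
      have "subseq (m i) (tl (m ?k))" using s 2 by (simp add: h_def)
      then have "subseq (m i) (a # tl (m ?k))" by (rule list_emb_Cons)
      then have "subseq (m i) (m ?k)" by (simp only: split[symmetric])
      moreover have "i < ?k" using 2 mono[of 0 "j - \<psi> 0"] by (cases "j - \<psi> 0") auto
      ultimately show False using m by (auto simp: bad_seq_def)
    next
      case 3
      then have "subseq (tl (m (\<psi> (i - \<psi> 0)))) (tl (m (\<psi> (j - \<psi> 0))))"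
        using s by (simp add: h_def)
      then have "subseq (a # tl (m (\<psi> (i - \<psi> 0)))) (a # tl (m (\<psi> (j - \<psi> 0))))"
        by simp
      then have "subseq (m (\<psi> (i - \<psi> 0))) (m (\<psi> (j - \<psi> 0)))"
        by (simp only: split[symmetric])
      moreover have "\<psi> (i - \<psi> 0) < \<psi> (j - \<psi> 0)" using 3 ij by (intro mono) auto
      ultimately show False using m by (auto simp: bad_seq_def)
    qed
  qed
  have "length (m (\<psi> 0)) \<le> length (h (\<psi> 0))"
    by (rule min[OF h]) (simp add: h_def)
  also have "\<dots> = length (tl (m (\<psi> 0)))" by (simp add: h_def)
  also have "\<dots> < length (m (\<psi> 0))"
    using nonempty[of "\<psi> 0"] by (cases "m (\<psi> 0)") simp_all
  finally show False by simp
qed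

text \<open>Indices without a later superword are finite in number, since infinitely many would
  enumerate a bad sequence. Beyond all of them a next superword can be chosen forever, and
  transitivity makes the chosen words a chain.\<close>

lemma higman_chain:
  fixes f :: "nat \<Rightarrow> 'b list"
  assumes B: "finite B" and f: "\<And>n. set (f n) \<subseteq> B"
  obtains g where "strict_mono (g :: nat \<Rightarrow> nat)" "\<And>i j. i < j \<Longrightarrow> subseq (f (g i)) (f (g j))"
proof -
  define T where "T = {i. \<forall>j>i. \<not> subseq (f i) (f j)}"
  have "finite T"
  proof (rule ccontr)
    assume inf: "infinite T"
    obtain i j where "i < j" "subseq (f (enumerate T i)) (f (enumerate T j))"
      using higman[OF B, of "\<lambda>n. f (enumerate T n)"] f by blast
    then show False
      using enumerate_in_set[OF inf, of i] enumerate_mono[OF _ inf, of i j] by (auto simp: T_def)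
  qed
  then obtain N where "\<forall>i\<in>T. i < N"
    unfolding finite_nat_set_iff_bounded ..
  then have N: "\<And>i. i \<in> T \<Longrightarrow> i < N" by blast
  have "\<exists>j>i. subseq (f i) (f j)" if "N \<le> i" for i
    using N[of i] that by (auto simp: T_def)
  then obtain nxt where nxt: "\<And>i. N \<le> i \<Longrightarrow> i < nxt i \<and> subseq (f i) (f (nxt i))"
    by metis
  define g where "g = rec_nat N (\<lambda>_. nxt)"
  have g: "g 0 = N" "g (Suc n) = nxt (g n)" for n by (simp_all add: g_def)
  have ge: "N \<le> g n" for n
    by (induction n) (use nxt in \<open>auto simp: g dest: less_imp_le intro: order_trans\<close>)
  have "subseq (f (g i)) (f (g (i + Suc k)))" for i k
  proof (induction k)
    case 0
    then show ?case using nxt[OF ge[of i]] by (simp add: g)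
  next
    case (Suc k)
    then show ?case using nxt[OF ge[of "i + Suc k"]] by (auto simp: g intro: subseq_order.trans)
  qed
  then have "subseq (f (g i)) (f (g j))" if "i < j" for i j
    using less_imp_Suc_add[OF that] by auto
  moreover have "strict_mono g"
    using nxt ge by (auto simp: strict_mono_Suc_iff g)
  ultimately show thesis using that by blast
qed


section \<open>Words over sets of maps into a finite group\<close>

lemma list_mult_Nil [simp]: "list_mult G [] = \<one>\<^bsub>G\<^esub>"
  and list_mult_Cons [simp]: "list_mult G (x # xs) = x \<otimes>\<^bsub>G\<^esub> list_mult G xs"
  by (simp_all add: list_mult_def)

lemma (in monoid) list_mult_closed': "set xs \<subseteq> carrier G \<Longrightarrow> list_mult G xs \<in> carrier G"
  using list_mult_closed[OF monoid_axioms] .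

lemma (in monoid) list_mult_append:
  "set xs \<subseteq> carrier G \<Longrightarrow> set ys \<subseteq> carrier G
    \<Longrightarrow> list_mult G (xs @ ys) = list_mult G xs \<otimes> list_mult G ys"
  by (induction xs) (auto simp: m_assoc list_mult_closed')

text \<open>In the application a letter a is a kind of excursion, an element of \<open>'x\<close> is
  a place carrying a label, and \<open>R a z\<close> says that some excursion of kind a multiplies
  the label at x by \<open>z x\<close>. Two occurrences of a letter may be realized differently, and
  a letter may have no realization at all.\<close>

locale realized_words = group H for H :: "('h, 'm) monoid_scheme" (structure) +
  fixes A :: "'a set" and R :: "'a \<Rightarrow> ('x \<Rightarrow> 'h) \<Rightarrow> bool"
  assumes finite_H: "finite (carrier H)" and finite_A: "finite A"
    and R_A: "R a z \<Longrightarrow> a \<in> A" and R_closed: "R a z \<Longrightarrow> z x \<in> carrier H"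
begin

definition trivial_words :: "'a list set" where
  "trivial_words = {w. \<exists>zs. list_all2 R w zs \<and> (\<forall>x. list_mult H (map (\<lambda>z. z x) zs) = \<one>)}"

text \<open>The image of a word in the relatively free group on \<open>A\<close> of the variety generated by \<open>H\<close>.\<close>

definition rf :: "'a list \<Rightarrow> ('a \<Rightarrow> 'h) \<Rightarrow> 'h" where
  "rf w = (\<lambda>\<phi>\<in>A \<rightarrow>\<^sub>E carrier H. list_mult H (map \<phi> w))"

definition triv :: "'a list \<Rightarrow> bool" where
  "triv w \<longleftrightarrow> set w \<subseteq> A \<and> rf w = rf []"

lemma map_closed: "\<phi> \<in> A \<rightarrow>\<^sub>E carrier H \<Longrightarrow> set w \<subseteq> A \<Longrightarrow> set (map \<phi> w) \<subseteq> carrier H"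
  by (auto simp: PiE_iff)

lemma rf_mem: "set w \<subseteq> A \<Longrightarrow> rf w \<in> (A \<rightarrow>\<^sub>E carrier H) \<rightarrow>\<^sub>E carrier H"
  unfolding rf_def using list_mult_closed'[OF map_closed] by auto

lemma rf_append_cong:
  assumes "rf p = rf p'" "set p \<subseteq> A" "set p' \<subseteq> A" "set w \<subseteq> A"
  shows "rf (p @ w) = rf (p' @ w)"
proof -
  have "list_mult H (map \<phi> (p @ w)) = list_mult H (map \<phi> (p' @ w))" if \<phi>: "\<phi> \<in> A \<rightarrow>\<^sub>E carrier H" for \<phi>
    using fun_cong[OF assms(1), of \<phi>] \<phi> map_closed[OF \<phi>] assms(2-4)
    by (simp add: rf_def list_mult_append)
  then show ?thesis unfolding rf_def by (intro restrict_ext)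
qed

lemma triv_if_rf_append:
  assumes "rf (p @ w) = rf p" "set p \<subseteq> A" "set w \<subseteq> A"
  shows "triv w"
proof -
  have "list_mult H (map \<phi> w) = list_mult H (map \<phi> [])" if \<phi>: "\<phi> \<in> A \<rightarrow>\<^sub>E carrier H" for \<phi>
  proof -
    have c: "list_mult H (map \<phi> p) \<in> carrier H" "list_mult H (map \<phi> w) \<in> carrier H"
      using list_mult_closed' map_closed[OF \<phi>] assms by blast+
    have "list_mult H (map \<phi> p) \<otimes> list_mult H (map \<phi> w) = list_mult H (map \<phi> p)"
      using fun_cong[OF assms(1), of \<phi>] \<phi> map_closed[OF \<phi>] assms(2-3)
      by (simp add: rf_def list_mult_append)
    then show ?thesis using c by (simp add: r_cancel_one)
  qed
  then show ?thesis using assms unfolding triv_def rf_def by (auto intro!: restrict_ext)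
qed

lemma triv_append: "triv x \<Longrightarrow> triv y \<Longrightarrow> triv (x @ y)"
  using rf_append_cong[of x "[]" y] by (auto simp: triv_def)

lemma triv_Nil: "triv []"
  by (simp add: triv_def)

text \<open>The insertion order: v arises from u by inserting trivial factors, one before each
  letter and one at the end. Adjacent insertions merge because trivial words are closed under
  concatenation.\<close>

inductive le :: "'a list \<Rightarrow> 'a list \<Rightarrow> bool" where
  le_Nil: "triv x \<Longrightarrow> le [] x"
| le_Cons: "triv x \<Longrightarrow> le u v \<Longrightarrow> le (a # u) (x @ a # v)"

lemma le_append_left: "triv x \<Longrightarrow> le u v \<Longrightarrow> le u (x @ v)"
  by (erule le.cases) (auto simp: append_assoc[symmetric] simp del: append_assoc intro!: le.intros triv_append)

lemma le_append: "le u u' \<Longrightarrow> le v v' \<Longrightarrow> le (u @ v) (u' @ v')"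
  by (induction rule: le.induct) (auto intro: le_append_left le.intros)

lemma le_refl: "le u u"
  using le_Cons[of "[]"] by (induction u) (auto intro: le_Nil triv_Nil)

text \<open>Each letter carries the image of the prefix before it. The closing entry with
  \<open>None\<close> carries the image of the whole word, so that a factor inserted after the last
  letter is controlled too. The set S will be the set of all letters of the word; having it in every
  entry makes comparable words use the same letters.\<close>

fun ext :: "'a set \<Rightarrow> 'a list \<Rightarrow> 'a list \<Rightarrow> ('a option \<times> (('a \<Rightarrow> 'h) \<Rightarrow> 'h) \<times> 'a set) list" where
  "ext S p [] = [(None, rf p, S)]"
| "ext S p (a # w) = (Some a, rf p, S) # ext S (p @ [a]) w"

lemma set_ext:
  "set p \<subseteq> A \<Longrightarrow> set w \<subseteq> A \<Longrightarrow> S \<subseteq> A \<Longrightarrow>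
    set (ext S p w) \<subseteq> insert None (Some ` A) \<times> ((A \<rightarrow>\<^sub>E carrier H) \<rightarrow>\<^sub>E carrier H) \<times> Pow A"
  by (induction w arbitrary: p) (auto simp: rf_mem)

lemma subseq_ext_set: "subseq (ext S p u) (ext S' p' v) \<Longrightarrow> S = S'"
proof -
  have *: "x \<in> set (ext S p u) \<Longrightarrow> snd (snd x) = S" for x S p u
    by (induction u arbitrary: p) auto
  have "hd (ext S p u) \<in> set (ext S p u)" by (cases u) auto
  moreover assume "subseq (ext S p u) (ext S' p' v)"
  ultimately have "hd (ext S p u) \<in> set (ext S' p' v)"
    by (auto elim: list_emb_set)
  from *[OF this] *[OF \<open>hd (ext S p u) \<in> set (ext S p u)\<close>] show ?thesis by simp
qed

text \<open>Higman's order on words decorated with the images of their prefixes refines \<open>le\<close>: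
  equal decorations force the factor inserted between them to be trivial.\<close>

lemma le_if_subseq_ext:
  assumes "subseq (ext S p u) (ext S' p' v)" "set p \<subseteq> A" "set p' \<subseteq> A" "set u \<subseteq> A" "set v \<subseteq> A"
  shows "\<exists>x y. v = x @ y \<and> rf (p' @ x) = rf p \<and> le u y"
  using assms
proof (induction v arbitrary: p p' u)
  case Nil
  then show ?case
    by (cases u) (auto simp: subseq_singleton_left intro: le_Nil triv_Nil dest: list_emb_length split: if_splits)
next
  case (Cons b v)
  have skip: ?case if s: "subseq (ext S p u) (ext S' (p' @ [b]) v)"
  proof -
    obtain x y where "v = x @ y" "rf ((p' @ [b]) @ x) = rf p" "le u y"
      using Cons.IH[OF s] Cons.prems(2-5) by auto
    then show ?thesis by (intro exI[of _ "b # x"] exI[of _ y]) simp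
  qed
  show ?case
  proof (cases u)
    case u: Nil
    then show ?thesis using Cons.prems(1) by (intro skip) simp
  next
    case u: (Cons a u')
    show ?thesis
    proof (cases "a = b \<and> rf p = rf p' \<and> S = S'")
      case True
      then have "subseq (ext S (p @ [a]) u') (ext S' (p' @ [a]) v)"
        using Cons.prems(1) u by simp
      then obtain x y where xy: "v = x @ y" "rf ((p' @ [a]) @ x) = rf (p @ [a])" "le u' y"
        using Cons.IH[of "p @ [a]" u' "p' @ [a]"] Cons.prems u by auto
      have "rf (p @ [a]) = rf (p' @ [a])"
        using True Cons.prems u by (intro rf_append_cong) auto
      then have "triv x"
        using xy Cons.prems u by (intro triv_if_rf_append[of "p' @ [a]"]) auto
      then have "le u (b # v)"
        using xy True le_Cons[OF triv_Nil le_append_left[of x u' y], of a] u by simp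
      then show ?thesis using True by (intro exI[of _ "[]"] exI[of _ "b # v"]) simp
    next
      case False
      then show ?thesis using Cons.prems(1) u by (intro skip) (auto split: if_splits)
    qed
  qed
qed

text \<open>The letters of u keep their realizations, and every inserted letter a gets the fixed
  realization \<open>z a\<close>. At a place x this amounts to the map sending a to
  \<open>z a x\<close>, and an inserted factor is trivial under every map from letters to
  \<open>H\<close>.\<close>

lemma le_realize:
  assumes "le u v" "list_all2 R u zs" "set v \<subseteq> S" "\<And>a. a \<in> S \<Longrightarrow> R a (z a)"
  shows "\<exists>ys. list_all2 R v ys \<and>
    (\<forall>x. list_mult H (map (\<lambda>\<zeta>. \<zeta> x) ys) = list_mult H (map (\<lambda>\<zeta>. \<zeta> x) zs))"
proof -
  have triv_z: "list_mult H (map (\<lambda>\<zeta>. \<zeta> x) (map z w)) = \<one>" "list_all2 R w (map z w)"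
    if w: "triv w" "set w \<subseteq> S" for w x
  proof -
    \<comment> \<open>A map on all of A is needed; letters outside S get the value one, and w
      contains none of them.\<close>
    let ?\<phi> = "\<lambda>a\<in>A. if a \<in> S then z a x else \<one>"
    have "?\<phi> \<in> A \<rightarrow>\<^sub>E carrier H" using R_closed[OF assms(4)] by auto
    note mem = restrict_apply'[OF this]
    have "rf w ?\<phi> = rf [] ?\<phi>" using w(1) by (simp only: triv_def)
    then have "list_mult H (map ?\<phi> w) = \<one>"
      unfolding rf_def mem by simp
    moreover have "map ?\<phi> w = map (\<lambda>\<zeta>. \<zeta> x) (map z w)"
      using w by (auto simp: triv_def subset_iff)
    ultimately show "list_mult H (map (\<lambda>\<zeta>. \<zeta> x) (map z w)) = \<one>" by simp
    show "list_all2 R w (map z w)"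
      using w(2) assms(4) by (auto simp: list_all2_conv_all_nth intro!: assms(4) dest: nth_mem)
  qed
  have closed: "list_all2 R w ys \<Longrightarrow> (\<lambda>\<zeta>. \<zeta> x) ` set ys \<subseteq> carrier H" for w ys x
    using R_closed by (fastforce simp: list_all2_conv_all_nth in_set_conv_nth)
  show ?thesis
    using assms(1-3)
  proof (induction arbitrary: zs rule: le.induct)
    case (le_Nil w)
    then show ?case by (intro exI[of _ "map z w"]) (simp add: triv_z del: map_map)
  next
    case (le_Cons w u v a)
    obtain \<zeta> zs' where zs: "zs = \<zeta> # zs'" "R a \<zeta>" "list_all2 R u zs'"
      using le_Cons.prems(1) by (auto simp: list_all2_Cons1)
    obtain ys where ys: "list_all2 R v ys"
      "\<And>x. list_mult H (map (\<lambda>\<zeta>. \<zeta> x) ys) = list_mult H (map (\<lambda>\<zeta>. \<zeta> x) zs')"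
      using le_Cons.IH[OF zs(3)] le_Cons.prems(2) by auto
    have w: "triv w" "set w \<subseteq> S" using le_Cons by auto
    have "list_all2 R (w @ a # v) (map z w @ \<zeta> # ys)"
      using triv_z(2)[OF w] zs(2) ys(1) by (simp add: list_all2_appendI)
    moreover have "list_mult H (map (\<lambda>\<zeta>. \<zeta> x) (map z w @ \<zeta> # ys)) = list_mult H (map (\<lambda>\<zeta>. \<zeta> x) zs)" for x
    proof -
      have c: "\<zeta> x \<in> carrier H" "(\<lambda>\<zeta>. \<zeta> x) ` set ys \<subseteq> carrier H" "(\<lambda>\<zeta>. \<zeta> x) ` set (map z w) \<subseteq> carrier H"
        using R_closed zs(2) closed[OF ys(1)] closed[OF triv_z(2)[OF w]] by blast+
      have "list_mult H (map (\<lambda>\<zeta>. \<zeta> x) (map z w @ \<zeta> # ys))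
          = list_mult H (map (\<lambda>\<zeta>. \<zeta> x) (map z w)) \<otimes> list_mult H (map (\<lambda>\<zeta>. \<zeta> x) (\<zeta> # ys))"
        unfolding map_append by (rule list_mult_append) (use c in auto)
      also have "\<dots> = list_mult H (map (\<lambda>\<zeta>. \<zeta> x) (\<zeta> # ys))"
        unfolding triv_z(1)[OF w] by (rule l_one, rule list_mult_closed') (use c in auto)
      also have "\<dots> = list_mult H (map (\<lambda>\<zeta>. \<zeta> x) zs)"
        by (simp add: zs(1) ys(2))
      finally show ?thesis .
    qed
    ultimately show ?case by blast
  qed
qed

text \<open>Equality of the letter sets is what supplies realizations: each letter inserted into u
  also occurs in u, where it is realized.\<close>

lemma trivial_words_upward:
  assumes "u \<in> trivial_words" "le u v" "set u = set v"
  shows "v \<in> trivial_words"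
proof -
  obtain zs where zs: "list_all2 R u zs" "\<And>x. list_mult H (map (\<lambda>z. z x) zs) = \<one>"
    using assms(1) by (auto simp: trivial_words_def)
  have "\<exists>\<zeta>. R a \<zeta>" if "a \<in> set v" for a
    using zs(1) that unfolding assms(3)[symmetric]
    by (metis in_set_conv_nth list_all2_conv_all_nth)
  then obtain z where "\<And>a. a \<in> set v \<Longrightarrow> R a (z a)" by metis
  from le_realize[OF assms(2) zs(1) order_refl this] show ?thesis
    unfolding trivial_words_def using zs(2) by auto
qed

lemma trivial_words_subset: "w \<in> trivial_words \<Longrightarrow> set w \<subseteq> A"
proof -
  assume "w \<in> trivial_words"
  then obtain zs where zs: "list_all2 R w zs" unfolding trivial_words_def by blast
  then have "w ! i \<in> A" if "i < length w" for i
    using that R_A[of "w ! i" "zs ! i"] by (simp add: list_all2_conv_all_nth)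
  then show ?thesis by (auto simp: in_set_conv_nth)
qed

section \<open>Regularity of the set of trivial words\<close>

definition residual :: "'a list \<Rightarrow> 'a list set" where
  "residual w = {v. w @ v \<in> trivial_words}"

text \<open>Infinitely many residuals would give, by Higman's lemma, words whose residuals form a
  strictly increasing chain. A second use of the lemma, on words \<open>v i\<close> that separate
  neighbours in the chain, finds two comparable ones; upward closure then puts the larger into a
  residual that it was chosen to avoid.\<close>

theorem finite_residuals: "finite (range residual)"
proof (rule ccontr)
  assume "infinite (range residual)"
  \<comment> \<open>A word with a letter outside A has the empty residual.\<close>
  moreover have "range residual \<subseteq> insert {} (residual ` lists A)"
    using trivial_words_subset by (fastforce simp: residual_def)
  ultimately have "infinite (residual ` lists A)"
    by (meson finite_insert finite_subset)
  then obtain r :: "nat \<Rightarrow> 'a list set" where r: "inj r" "range r \<subseteq> residual ` lists A"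
    using infinite_countable_subset[of "residual ` lists A"] by auto
  have "\<exists>w. set w \<subseteq> A \<and> r n = residual w" for n
  proof -
    have "r n \<in> residual ` lists A" using r(2) by (rule subsetD) simp
    then show ?thesis by auto
  qed
  then obtain w where w: "\<And>n. set (w n) \<subseteq> A" "\<And>n. r n = residual (w n)" by metis
  have fin: "finite (insert None (Some ` A) \<times> ((A \<rightarrow>\<^sub>E carrier H) \<rightarrow>\<^sub>E carrier H) \<times> Pow A)"
    using finite_A finite_H by (intro finite_cartesian_product finite_PiE) auto
  have chain: "\<exists>g. strict_mono (g::nat\<Rightarrow>nat) \<and> (\<forall>i j. i < j \<longrightarrow> le (u (g i)) (u (g j)) \<and> set (u (g i)) = set (u (g j)))"
    if u: "\<And>n. set (u n) \<subseteq> A" for u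
  proof -
    define E where "E n = ext (set (u n)) [] (u n)" for n
    obtain g where g: "strict_mono (g::nat\<Rightarrow>nat)" "\<And>i j. i < j \<Longrightarrow> subseq (E (g i)) (E (g j))"
      using higman_chain[OF fin, of E] set_ext[of "[]"] u unfolding E_def by (metis empty_subsetI list.set(1))
    have "le (u (g i)) (u (g j)) \<and> set (u (g i)) = set (u (g j))" if "i < j" for i j
    proof -
      have s: "subseq (ext (set (u (g i))) [] (u (g i))) (ext (set (u (g j))) [] (u (g j)))"
        using g(2)[OF that] by (simp add: E_def)
      obtain x y where xy: "u (g j) = x @ y" "rf x = rf []" "le (u (g i)) y"
        using le_if_subseq_ext[OF s] u by auto
      then have "triv x" using u[of "g j"] by (auto simp: triv_def)
      then show ?thesis using le_append_left[OF _ xy(3), of x] xy(1) subseq_ext_set[OF s] by simp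
    qed
    then show ?thesis using g(1) by blast
  qed
  from chain[OF w(1)] obtain g :: "nat \<Rightarrow> nat" where "strict_mono g \<and>
    (\<forall>i j. i < j \<longrightarrow> le (w (g i)) (w (g j)) \<and> set (w (g i)) = set (w (g j)))" ..
  then have g: "strict_mono g"
    "\<And>i j. i < j \<Longrightarrow> le (w (g i)) (w (g j)) \<and> set (w (g i)) = set (w (g j))"
    by simp_all
  have mono: "residual (w (g i)) \<subseteq> residual (w (g j))" if "i < j" for i j
    using trivial_words_upward g(2)[OF that] le_append[OF _ le_refl]
    by (auto simp: residual_def)
  define v where "v i = (SOME v. v \<in> residual (w (g (Suc i))) - residual (w (g i)))" for i
  have "v i \<in> residual (w (g (Suc i))) - residual (w (g i))" for i
  proof -
    have "r (g i) \<noteq> r (g (Suc i))"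
      using injD[OF r(1)] strict_mono_eq[OF g(1)] n_not_Suc_n by blast
    then have "\<exists>v. v \<in> residual (w (g (Suc i))) - residual (w (g i))"
      using mono[of i "Suc i"] unfolding w(2) by blast
    then show ?thesis unfolding v_def by (rule someI_ex)
  qed
  then have v: "\<And>i. v i \<in> residual (w (g (Suc i)))" "\<And>i. v i \<notin> residual (w (g i))"
    by blast+
  have "set (v i) \<subseteq> A" for i
    using v(1)[of i] trivial_words_subset[of "w (g (Suc i)) @ v i"] by (simp add: residual_def)
  from chain[OF this] obtain h :: "nat \<Rightarrow> nat" where "strict_mono h \<and>
    (\<forall>i j. i < j \<longrightarrow> le (v (h i)) (v (h j)) \<and> set (v (h i)) = set (v (h j)))" ..
  then have h: "strict_mono h"
    "\<And>i j. i < j \<Longrightarrow> le (v (h i)) (v (h j)) \<and> set (v (h i)) = set (v (h j))"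
    by simp_all
  \<comment> \<open>The word \<open>v ?i\<close> enters the chain at stage \<open>Suc ?i\<close>,
    hence belongs to stage \<open>?j\<close>; the larger word \<open>v ?j\<close> follows it there,
    although it was chosen outside stage \<open>?j\<close>.\<close>
  let ?i = "h 0" and ?j = "h 1"
  have ij: "?i < ?j" using h(1) by (simp add: strict_mono_def)
  have "v ?i \<in> residual (w (g ?j))"
  proof (cases "Suc ?i = ?j")
    case True
    then show ?thesis using v(1)[of ?i] by simp
  next
    case False
    then show ?thesis using v(1)[of ?i] mono[of "Suc ?i" ?j] ij by auto
  qed
  then have "v ?j \<in> residual (w (g ?j))"
    using trivial_words_upward[of "w (g ?j) @ v ?i" "w (g ?j) @ v ?j"] h(2)[of 0 1] le_append[OF le_refl]
    by (auto simp: residual_def)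
  then show False using v(2) by blast
qed

end


section \<open>Machines walking on a tree\<close>

text \<open>The directions \<open>2 * k\<close> and \<open>2 * k + 1\<close> are opposite to each other. No machine moves in the
  directions 0 and 1: the root of a run counts as being entered in the direction 0.\<close>

definition opp :: "nat \<Rightarrow> nat" where
  "opp d = (if even d then Suc d else d - 1)"

lemma opp_neq [simp]: "d \<noteq> opp d"
  by (auto simp: opp_def elim: oddE)

text \<open>A vertex is the list of the directions leading to it, the last one first. The log entry
  \<open>((u, t), h)\<close> records that the label of the vertex \<open>u\<close> in the coset \<open>t\<close> was multiplied by \<open>h\<close>.\<close>

type_synonym log = "((nat list \<times> nat) \<times> nat) list"

definition shift :: "nat \<Rightarrow> log \<Rightarrow> log" where
  "shift d l = map (\<lambda>((u, t), h). ((u @ [d], t), h)) l"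

lemma shift_Nil [simp]: "shift d [] = []"
  and shift_append [simp]: "shift d (l @ l') = shift d l @ shift d l'"
  by (simp_all add: shift_def)

text \<open>Letters describe a run as seen from one vertex: \<open>Lab t h\<close> logs a label there, and
  \<open>Exc d p q\<close> is an excursion in the direction \<open>d\<close> that departs in state \<open>p\<close> and comes back in
  state \<open>q\<close>. The first component is the class of a letter; letters of different classes act on
  disjoint sets of labels and hence commute.\<close>

type_synonym letter = "(nat \<times> nat) \<times> nat \<times> nat"

abbreviation Lab :: "nat \<Rightarrow> nat \<Rightarrow> letter" where
  "Lab t h \<equiv> ((0, t), h, 0)"

abbreviation Exc :: "nat \<Rightarrow> nat \<Rightarrow> nat \<Rightarrow> letter" where
  "Exc d p q \<equiv> ((Suc 0, d), p, q)"

text \<open>A vertex lists its directions with the last one first, so \<open>last\<close> is the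
  direction in which the way to it begins. The result is the class of the letters that can touch
  this place.\<close>

definition pcls :: "nat list \<times> nat \<Rightarrow> nat \<times> nat" where
  "pcls x = (if fst x = [] then (0, snd x) else (Suc 0, last (fst x)))"

fun dpath :: "(nat \<times> letter \<times> nat) set \<Rightarrow> nat \<Rightarrow> letter list \<Rightarrow> nat \<Rightarrow> bool" where
  "dpath \<Delta> c [] c' \<longleftrightarrow> c = c'"
| "dpath \<Delta> c (a # w) c' \<longleftrightarrow> (\<exists>c1. (c, a, c1) \<in> \<Delta> \<and> dpath \<Delta> c1 w c')"

lemma dpath_append: "dpath \<Delta> c (u @ v) c' \<longleftrightarrow> (\<exists>c1. dpath \<Delta> c u c1 \<and> dpath \<Delta> c1 v c')"
  by (induction u arbitrary: c) auto

definition eff :: "('h, 'm) monoid_scheme \<Rightarrow> (nat \<Rightarrow> 'h) \<Rightarrow> log \<Rightarrow> nat list \<times> nat \<Rightarrow> 'h" where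
  "eff H hv l x = list_mult H (map (\<lambda>e. hv (snd e)) (filter (\<lambda>e. fst e = x) l))"

locale machine = group H for H :: "('h, 'm) monoid_scheme" (structure) +
  fixes hv :: "nat \<Rightarrow> 'h" and Hc T :: "nat set"
    and eps :: "(nat \<times> nat) set" and lab :: "(nat \<times> nat \<times> nat \<times> nat) set"
    and mov :: "(nat \<times> nat \<times> nat) set"
  assumes hv: "bij_betw hv Hc (carrier H)" and finite_Hc: "finite Hc" and finite_T: "finite T"
    and finite_eps: "finite eps" and finite_lab: "finite lab" and finite_mov: "finite mov"
    and lab_ok: "(p, t, h, q) \<in> lab \<Longrightarrow> t \<in> T \<and> h \<in> Hc"
    and mov_ok: "(p, d, q) \<in> mov \<Longrightarrow> 2 \<le> d"
begin

definition trivial :: "log \<Rightarrow> bool" where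
  "trivial l \<longleftrightarrow> (\<forall>x. eff H hv l x = \<one>)"

text \<open>\<open>sub n b p l q\<close>: a run with log \<open>l\<close> from state \<open>p\<close> to state \<open>q\<close> which starts and ends at the
  same vertex, never leaves it in the direction \<open>b\<close>, and nests excursions at most \<open>n\<close> deep.\<close>

inductive sub :: "nat \<Rightarrow> nat \<Rightarrow> nat \<Rightarrow> log \<Rightarrow> nat \<Rightarrow> bool" where
  sub_refl: "sub n b p [] p"
| sub_eps: "sub n b p l q \<Longrightarrow> (q, r) \<in> eps \<Longrightarrow> sub n b p l r"
| sub_lab: "sub n b p l q \<Longrightarrow> (q, t, h, r) \<in> lab \<Longrightarrow> sub n b p (l @ [(([], t), h)]) r"
| sub_exc: "sub (Suc n) b p l q \<Longrightarrow> e \<noteq> b \<Longrightarrow> (q, e, q') \<in> mov \<Longrightarrow> sub n (opp e) q' l' r'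
    \<Longrightarrow> (r', opp e, r) \<in> mov \<Longrightarrow> sub (Suc n) b p (l @ shift e l') r"

text \<open>The logs that realize a letter. The level n bounds the nesting of excursions and is the
  measure on which the soundness proof for certificates descends.\<close>

definition letter_log :: "nat \<Rightarrow> letter \<Rightarrow> log \<Rightarrow> bool" where
  "letter_log n a l \<longleftrightarrow> (\<exists>t\<in>T. \<exists>h\<in>Hc. a = Lab t h \<and> l = [(([], t), h)]) \<or>
     (\<exists>m d p q p' q' l'. n = Suc m \<and> a = Exc d p q \<and> (p, d, p') \<in> mov \<and>
        sub m (opp d) p' l' q' \<and> (q', opp d, q) \<in> mov \<and> l = shift d l')"

lemma letter_log_Lab [simp]: "letter_log n ((0, t), h, k) l \<longleftrightarrow> t \<in> T \<and> h \<in> Hc \<and> k = 0 \<and> l = [(([], t), h)]"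
  by (auto simp: letter_log_def)

lemma sub_mono: "sub n b p l q \<Longrightarrow> sub (Suc n) b p l q"
  by (induction rule: sub.induct) (auto intro: sub.intros)

lemma sub_mono_le: "sub n b p l q \<Longrightarrow> n \<le> m \<Longrightarrow> sub m b p l q"
  by (induction m) (auto simp: le_Suc_eq intro: sub_mono)

lemma letter_log_mono: "letter_log n a l \<Longrightarrow> letter_log (Suc n) a l"
  unfolding letter_log_def by (blast intro: sub_mono)

lemma letter_log_mono_le: "letter_log n a l \<Longrightarrow> n \<le> m \<Longrightarrow> letter_log m a l"
  by (induction m) (auto simp: le_Suc_eq intro: letter_log_mono)

lemma letter_logs_mono_le: "list_all2 (letter_log n) w ls \<Longrightarrow> n \<le> m \<Longrightarrow> list_all2 (letter_log m) w ls"
  by (erule list_all2_mono) (rule letter_log_mono_le)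

lemma common_level: "list_all2 (\<lambda>a l. \<exists>n. letter_log n a l) w ls \<Longrightarrow> \<exists>n. list_all2 (letter_log n) w ls"
proof (induction rule: list_all2_induct)
  case (Cons a w l ls)
  then obtain n m where "letter_log n a l" "list_all2 (letter_log m) w ls" by blast
  then have "list_all2 (letter_log (max n m)) (a # w) (l # ls)"
    by (auto intro: letter_log_mono_le letter_logs_mono_le)
  then show ?case by blast
qed simp

section \<open>Effects of logs on the labels\<close>

lemma hv_closed: "h \<in> Hc \<Longrightarrow> hv h \<in> carrier H"
  using hv by (auto simp: bij_betw_def)

definition log_ok :: "log \<Rightarrow> bool" where
  "log_ok l \<longleftrightarrow> snd ` set l \<subseteq> Hc"

lemma log_ok_simps [simp]: "log_ok []" "log_ok (l @ l') \<longleftrightarrow> log_ok l \<and> log_ok l'" "log_ok [(x, h)] \<longleftrightarrow> h \<in> Hc"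
  "log_ok (shift d l) \<longleftrightarrow> log_ok l"
  by (auto simp: log_ok_def shift_def image_subset_iff split: prod.splits)

lemma eff_closed: "log_ok l \<Longrightarrow> eff H hv l x \<in> carrier H"
  unfolding eff_def by (rule list_mult_closed') (auto simp: log_ok_def intro!: hv_closed)

lemma eff_Nil [simp]: "eff H hv [] x = \<one>"
  by (simp add: eff_def)

lemma eff_append: "log_ok l \<Longrightarrow> log_ok l' \<Longrightarrow> eff H hv (l @ l') x = eff H hv l x \<otimes> eff H hv l' x"
  unfolding eff_def filter_append map_append
  by (rule list_mult_append) (auto simp: log_ok_def intro!: hv_closed)

lemma eff_single: "h \<in> Hc \<Longrightarrow> eff H hv [(y, h)] x = (if y = x then hv h else \<one>)"
  by (simp add: eff_def hv_closed)

lemma eff_outside: "(\<And>e. e \<in> set l \<Longrightarrow> fst e \<noteq> x) \<Longrightarrow> eff H hv l x = \<one>"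
  by (simp add: eff_def)

lemma eff_shift:
  "eff H hv (shift d l) (u, t) = (if u \<noteq> [] \<and> last u = d then eff H hv l (butlast u, t) else \<one>)"
proof (cases "u \<noteq> [] \<and> last u = d")
  case True
  then obtain v where u: "u = v @ [d]" by (metis append_butlast_last_id)
  have "filter (\<lambda>e. fst e = (u, t)) (shift d l) = map (\<lambda>((u, t), h). ((u @ [d], t), h)) (filter (\<lambda>e. fst e = (v, t)) l)"
    unfolding shift_def filter_map
    by (rule arg_cong[where f = "map _"], rule filter_cong) (auto simp: u)
  then show ?thesis unfolding eff_def using u by (simp add: o_def case_prod_beta)
next
  case False
  have "eff H hv (shift d l) (u, t) = \<one>"
    by (rule eff_outside) (use False in \<open>auto simp: shift_def\<close>)
  then show ?thesis using False by auto
qed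

lemma trivial_shift: "trivial (shift d l) \<longleftrightarrow> trivial l"
proof
  assume *: "trivial (shift d l)"
  have "eff H hv l (u, t) = \<one>" for u t
    using *[unfolded trivial_def, rule_format, of "(u @ [d], t)"] by (simp add: eff_shift)
  then show "trivial l" by (auto simp: trivial_def)
qed (auto simp: trivial_def eff_shift)

lemma sub_ok: "sub n b p l q \<Longrightarrow> log_ok l"
  by (induction rule: sub.induct) (auto dest: lab_ok)

lemma letter_log_ok: "letter_log n a l \<Longrightarrow> log_ok l"
  by (auto simp: letter_log_def dest: sub_ok)

lemma letter_logs_ok: "list_all2 (letter_log n) w ls \<Longrightarrow> log_ok (concat ls)"
  by (induction rule: list_all2_induct) (auto dest: letter_log_ok)

lemma letter_log_pcls: "letter_log n a l \<Longrightarrow> e \<in> set l \<Longrightarrow> pcls (fst e) = fst a"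
  by (auto simp: letter_log_def pcls_def shift_def)

lemma letter_log_eff_outside: "letter_log n a l \<Longrightarrow> pcls x \<noteq> fst a \<Longrightarrow> eff H hv l x = \<one>"
  by (rule eff_outside) (auto dest: letter_log_pcls)

text \<open>An excursion depends on its surroundings only through the states in which it departs and
  returns, and its letter records both. So the letters of a word are realized independently. Whether
  consecutive letters fit together as parts of a run is a separate matter, expressed by
  \<open>nrun\<close>.\<close>

definition L :: "letter list set" where
  "L = {w. \<exists>n ls. list_all2 (letter_log n) w ls \<and> trivial (concat ls)}"

text \<open>Letters of different classes act on disjoint sets of places. Keeping only some classes
  therefore keeps the effect on their places and erases it elsewhere; in particular a realization
  with trivial effect restricts to one with trivial effect.\<close>

lemma eff_filter:
  assumes "list_all2 (letter_log n) w ls"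
  shows "\<exists>ls'. list_all2 (letter_log n) (filter (\<lambda>a. P (fst a)) w) ls' \<and>
    (\<forall>x. eff H hv (concat ls') x = (if P (pcls x) then eff H hv (concat ls) x else \<one>))"
  using assms
proof (induction rule: list_all2_induct)
  case (Cons a w l ls)
  then obtain ls' where ls': "list_all2 (letter_log n) (filter (\<lambda>a. P (fst a)) w) ls'"
    "\<And>x. eff H hv (concat ls') x = (if P (pcls x) then eff H hv (concat ls) x else \<one>)" by blast
  note ok = letter_log_ok[OF Cons(1)] letter_logs_ok[OF ls'(1)] letter_logs_ok[OF Cons(2)]
  note c = eff_closed[OF ok(1)] eff_closed[OF ok(2)] eff_closed[OF ok(3)]
  have out: "P (fst a) \<noteq> P (pcls x) \<Longrightarrow> eff H hv l x = \<one>" for x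
    by (rule letter_log_eff_outside[OF Cons(1)]) auto
  show ?case
  proof (cases "P (fst a)")
    case True
    have "eff H hv (concat (l # ls')) x = (if P (pcls x) then eff H hv (concat (l # ls)) x else \<one>)" for x
      using True ls'(2)[of x] ok out[of x] c by (auto simp: eff_append)
    then show ?thesis using ls'(1) Cons(1) True
      by (intro exI[of _ "l # ls'"]) simp
  next
    case False
    have "eff H hv (concat ls') x = (if P (pcls x) then eff H hv (concat (l # ls)) x else \<one>)" for x
      using False ls'(2)[of x] ok out[of x] c by (auto simp: eff_append)
    then show ?thesis using ls'(1) False
      by (intro exI[of _ ls']) simp
  qed
qed simp

lemma L_Nil: "[] \<in> L"
  unfolding L_def by (auto simp: trivial_def intro!: exI[of _ "[]"])

lemma L_append: "u \<in> L \<Longrightarrow> v \<in> L \<Longrightarrow> u @ v \<in> L"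
proof -
  assume "u \<in> L" "v \<in> L"
  then obtain n ls m ms where *: "list_all2 (letter_log n) u ls" "trivial (concat ls)"
    "list_all2 (letter_log m) v ms" "trivial (concat ms)" by (auto simp: L_def)
  have "list_all2 (letter_log (max n m)) (u @ v) (ls @ ms)"
    using *(1,3) by (intro list_all2_appendI) (auto intro: letter_logs_mono_le)
  moreover have "trivial (concat (ls @ ms))"
    using *(2,4) letter_logs_ok[OF *(1)] letter_logs_ok[OF *(3)] by (auto simp: trivial_def eff_append)
  ultimately show ?thesis unfolding L_def by blast
qed

text \<open>The common source of the rules below, which later become identities between states of
  the automaton of \<open>L\<close>.\<close>

lemma L_replace:
  assumes "\<And>n ls. list_all2 (letter_log n) \<alpha> ls \<Longrightarrow>
      \<exists>ls'. list_all2 (letter_log n) \<beta> ls' \<and> (\<forall>x. eff H hv (concat ls') x = eff H hv (concat ls) x)"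
    and "u @ \<alpha> @ v \<in> L"
  shows "u @ \<beta> @ v \<in> L"
proof -
  obtain n ls where ls: "list_all2 (letter_log n) (u @ \<alpha> @ v) ls" "trivial (concat ls)"
    using assms(2) by (auto simp: L_def)
  then obtain l1 l2 l3 where l: "ls = l1 @ l2 @ l3" "list_all2 (letter_log n) u l1"
      "list_all2 (letter_log n) \<alpha> l2" "list_all2 (letter_log n) v l3"
    by (auto simp: list_all2_append1)
  obtain l2' where l2': "list_all2 (letter_log n) \<beta> l2'" "\<And>x. eff H hv (concat l2') x = eff H hv (concat l2) x"
    using assms(1)[OF l(3)] by blast
  have "list_all2 (letter_log n) (u @ \<beta> @ v) (l1 @ l2' @ l3)"
    using l(2,4) l2'(1) by (auto intro: list_all2_appendI)
  moreover have "trivial (concat (l1 @ l2' @ l3))"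
    using ls(2) letter_logs_ok[OF l(2)] letter_logs_ok[OF l(3)] letter_logs_ok[OF l(4)] letter_logs_ok[OF l2'(1)]
    by (auto simp: trivial_def eff_append l(1) l2'(2))
  ultimately show ?thesis unfolding L_def by blast
qed

lemma L_commute:
  assumes "fst a \<noteq> fst b" "u @ [a, b] @ v \<in> L" shows "u @ [b, a] @ v \<in> L"
  using _ assms(2)
proof (rule L_replace)
  fix n ls assume "list_all2 (letter_log n) [a, b] ls"
  then obtain l l' where l: "ls = [l, l']" "letter_log n a l" "letter_log n b l'"
    by (auto simp: list_all2_Cons1)
  have "eff H hv (concat [l', l]) x = eff H hv (concat ls) x" for x
    using letter_log_eff_outside[OF l(2), of x] letter_log_eff_outside[OF l(3), of x] assms(1)
      letter_log_ok[OF l(2)] letter_log_ok[OF l(3)] eff_closed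
    by (cases "pcls x = fst a") (auto simp: l(1) eff_append)
  then show "\<exists>ls'. list_all2 (letter_log n) [b, a] ls' \<and> (\<forall>x. eff H hv (concat ls') x = eff H hv (concat ls) x)"
    using l by (intro exI[of _ "[l', l]"]) auto
qed

lemma L_Lab_unit:
  assumes "t \<in> T" "h \<in> Hc" "hv h = \<one>"
  shows "u @ [Lab t h] @ v \<in> L \<longleftrightarrow> u @ [] @ v \<in> L"
proof
  assume "u @ [Lab t h] @ v \<in> L"
  with _ show "u @ [] @ v \<in> L"
    by (rule L_replace) (use assms in \<open>auto simp: list_all2_Cons1 eff_single\<close>)
next
  assume "u @ [] @ v \<in> L"
  with _ show "u @ [Lab t h] @ v \<in> L"
    by (rule L_replace) (use assms in \<open>auto simp: list_all2_Cons1 eff_single intro!: exI[of _ "[[(([], t), h)]]"]\<close>)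
qed

lemma L_Lab_mult:
  assumes "t \<in> T" "h \<in> Hc" "h' \<in> Hc" "h'' \<in> Hc" "hv h'' = hv h \<otimes> hv h'"
  shows "u @ [Lab t h, Lab t h'] @ v \<in> L \<longleftrightarrow> u @ [Lab t h''] @ v \<in> L"
proof -
  have e: "eff H hv ([(([], t), h)] @ [(([], t), h')]) x = eff H hv [(([], t), h'')] x" for x
    using assms by (subst eff_append) (auto simp: eff_single)
  show ?thesis
  proof
    assume "u @ [Lab t h, Lab t h'] @ v \<in> L"
    with _ show "u @ [Lab t h''] @ v \<in> L"
      by (rule L_replace) (use assms e in \<open>auto simp: list_all2_Cons1 intro!: exI[of _ "[[(([], t), h'')]]"]\<close>)
  next
    assume "u @ [Lab t h''] @ v \<in> L"
    with _ show "u @ [Lab t h, Lab t h'] @ v \<in> L"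
      by (rule L_replace)
        (use assms e in \<open>auto simp: list_all2_Cons1 intro!: exI[of _ "[[(([], t), h)], [(([], t), h')]]"]\<close>)
  qed
qed

section \<open>Regularity of \<open>L\<close>\<close>

definition letters :: "letter set" where
  "letters = (\<lambda>(t, h). Lab t h) ` (T \<times> Hc) \<union> (\<lambda>((p, d, _), (_, _, q)). Exc d p q) ` (mov \<times> mov)"

lemma letter_log_letters: "letter_log n a l \<Longrightarrow> a \<in> letters"
  unfolding letter_log_def letters_def by (fastforce simp: image_iff)

lemma finite_letters: "finite letters"
  unfolding letters_def using finite_T finite_Hc finite_mov by auto

definition res :: "letter list \<Rightarrow> letter list set" where
  "res w = {v. w @ v \<in> L}"

lemma eff_concat: "list_all2 (letter_log n) w ls \<Longrightarrow> eff H hv (concat ls) x = list_mult H (map (\<lambda>l. eff H hv l x) ls)"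
proof (induction rule: list_all2_induct)
  case (Cons a w l ls)
  then show ?case using letter_log_ok[OF Cons(1)] letter_logs_ok[OF Cons(2)] by (simp add: eff_append)
qed simp

text \<open>If the realizations of a letter are taken to be the effects of its logs of any level,
  then \<open>L\<close> is the set of trivial words of \<open>realized_words\<close>. The levels
  chosen for the letters of one word can be replaced by their maximum.\<close>

lemma finite_range_res: "finite (range res)"
proof -
  interpret W: realized_words H letters "\<lambda>a z. \<exists>n l. letter_log n a l \<and> z = eff H hv l"
  proof unfold_locales
    show "finite (carrier H)" using hv finite_Hc bij_betw_finite by blast
    show "finite letters" by (rule finite_letters)
  qed (auto dest: letter_log_letters letter_log_ok eff_closed)
  have "w \<in> L \<longleftrightarrow> w \<in> W.trivial_words" for w
  proof
    assume "w \<in> L"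
    then obtain n ls where *: "list_all2 (letter_log n) w ls" "trivial (concat ls)" by (auto simp: L_def)
    have "list_all2 (\<lambda>a z. \<exists>n l. letter_log n a l \<and> z = eff H hv l) w (map (eff H hv) ls)"
      unfolding list_all2_map2 by (rule list_all2_mono[OF *(1)]) blast
    moreover have "list_mult H (map (\<lambda>z. z x) (map (eff H hv) ls)) = \<one>" for x
      using *(2)[unfolded trivial_def, rule_format, of x] eff_concat[OF *(1), of x] by (simp add: o_def)
    ultimately show "w \<in> W.trivial_words" unfolding W.trivial_words_def by blast
  next
    assume "w \<in> W.trivial_words"
    then obtain zs where zs: "list_all2 (\<lambda>a z. \<exists>n l. letter_log n a l \<and> z = eff H hv l) w zs"
      "\<And>x. list_mult H (map (\<lambda>z. z x) zs) = \<one>" by (auto simp: W.trivial_words_def)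
    from zs(1) have "\<exists>ls. list_all2 (\<lambda>a l. \<exists>n. letter_log n a l) w ls \<and> zs = map (eff H hv) ls"
    proof (induction rule: list_all2_induct)
      case (Cons a w z zs)
      then obtain n l ls where "letter_log n a l" "z = eff H hv l"
        "list_all2 (\<lambda>a l. \<exists>n. letter_log n a l) w ls" "zs = map (eff H hv) ls" by blast
      then show ?case by (intro exI[of _ "l # ls"]) auto
    qed simp
    then obtain ls n where ls: "list_all2 (letter_log n) w ls" "zs = map (eff H hv) ls"
      using common_level by blast
    then have "trivial (concat ls)"
      using zs(2) eff_concat[OF ls(1)] by (simp add: trivial_def ls(2) o_def)
    then show "w \<in> L" using ls(1) unfolding L_def by blast
  qed
  then have "L = W.trivial_words" by blast
  then have "res = W.residual" by (intro ext) (simp add: res_def W.residual_def)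
  then show ?thesis using W.finite_residuals by simp
qed

text \<open>A run as seen from one vertex, with excursions guessed: only a departing and a returning
  move must exist. Whether a guessed excursion can be carried out is left to
  \<open>letter_log\<close>, and hence to membership in \<open>L\<close>.\<close>

inductive nrun :: "nat \<Rightarrow> nat \<Rightarrow> letter list \<Rightarrow> nat \<Rightarrow> bool" where
  nrun_refl: "nrun b p [] p"
| nrun_eps: "nrun b p x q \<Longrightarrow> (q, r) \<in> eps \<Longrightarrow> nrun b p x r"
| nrun_lab: "nrun b p x q \<Longrightarrow> (q, t, h, r) \<in> lab \<Longrightarrow> nrun b p (x @ [Lab t h]) r"
| nrun_exc: "nrun b p x q \<Longrightarrow> e \<noteq> b \<Longrightarrow> (q, e, q') \<in> mov \<Longrightarrow> (r', opp e, r) \<in> mov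
    \<Longrightarrow> nrun b p (x @ [Exc e q r]) r"

lemma sub_nrun: "sub n b p l q \<Longrightarrow> \<exists>x ls. nrun b p x q \<and> list_all2 (letter_log n) x ls \<and> concat ls = l"
proof (induction rule: sub.induct)
  case (sub_refl n b p)
  then show ?case by (intro exI[of _ "[]"]) (auto intro: nrun_refl)
next
  case (sub_eps n b p l q r)
  then show ?case by (blast intro: nrun_eps)
next
  case (sub_lab n b p l q t h r)
  then obtain x ls where "nrun b p x q" "list_all2 (letter_log n) x ls" "concat ls = l" by blast
  then show ?case using sub_lab(2) lab_ok[OF sub_lab(2)]
    by (intro exI[of _ "x @ [Lab t h]"] exI[of _ "ls @ [[(([], t), h)]]"])
      (auto intro: nrun_lab list_all2_appendI)
next
  case (sub_exc n b p l q e q' l' r' r)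
  then obtain x ls where "nrun b p x q" "list_all2 (letter_log (Suc n)) x ls" "concat ls = l" by blast
  moreover have "letter_log (Suc n) (Exc e q r) (shift e l')"
    using sub_exc by (auto simp: letter_log_def)
  ultimately show ?case using sub_exc
    by (intro exI[of _ "x @ [Exc e q r]"] exI[of _ "ls @ [shift e l']"])
      (auto intro: nrun_exc list_all2_appendI)
qed

lemma nrun_sub: "nrun b p x q \<Longrightarrow> list_all2 (letter_log n) x ls \<Longrightarrow> sub n b p (concat ls) q"
proof (induction arbitrary: ls rule: nrun.induct)
  case (nrun_exc b p x q e q' r' r)
  obtain ls' l where ls: "ls = ls' @ [l]" "list_all2 (letter_log n) x ls'" "letter_log n (Exc e q r) l"
    using nrun_exc.prems by (auto simp: list_all2_append1 list_all2_Cons1)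
  from ls(3) obtain m p' q'' l' where "n = Suc m" "(q, e, p') \<in> mov" "sub m (opp e) p' l' q''"
    "(q'', opp e, r) \<in> mov" "l = shift e l'"
    by (auto simp: letter_log_def)
  then show ?case using nrun_exc.IH[OF ls(2)] nrun_exc.hyps ls(1) by (auto intro: sub_exc)
next
  case (nrun_lab b p x q t h r)
  obtain ls' where ls: "ls = ls' @ [[(([], t), h)]]" "list_all2 (letter_log n) x ls'"
    using nrun_lab.prems by (auto simp: list_all2_append1 list_all2_Cons1)
  then show ?case using sub_lab[OF nrun_lab.IH[OF ls(2)] nrun_lab.hyps(2)] by simp
qed (auto intro: sub.intros)

text \<open>\<open>pat d w x\<close>: the excursions \<open>w\<close> in the direction \<open>d\<close> read \<open>x\<close> at the vertex they visit.\<close>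

inductive pat :: "nat \<Rightarrow> letter list \<Rightarrow> letter list \<Rightarrow> bool" where
  pat_Nil: "pat d [] []"
| pat_snoc: "pat d w x \<Longrightarrow> (p, d, p') \<in> mov \<Longrightarrow> nrun (opp d) p' y r' \<Longrightarrow> (r', opp d, q) \<in> mov
    \<Longrightarrow> pat d (w @ [Exc d p q]) (x @ y)"

lemma pat_letter_log:
  "pat d w x \<Longrightarrow> list_all2 (letter_log n) x ls
    \<Longrightarrow> \<exists>ms. list_all2 (letter_log (Suc n)) w ms \<and> concat ms = shift d (concat ls)"
proof (induction arbitrary: ls rule: pat.induct)
  case (pat_snoc d w x p p' y r' q)
  obtain l1 l2 where ls: "ls = l1 @ l2" "list_all2 (letter_log n) x l1" "list_all2 (letter_log n) y l2"
    using pat_snoc.prems by (auto simp: list_all2_append1)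
  obtain ms where ms: "list_all2 (letter_log (Suc n)) w ms" "concat ms = shift d (concat l1)"
    using pat_snoc.IH[OF ls(2)] by blast
  have "letter_log (Suc n) (Exc d p q) (shift d (concat l2))"
    using pat_snoc.hyps(2,4) nrun_sub[OF pat_snoc.hyps(3) ls(3)] unfolding letter_log_def by blast
  then show ?case using ms ls(1)
    by (intro exI[of _ "ms @ [shift d (concat l2)]"]) (auto intro: list_all2_appendI)
qed simp

text \<open>Several excursions in one direction are viewed together from the vertex that they visit.
  The level drops by one, so a trivial word of excursions becomes a trivial word at a lower
  level.\<close>

lemma letter_log_pat:
  assumes "list_all2 (letter_log (Suc n)) w ms" "\<forall>a\<in>set w. fst a = (Suc 0, d)"
  shows "\<exists>x ls. pat d w x \<and> list_all2 (letter_log n) x ls \<and> concat ms = shift d (concat ls)"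
  using assms
proof (induction w arbitrary: ms rule: rev_induct)
  case Nil
  then show ?case by (intro exI[of _ "[]"]) (auto intro: pat_Nil)
next
  case (snoc a w)
  obtain ms' m where ms: "ms = ms' @ [m]" "list_all2 (letter_log (Suc n)) w ms'" "letter_log (Suc n) a m"
    using snoc.prems(1) by (auto simp: list_all2_append1 list_all2_Cons1)
  obtain x ls where x: "pat d w x" "list_all2 (letter_log n) x ls" "concat ms' = shift d (concat ls)"
    using snoc.IH[OF ms(2)] snoc.prems(2) by auto
  from ms(3) snoc.prems(2) obtain p q p' q' l' where a: "a = Exc d p q" "(p, d, p') \<in> mov"
    "sub n (opp d) p' l' q'" "(q', opp d, q) \<in> mov" "m = shift d l'"
    by (auto simp: letter_log_def)
  obtain y ls2 where y: "nrun (opp d) p' y q'" "list_all2 (letter_log n) y ls2" "concat ls2 = l'"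
    using sub_nrun[OF a(3)] by blast
  show ?case
    using pat_snoc[OF x(1) a(2) y(1) a(4)] x(2,3) y(2,3) a(1,5) ms(1)
    by (intro exI[of _ "x @ y"] exI[of _ "ls @ ls2"]) (auto intro: list_all2_appendI)
qed

text \<open>The rule for composing excursions: moving a log into a subtree preserves its triviality,
  so \<open>L\<close> at the visited vertex determines members of \<open>L\<close> at its
  neighbour.\<close>

lemma pat_L: "pat d w x \<Longrightarrow> x \<in> L \<Longrightarrow> w \<in> L"
  using pat_letter_log unfolding L_def by (auto simp: trivial_shift) (metis trivial_shift)

definition reach :: "nat \<Rightarrow> nat set \<Rightarrow> bool" where
  "reach s F \<longleftrightarrow> (\<exists>n l r. sub n (opp 0) s l r \<and> r \<in> F \<and> trivial l)"

lemma reach_iff: "reach s F \<longleftrightarrow> (\<exists>x\<in>L. \<exists>r\<in>F. nrun (opp 0) s x r)"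
proof
  assume "reach s F"
  then obtain n l r where "sub n (opp 0) s l r" "r \<in> F" "trivial l" by (auto simp: reach_def)
  moreover from sub_nrun[OF this(1)] obtain x ls where
    "nrun (opp 0) s x r" "list_all2 (letter_log n) x ls" "concat ls = l" by blast
  ultimately show "\<exists>x\<in>L. \<exists>r\<in>F. nrun (opp 0) s x r" unfolding L_def by blast
next
  assume "\<exists>x\<in>L. \<exists>r\<in>F. nrun (opp 0) s x r"
  then show "reach s F" unfolding L_def reach_def using nrun_sub by blast
qed

end

text \<open>A finite automaton with transitions \<open>\<Delta>\<close> that accepts at least the words of \<open>L\<close>. The relation
  \<open>I\<close> contains all \<open>(d, c, c')\<close> such that some \<open>pat d w x\<close> leads from \<open>Acc\<close> to \<open>c\<close> along \<open>w\<close> and from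
  \<open>c0\<close> to \<open>c'\<close> along \<open>x\<close>, and \<open>J\<close> follows the last excursion, \<open>p\<close> being the state in which it departed.
  The root of the run is treated as an unfinished excursion with the dummy data \<open>(0, 0, 0)\<close>.\<close>

locale certificate = machine H hv Hc T eps lab mov
  for H :: "('h, 'm) monoid_scheme" (structure) and hv Hc T eps lab mov +
  fixes s :: nat and F :: "nat set" and \<Delta> :: "(nat \<times> letter \<times> nat) set" and Acc :: "nat set" and c0 :: nat
    and I :: "(nat \<times> nat \<times> nat) set" and J :: "((nat \<times> nat \<times> nat) \<times> nat \<times> nat) set"
  assumes c0_Acc: "c0 \<in> Acc"
    and commute: "(c, a, c1) \<in> \<Delta> \<Longrightarrow> (c1, b, c2) \<in> \<Delta> \<Longrightarrow> fst a \<noteq> fst b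
      \<Longrightarrow> \<exists>c3. (c, b, c3) \<in> \<Delta> \<and> (c3, a, c2) \<in> \<Delta>"
    and lab_unit: "t \<in> T \<Longrightarrow> h \<in> Hc \<Longrightarrow> hv h = \<one> \<Longrightarrow> (c, Lab t h, c') \<in> \<Delta> \<Longrightarrow> c' = c"
    and lab_mult: "t \<in> T \<Longrightarrow> h \<in> Hc \<Longrightarrow> h' \<in> Hc \<Longrightarrow> h'' \<in> Hc \<Longrightarrow> hv h'' = hv h \<otimes> hv h'
      \<Longrightarrow> (c, Lab t h, c1) \<in> \<Delta> \<Longrightarrow> (c1, Lab t h', c2) \<in> \<Delta> \<Longrightarrow> (c, Lab t h'', c2) \<in> \<Delta>"
    and I_start: "c \<in> Acc \<Longrightarrow> (p, d, p') \<in> mov \<Longrightarrow> (d, c, c0) \<in> I"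
    and J_open: "(d, c, c') \<in> I \<Longrightarrow> (p, d, p') \<in> mov \<Longrightarrow> ((d, c, p), p', c') \<in> J"
    and J_eps: "(k, r, c') \<in> J \<Longrightarrow> (r, r') \<in> eps \<Longrightarrow> (k, r', c') \<in> J"
    and J_lab: "(k, r, c') \<in> J \<Longrightarrow> (r, t, h, r') \<in> lab
      \<Longrightarrow> \<exists>c''. (c', Lab t h, c'') \<in> \<Delta> \<and> (k, r', c'') \<in> J"
    and J_exc: "(k, r, c') \<in> J \<Longrightarrow> (r, e, q) \<in> mov \<Longrightarrow> (r1, opp e, r') \<in> mov \<Longrightarrow> e \<noteq> opp (fst k)
      \<Longrightarrow> \<exists>c''. (c', Exc e r r', c'') \<in> \<Delta> \<and> (k, r', c'') \<in> J"
    and I_close: "((d, c, p), r, c') \<in> J \<Longrightarrow> (r, opp d, q) \<in> mov \<Longrightarrow> (c, Exc d p q, c2) \<in> \<Delta>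
      \<Longrightarrow> (d, c2, c') \<in> I"
    and I_Acc: "(d, c, c') \<in> I \<Longrightarrow> c' \<in> Acc \<Longrightarrow> c \<in> Acc"
    and J_root: "((0, 0, 0), s, c0) \<in> J"
    and J_final: "((0, 0, 0), r, c') \<in> J \<Longrightarrow> r \<in> F \<Longrightarrow> c' \<notin> Acc"
begin

section \<open>Soundness of certificates\<close>

lemma dpath_move:
  "dpath \<Delta> c (a # u) c' \<Longrightarrow> \<forall>b\<in>set u. fst a \<noteq> fst b \<Longrightarrow> dpath \<Delta> c (u @ [a]) c'"
proof (induction u arbitrary: c)
  case (Cons b u)
  then obtain c1 c2 where *: "(c, a, c1) \<in> \<Delta>" "(c1, b, c2) \<in> \<Delta>" "dpath \<Delta> c2 u c'" "fst a \<noteq> fst b"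
    by auto
  obtain c3 where "(c, b, c3) \<in> \<Delta>" "(c3, a, c2) \<in> \<Delta>"
    using commute[OF *(1,2,4)] by blast
  then show ?case using Cons.IH[of c3] Cons.prems(2) *(3) by auto
qed simp

text \<open>Commutation lets a path be rearranged class by class without changing its ends, so that
  each class can be treated on its own.\<close>

lemma dpath_sort:
  "dpath \<Delta> c w c' \<Longrightarrow> dpath \<Delta> c (filter (\<lambda>a. fst a = \<kappa>) w @ filter (\<lambda>a. fst a \<noteq> \<kappa>) w) c'"
proof (induction w arbitrary: c)
  case (Cons a w)
  then obtain c1 where c1: "(c, a, c1) \<in> \<Delta>"
    "dpath \<Delta> c1 (filter (\<lambda>a. fst a = \<kappa>) w @ filter (\<lambda>a. fst a \<noteq> \<kappa>) w) c'"
    by auto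
  show ?case
  proof (cases "fst a = \<kappa>")
    case True
    then show ?thesis using c1 by auto
  next
    case False
    obtain c2 where c2: "dpath \<Delta> c1 (filter (\<lambda>a. fst a = \<kappa>) w) c2" "dpath \<Delta> c2 (filter (\<lambda>a. fst a \<noteq> \<kappa>) w) c'"
      using c1(2) by (auto simp: dpath_append)
    have "dpath \<Delta> c (filter (\<lambda>a. fst a = \<kappa>) w @ [a]) c2"
      using c1(1) c2(1) False by (intro dpath_move) auto
    then show ?thesis using c2(2) False by (auto simp: dpath_append)
  qed
qed simp

text \<open>\<open>lab_mult\<close> merges neighbouring labels at one coset into their product. The
  word must be nonempty because a transition for the unit label is not guaranteed to exist;
  \<open>lab_unit\<close> only says where it leads.\<close>

lemma dpath_Lab:
  assumes "list_all2 (letter_log n) v ls" "\<forall>a\<in>set v. fst a = (0, t)" "dpath \<Delta> c v c'" "v \<noteq> []"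
  shows "\<exists>h\<in>Hc. t \<in> T \<and> hv h = eff H hv (concat ls) ([], t) \<and> (c, Lab t h, c') \<in> \<Delta>"
  using assms
proof (induction arbitrary: c rule: list_all2_induct)
  case (Cons a v l ls)
  then obtain h where h: "a = Lab t h" "l = [(([], t), h)]" "h \<in> Hc" "t \<in> T"
    by (cases a) auto
  obtain c1 where c1: "(c, Lab t h, c1) \<in> \<Delta>" "dpath \<Delta> c1 v c'" using Cons h by auto
  show ?case
  proof (cases "v = []")
    case True
    then show ?thesis using Cons h c1 by (auto simp: eff_single)
  next
    case False
    then obtain h' where h': "h' \<in> Hc" "hv h' = eff H hv (concat ls) ([], t)" "(c1, Lab t h', c') \<in> \<Delta>"
      using Cons.IH[OF _ c1(2)] Cons.prems by auto
    have "hv h \<otimes> hv h' \<in> hv ` Hc"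
      unfolding bij_betw_imp_surj_on[OF hv] by (intro m_closed hv_closed h h')
    then obtain h'' where h'': "h'' \<in> Hc" "hv h'' = hv h \<otimes> hv h'" by auto
    have "(c, Lab t h'', c') \<in> \<Delta>" by (rule lab_mult[OF h(4,3) h'(1) h'' c1(1) h'(3)])
    moreover have "hv h'' = eff H hv (concat (l # ls)) ([], t)"
      using h h' h'' letter_logs_ok[OF Cons(2)] eff_append[of "[(([], t), h)]" "concat ls" "([], t)"]
      by (simp add: eff_single)
    ultimately show ?thesis using h'' h by blast
  qed
qed simp

text \<open>\<open>\<Delta>\<close> may be partial and nondeterministic; \<open>J_lab\<close> and
  \<open>J_exc\<close> ensure that it never gets stuck on a word that a run reads.\<close>

lemma nrun_J:
  assumes "nrun b p x r" "b = opp (fst k)" "(k, p, c) \<in> J"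
  shows "\<exists>c'. dpath \<Delta> c x c' \<and> (k, r, c') \<in> J"
  using assms
proof (induction rule: nrun.induct)
  case (nrun_eps b p x q r)
  then show ?case using J_eps by blast
next
  case (nrun_lab b p x q t h r)
  obtain c' where c': "dpath \<Delta> c x c'" "(k, q, c') \<in> J" using nrun_lab by blast
  obtain c'' where "(c', Lab t h, c'') \<in> \<Delta>" "(k, r, c'') \<in> J"
    using J_lab[OF c'(2) nrun_lab.hyps(2)] by blast
  then show ?case using c'(1) by (auto simp: dpath_append)
next
  case (nrun_exc b p x q e q' r' r)
  obtain c' where c': "dpath \<Delta> c x c'" "(k, q, c') \<in> J" using nrun_exc by blast
  have "e \<noteq> opp (fst k)" using nrun_exc.hyps(2) nrun_exc.prems(1) by simp
  from J_exc[OF c'(2) nrun_exc.hyps(3,4) this]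
  obtain c'' where "(c', Exc e q r, c'') \<in> \<Delta>" "(k, r, c'') \<in> J" by blast
  then show ?case using c'(1) by (auto simp: dpath_append)
qed auto

lemma pat_I:
  "pat d w x \<Longrightarrow> dpath \<Delta> c w c1 \<Longrightarrow> (d, c, c0) \<in> I \<Longrightarrow> \<exists>c'. dpath \<Delta> c0 x c' \<and> (d, c1, c') \<in> I"
proof (induction arbitrary: c1 rule: pat.induct)
  case (pat_snoc d w x p p' y r' q)
  obtain c2 where c2: "dpath \<Delta> c w c2" "(c2, Exc d p q, c1) \<in> \<Delta>"
    using pat_snoc.prems(1) by (auto simp: dpath_append)
  obtain c' where c': "dpath \<Delta> c0 x c'" "(d, c2, c') \<in> I"
    using pat_snoc.IH[OF c2(1) pat_snoc.prems(2)] by blast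
  have "((d, c2, p), p', c') \<in> J" by (rule J_open[OF c'(2) pat_snoc.hyps(2)])
  from nrun_J[OF pat_snoc.hyps(3) _ this] obtain c'' where c'':
    "dpath \<Delta> c' y c''" "((d, c2, p), r', c'') \<in> J" by auto
  have "(d, c1, c'') \<in> I" by (rule I_close[OF c''(2) pat_snoc.hyps(4) c2(2)])
  then show ?case using c'(1) c''(1) by (auto simp: dpath_append)
qed auto

text \<open>Induction on the level and, within a level, on the length of the word. The letters in
  the class of the first one are moved to the front; they and the remaining letters are trivial
  separately. If they are labels, they merge into the unit label and leave the state unchanged. If
  they are excursions, the word x read at the vertex they visit is trivial at a lower level, so it
  leads from \<open>c0\<close> into \<open>Acc\<close>, and \<open>I_Acc\<close> carries this over
  to the state outside.\<close>

lemma dpath_Acc: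
  "list_all2 (letter_log n) w ls \<Longrightarrow> trivial (concat ls) \<Longrightarrow> c \<in> Acc \<Longrightarrow> dpath \<Delta> c w c' \<Longrightarrow> c' \<in> Acc"
proof (induction n arbitrary: w ls c c' rule: less_induct)
  case (less n)
  note outer = less.IH
  from less.prems show ?case
  proof (induction "length w" arbitrary: w ls c rule: less_induct)
    case less
    show ?case
    proof (cases w)
      case Nil
      then show ?thesis using less.prems by simp
    next
      case (Cons a w')
      define v where "v = filter (\<lambda>b. fst b = fst a) w"
      define u where "u = filter (\<lambda>b. fst b \<noteq> fst a) w"
      obtain c1 where c1: "dpath \<Delta> c v c1" "dpath \<Delta> c1 u c'"
        using dpath_sort[OF less.prems(4), of "fst a"] by (auto simp: dpath_append u_def v_def)
      obtain vs where vs: "list_all2 (letter_log n) v vs" "trivial (concat vs)"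
        using eff_filter[OF less.prems(1), of "\<lambda>\<kappa>. \<kappa> = fst a"] less.prems(2) by (auto simp: trivial_def v_def)
      obtain us where us: "list_all2 (letter_log n) u us" "trivial (concat us)"
        using eff_filter[OF less.prems(1), of "\<lambda>\<kappa>. \<kappa> \<noteq> fst a"] less.prems(2) by (auto simp: trivial_def u_def)
      have "length u < length w" unfolding u_def Cons by (simp add: le_imp_less_Suc)
      moreover have "c1 \<in> Acc"
      proof -
        have av: "a \<in> set v" "\<forall>b\<in>set v. fst b = fst a" by (auto simp: v_def Cons)
        obtain l where "letter_log n a l"
          using less.prems(1) Cons by (auto simp: list_all2_Cons1)
        then consider t h where "a = Lab t h" | m d p q p' where "n = Suc m" "a = Exc d p q" "(p, d, p') \<in> mov"
          by (auto simp: letter_log_def)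
        then show ?thesis
        proof cases
          case (1 t h)
          then have v: "\<forall>b\<in>set v. fst b = (0, t)" "v \<noteq> []" using av by auto
          obtain h' where h': "h' \<in> Hc" "t \<in> T" "hv h' = eff H hv (concat vs) ([], t)" "(c, Lab t h', c1) \<in> \<Delta>"
            using dpath_Lab[OF vs(1) v(1) c1(1) v(2)] by blast
          then have "hv h' = \<one>" using vs(2) by (simp add: trivial_def)
          from lab_unit[OF h'(2,1) this h'(4)] have "c1 = c" .
          then show ?thesis using less.prems(3) by simp
        next
          case (2 m d p q p')
          obtain x ls' where x: "pat d v x" "list_all2 (letter_log m) x ls'" "concat vs = shift d (concat ls')"
            using letter_log_pat[of m v vs d] vs(1) 2 av by auto
          have "(d, c, c0) \<in> I" by (rule I_start[OF less.prems(3) 2(3)])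
          from pat_I[OF x(1) c1(1) this] obtain c2 where c2: "dpath \<Delta> c0 x c2" "(d, c1, c2) \<in> I" by blast
          have "c2 \<in> Acc"
            using outer[OF _ x(2) _ c0_Acc c2(1)] 2(1) vs(2) x(3) by (simp add: trivial_shift)
          then show ?thesis by (rule I_Acc[OF c2(2)])
        qed
      qed
      ultimately show ?thesis using less.hyps us c1(2) by blast
    qed
  qed
qed

text \<open>A successful run would read a word of \<open>L\<close> from \<open>c0\<close>, ending
  inside \<open>Acc\<close> by \<open>dpath_Acc\<close> and outside \<open>Acc\<close> by
  \<open>J_final\<close>.\<close>

theorem not_reach: "\<not> reach s F"
proof
  assume "reach s F"
  then obtain x r where x: "x \<in> L" "r \<in> F" "nrun (opp 0) s x r" by (auto simp: reach_iff)
  from nrun_J[OF x(3) _ J_root] obtain c' where c': "dpath \<Delta> c0 x c'" "((0, 0, 0), r, c') \<in> J" by auto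
  obtain n ls where "list_all2 (letter_log n) x ls" "trivial (concat ls)" using x(1) by (auto simp: L_def)
  from dpath_Acc[OF this c0_Acc c'(1)] J_final[OF c'(2) x(2)] show False by contradiction
qed

end

section \<open>Completeness of certificates\<close>

context machine
begin

lemma nrun_states:
  "nrun b p x r \<Longrightarrow> r \<in> insert p (snd ` eps \<union> (\<lambda>(_, _, _, q). q) ` lab \<union> (\<lambda>(_, _, q). q) ` mov)"
  by (induction rule: nrun.induct) (auto intro: rev_image_eqI)

text \<open>The Myhill-Nerode automaton of \<open>L\<close> works: its states are the finitely many
  residuals, numbered by \<open>\<iota>\<close>, and \<open>I\<close> and \<open>J\<close> consist
  of what actual words and runs reach. Its conditions are the closure rules of \<open>L\<close>,
  with \<open>I_Acc\<close> coming from \<open>pat_L\<close> and \<open>L_append\<close>, and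
  \<open>J_final\<close> from the assumption that nothing is reached.\<close>

lemma certificate_exists:
  assumes "\<not> reach s F"
  shows "\<exists>\<Delta> Acc c0 I J. finite \<Delta> \<and> finite Acc \<and> finite I \<and> finite J \<and>
    certificate H hv Hc T eps lab mov s F \<Delta> Acc c0 I J"
proof -
  obtain \<iota> :: "letter list set \<Rightarrow> nat" where \<iota>: "inj_on \<iota> (range res)"
    using finite_imp_inj_to_nat_seg[OF finite_range_res] by (elim exE conjE) (rule that)
  define c where "c w = \<iota> (res w)" for w
  have c_eq: "c w = c w' \<longleftrightarrow> res w = res w'" for w w'
    unfolding c_def using \<iota> by (auto dest: inj_onD)
  have c_append: "c (w @ u) = c (w' @ u)" if "c w = c w'" for w w' u
    using that unfolding c_eq by (auto simp: res_def set_eq_iff)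
  have c_L: "w \<in> L \<longleftrightarrow> w' \<in> L" if "c w = c w'" for w w'
    using that unfolding c_eq by (auto simp: res_def set_eq_iff dest: spec[of _ "[]"])
  have fin_c: "finite (range c)"
  proof -
    have "range c = \<iota> ` range res" by (auto simp: c_def)
    then show ?thesis using finite_range_res by simp
  qed
  define \<Delta> where "\<Delta> = {(c w, a, c (w @ [a])) | w a. a \<in> letters}"
  have \<Delta>: "(c w, a, k) \<in> \<Delta> \<longleftrightarrow> a \<in> letters \<and> k = c (w @ [a])" for w a k
  proof
    assume "(c w, a, k) \<in> \<Delta>"
    then obtain w' where "c w = c w'" "a \<in> letters" "k = c (w' @ [a])" unfolding \<Delta>_def by blast
    then show "a \<in> letters \<and> k = c (w @ [a])" using c_append[of w w' "[a]"] by simp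
  next
    assume "a \<in> letters \<and> k = c (w @ [a])"
    then show "(c w, a, k) \<in> \<Delta>" unfolding \<Delta>_def by blast
  qed
  have \<Delta>_cases: "\<exists>w. k = c w \<and> a \<in> letters \<and> k' = c (w @ [a])" if "(k, a, k') \<in> \<Delta>" for k a k'
    using that unfolding \<Delta>_def by blast
  define Acc where "Acc = c ` L"
  have Acc: "c w \<in> Acc \<longleftrightarrow> w \<in> L" for w
    unfolding Acc_def using c_L by blast
  define dirs where "dirs = (\<lambda>(_, d, _). d) ` mov"
  define srcs where "srcs = fst ` mov"
  define St where "St = insert s (snd ` eps \<union> (\<lambda>(_, _, _, q). q) ` lab \<union> (\<lambda>(_, _, q). q) ` mov)"
  \<comment> \<open>The excursions w may begin in any accepting state, that is, after any word
    \<open>w0\<close> of \<open>L\<close>.\<close>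
  define I where "I = {(d, c (w0 @ w), c x) | d w0 w x. d \<in> dirs \<and> w0 \<in> L \<and> pat d w x}"
  define J where "J = {((d, c (w0 @ w), p), r, c (x @ y)) | d w0 w p r x y. \<exists>p'. w0 \<in> L \<and> pat d w x
      \<and> (p, d, p') \<in> mov \<and> nrun (opp d) p' y r} \<union> {((0, 0, 0), r, c x) | r x. nrun (opp 0) s x r}"
  have fin: "finite dirs" "finite srcs" "finite St"
    using finite_mov finite_eps finite_lab by (auto simp: dirs_def srcs_def St_def)
  have "\<Delta> \<subseteq> range c \<times> letters \<times> range c" unfolding \<Delta>_def by blast
  then have fin\<Delta>: "finite \<Delta>" using fin_c finite_letters by (meson finite_SigmaI finite_subset)
  have finAcc: "finite Acc" unfolding Acc_def by (rule finite_subset[OF image_mono[OF subset_UNIV] fin_c])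
  have "I \<subseteq> dirs \<times> range c \<times> range c" unfolding I_def by blast
  then have finI: "finite I" using fin_c fin by (meson finite_SigmaI finite_subset)
  have "J \<subseteq> (insert (0, 0, 0) (dirs \<times> range c \<times> srcs)) \<times> St \<times> range c"
  proof
    fix j assume "j \<in> J"
    then consider d w0 w p r x y p' where "j = ((d, c (w0 @ w), p), r, c (x @ y))" "(p, d, p') \<in> mov" "nrun (opp d) p' y r"
      | r x where "j = ((0, 0, 0), r, c x)" "nrun (opp 0) s x r"
      unfolding J_def by blast
    then show "j \<in> (insert (0, 0, 0) (dirs \<times> range c \<times> srcs)) \<times> St \<times> range c"
    proof cases
      case 1
      then have "p' \<in> (\<lambda>(_, _, q). q) ` mov" "d \<in> dirs" "p \<in> srcs"
        unfolding dirs_def srcs_def by (auto intro: rev_image_eqI)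
      moreover have "r \<in> St" using nrun_states[OF 1(3)] calculation(1) unfolding St_def by blast
      ultimately show ?thesis unfolding 1(1) by blast
    next
      case 2
      then show ?thesis using nrun_states[OF 2(2)] by (auto simp: St_def)
    qed
  qed
  then have finJ: "finite J" using fin_c fin by (meson finite_SigmaI finite_insert finite_subset)
  have exc_letter: "Exc e r r' \<in> letters" if "(r, e, q) \<in> mov" "(r1, opp e, r') \<in> mov" for e r r' q r1
    using that unfolding letters_def by force
  have lab_letter: "Lab t h \<in> letters" if "t \<in> T" "h \<in> Hc" for t h
    using that unfolding letters_def by force
  have J_cases: "(\<exists>d w0 w p x y p'. k = (d, c (w0 @ w), p) \<and> c' = c (x @ y) \<and> w0 \<in> L \<and> pat d w x
      \<and> (p, d, p') \<in> mov \<and> nrun (opp d) p' y r) \<or> (\<exists>x. k = (0, 0, 0) \<and> c' = c x \<and> nrun (opp 0) s x r)"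
    if "(k, r, c') \<in> J" for k r c'
    using that unfolding J_def by blast
  have J_I: "((d, c (w0 @ w), p), r, c (x @ y)) \<in> J" if "w0 \<in> L" "pat d w x" "(p, d, p') \<in> mov" "nrun (opp d) p' y r"
    for d w0 w p r x y p'
    using that unfolding J_def by blast
  have J_I0: "((0, 0, 0), r, c x) \<in> J" if "nrun (opp 0) s x r" for r x
    using that unfolding J_def by blast
  \<comment> \<open>Common to labels and excursions: if the run at the inner vertex can read one
    more letter, so can the automaton, which is total on \<open>letters\<close>.\<close>
  have J_extend: "\<exists>c''. (c', a, c'') \<in> \<Delta> \<and> (k, r', c'') \<in> J"
    if J: "(k, r, c') \<in> J" and a: "a \<in> letters"
      and step: "\<And>p x. nrun (opp (fst k)) p x r \<Longrightarrow> nrun (opp (fst k)) p (x @ [a]) r'" for k r c' a r'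
    using J_cases[OF J]
  proof (elim disjE exE conjE)
    fix d w0 w p x y p'
    assume *: "k = (d, c (w0 @ w), p)" "c' = c (x @ y)" "w0 \<in> L" "pat d w x"
      "(p, d, p') \<in> mov" "nrun (opp d) p' y r"
    then have "((d, c (w0 @ w), p), r', c (x @ (y @ [a]))) \<in> J"
      using step[of p' y] by (intro J_I) auto
    then show ?thesis using * a by (auto simp: \<Delta>)
  next
    fix x assume *: "k = (0, 0, 0)" "c' = c x" "nrun (opp 0) s x r"
    then have "((0, 0, 0), r', c (x @ [a])) \<in> J"
      using step[of s x] by (intro J_I0) auto
    then show ?thesis using * a by (auto simp: \<Delta>)
  qed
  have "certificate H hv Hc T eps lab mov s F \<Delta> Acc (c []) I J"
  proof
    show "c [] \<in> Acc" unfolding Acc by (rule L_Nil)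
  next
    fix k a k1 b k2 assume "(k, a, k1) \<in> \<Delta>" "(k1, b, k2) \<in> \<Delta>" and ab: "fst a \<noteq> fst b"
    then obtain w where w: "k = c w" "a \<in> letters" "b \<in> letters" "k2 = c (w @ [a, b])"
      using \<Delta>_cases[of k a k1] by (auto simp: \<Delta>)
    have "c (w @ [a, b]) = c (w @ [b, a])"
      unfolding c_eq res_def using L_commute[OF ab] L_commute[OF ab[symmetric]] by auto
    then show "\<exists>k3. (k, b, k3) \<in> \<Delta> \<and> (k3, a, k2) \<in> \<Delta>"
      using w by (intro exI[of _ "c (w @ [b])"]) (simp add: \<Delta>)
  next
    fix t h k k' assume th: "t \<in> T" "h \<in> Hc" "hv h = \<one>" and "(k, Lab t h, k') \<in> \<Delta>"
    then obtain w where w: "k = c w" "k' = c (w @ [Lab t h])" using \<Delta>_cases by blast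
    show "k' = k" unfolding w c_eq res_def using L_Lab_unit[OF th] by auto
  next
    fix t h k k1 h' k2 h''
    assume th: "t \<in> T" "h \<in> Hc" "h' \<in> Hc" "h'' \<in> Hc" "hv h'' = hv h \<otimes> hv h'"
      and "(k, Lab t h, k1) \<in> \<Delta>" "(k1, Lab t h', k2) \<in> \<Delta>"
    then obtain w where w: "k = c w" "k2 = c (w @ [Lab t h, Lab t h'])"
      using \<Delta>_cases[of k "Lab t h" k1] by (auto simp: \<Delta>)
    have "c (w @ [Lab t h, Lab t h']) = c (w @ [Lab t h''])"
      unfolding c_eq res_def using L_Lab_mult[OF th] by auto
    then show "(k, Lab t h'', k2) \<in> \<Delta>" using w th lab_letter by (simp add: \<Delta>)
  next
    fix k p d p' assume k: "k \<in> Acc" and d: "(p, d, p') \<in> mov"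
    then obtain w where w: "k = c w" "w \<in> L" by (auto simp: Acc_def)
    have "d \<in> dirs" using d by (force simp: dirs_def)
    then show "(d, k, c []) \<in> I"
      unfolding I_def using w pat_Nil by (intro CollectI exI[of _ d] exI[of _ w] exI[of _ "[]"]) simp
  next
    fix d k k' p p' assume "(d, k, k') \<in> I" and d: "(p, d, p') \<in> mov"
    then obtain w0 w x where "k = c (w0 @ w)" "k' = c x" "w0 \<in> L" "pat d w x" by (auto simp: I_def)
    then show "((d, k, p), p', k') \<in> J" using J_I[OF _ _ d nrun_refl, of w0 w x] by simp
  next
    fix k r c' r' assume J: "(k, r, c') \<in> J" and e: "(r, r') \<in> eps"
    from J_cases[OF J] show "(k, r', c') \<in> J"
    proof (elim disjE exE conjE)
      fix d w0 w p x y p'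
      assume *: "k = (d, c (w0 @ w), p)" "c' = c (x @ y)" "w0 \<in> L" "pat d w x"
        "(p, d, p') \<in> mov" "nrun (opp d) p' y r"
      then show ?thesis using J_I[OF *(3,4,5) nrun_eps[OF *(6) e]] by simp
    next
      fix x assume *: "k = (0, 0, 0)" "c' = c x" "nrun (opp 0) s x r"
      then show ?thesis using J_I0[OF nrun_eps[OF *(3) e]] by simp
    qed
  next
    fix k r c' t h r' assume J: "(k, r, c') \<in> J" and l: "(r, t, h, r') \<in> lab"
    show "\<exists>c''. (c', Lab t h, c'') \<in> \<Delta> \<and> (k, r', c'') \<in> J"
      using lab_ok[OF l] by (intro J_extend[OF J] lab_letter nrun_lab[OF _ l]) auto
  next
    fix k r c' e q r1 r'
    assume J: "(k, r, c') \<in> J" and m: "(r, e, q) \<in> mov" "(r1, opp e, r') \<in> mov" "e \<noteq> opp (fst k)"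
    show "\<exists>c''. (c', Exc e r r', c'') \<in> \<Delta> \<and> (k, r', c'') \<in> J"
      by (intro J_extend[OF J] exc_letter[OF m(1,2)] nrun_exc[OF _ m(3,1,2)])
  next
    fix d k p r c' q k2
    assume J: "((d, k, p), r, c') \<in> J" and m: "(r, opp d, q) \<in> mov" and k2: "(k, Exc d p q, k2) \<in> \<Delta>"
    \<comment> \<open>A move in the direction \<open>opp d\<close> exists, and moves avoid the
      direction 1, so this is not the dummy entry of the root.\<close>
    have "d \<noteq> 0" using mov_ok[OF m] by (cases "d = 0") (auto simp: opp_def)
    then obtain w0 w x y p' where *: "k = c (w0 @ w)" "c' = c (x @ y)" "w0 \<in> L" "pat d w x"
      "(p, d, p') \<in> mov" "nrun (opp d) p' y r"
      using J_cases[OF J] by auto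
    have "d \<in> dirs" using *(5) by (force simp: dirs_def)
    moreover have "k2 = c (w0 @ (w @ [Exc d p q]))" using k2 *(1) by (simp add: \<Delta>)
    ultimately show "(d, k2, c') \<in> I"
      unfolding I_def using pat_snoc[OF *(4-6) m] *(2,3) by blast
  next
    fix d k k' assume "(d, k, k') \<in> I" "k' \<in> Acc"
    then obtain w0 w x where "k = c (w0 @ w)" "k' = c x" "w0 \<in> L" "pat d w x" "x \<in> L"
      by (auto simp: I_def Acc)
    then show "k \<in> Acc" by (simp add: Acc L_append pat_L)
  next
    show "((0, 0, 0), s, c []) \<in> J" by (rule J_I0[OF nrun_refl])
  next
    fix r c' assume J: "((0, 0, 0), r, c') \<in> J" and r: "r \<in> F"
    then obtain x where x: "c' = c x" "nrun (opp 0) s x r"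
      using J_cases[OF J] mov_ok by fastforce
    then show "c' \<notin> Acc" using assms r by (auto simp: Acc reach_iff)
  qed
  then show ?thesis using fin\<Delta> finAcc finI finJ by blast
qed

end


section \<open>Runs of a machine\<close>

definition mv :: "nat \<Rightarrow> nat list \<Rightarrow> nat list" where
  "mv d st = (case st of [] \<Rightarrow> [d] | e # st' \<Rightarrow> if d = opp e then st' else d # st)"

definition place :: "nat list \<Rightarrow> log \<Rightarrow> log" where
  "place st l = map (\<lambda>((u, t), h). ((u @ st, t), h)) l"

lemma place_simps [simp]:
  "place st [] = []" "place st (l @ l') = place st l @ place st l'"
  "place st [((u, t), h)] = [((u @ st, t), h)]" "place [] l = l"
  "place st (shift d l) = place (d # st) l"
  by (auto simp: place_def shift_def case_prod_beta)

inductive run :: "(nat \<times> nat) set \<Rightarrow> (nat \<times> nat \<times> nat \<times> nat) set \<Rightarrow> (nat \<times> nat \<times> nat) set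
    \<Rightarrow> nat \<Rightarrow> nat list \<Rightarrow> log \<Rightarrow> nat \<Rightarrow> bool" for eps lab mov s where
  run_refl: "run eps lab mov s [] [] s"
| run_eps: "run eps lab mov s st l q \<Longrightarrow> (q, r) \<in> eps \<Longrightarrow> run eps lab mov s st l r"
| run_lab: "run eps lab mov s st l q \<Longrightarrow> (q, t, h, r) \<in> lab \<Longrightarrow> run eps lab mov s st (l @ [((st, t), h)]) r"
| run_mov: "run eps lab mov s st l q \<Longrightarrow> (q, d, r) \<in> mov \<Longrightarrow> run eps lab mov s (mv d st) l r"

context machine
begin

text \<open>At a vertex other than the root, b is the direction leading back towards the root. As
  \<open>sub\<close> avoids it, each excursion starts by pushing its direction on the stack and ends
  by popping it.\<close>

lemma run_if_sub:
  assumes "sub n b p l q" "run eps lab mov s st l0 p" "st = [] \<or> b = opp (hd st)"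
  shows "run eps lab mov s st (l0 @ place st l) q"
  using assms
proof (induction arbitrary: st l0 rule: sub.induct)
  case (sub_eps n b p l q r)
  then show ?case by (blast intro: run_eps)
next
  case (sub_lab n b p l q t h r)
  then show ?case using run_lab[OF sub_lab.IH[OF sub_lab.prems] sub_lab.hyps(2)] by simp
next
  case (sub_exc n b p l q e q' l' r' r)
  have "mv e st = e # st"
    using sub_exc.hyps(2) sub_exc.prems(2) by (cases st) (auto simp: mv_def)
  then have "run eps lab mov s (e # st) (l0 @ place st l) q'"
    using run_mov[OF sub_exc.IH(1)[OF sub_exc.prems] sub_exc.hyps(3)] by simp
  from sub_exc.IH(2)[OF this] have "run eps lab mov s (e # st) ((l0 @ place st l) @ place (e # st) l') r'"
    by simp
  from run_mov[OF this sub_exc.hyps(5)] show ?case by (simp add: mv_def)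
qed simp

text \<open>The call stack of a run in progress. For each vertex on the path to the current one it
  holds the part of the run spent there since that vertex was last entered from its parent, with the
  finished excursions folded into \<open>sub\<close>.\<close>

inductive frames :: "nat \<Rightarrow> nat list \<Rightarrow> log \<Rightarrow> nat \<Rightarrow> bool" where
  frames_root: "sub n (opp 0) s l q \<Longrightarrow> frames s [] l q"
| frames_push: "frames s st l q \<Longrightarrow> (q, d, q') \<in> mov \<Longrightarrow> st = [] \<or> d \<noteq> opp (hd st)
    \<Longrightarrow> sub n (opp d) q' l' r \<Longrightarrow> frames s (d # st) (l @ place (d # st) l') r"

lemma frames_extend:
  assumes fr: "frames s st l q"
    and ext: "\<And>n b p m. sub n b p m q \<Longrightarrow> (st = [] \<and> b = opp 0 \<or> st \<noteq> [] \<and> b = opp (hd st))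
      \<Longrightarrow> \<exists>n'. sub n' b p (m @ m') r"
  shows "frames s st (l @ place st m') r"
  using fr
proof cases
  case (frames_root n)
  then obtain n' where "sub n' (opp 0) s (l @ m') r" using ext by blast
  then show ?thesis using frames_root by (auto intro: frames.frames_root)
next
  case (frames_push st' l1 q1 d q' n l')
  then obtain n' where "sub n' (opp d) q' (l' @ m') r" using ext by force
  from frames.frames_push[OF frames_push(3,4,5) this] show ?thesis using frames_push by simp
qed

text \<open>A move away from the root opens a new frame, and a move back closes the topmost one,
  turning it into an excursion of the frame below. The nesting bounds of the two frames are brought
  together by taking their maximum.\<close>

lemma frames_if_run: "run eps lab mov s st l q \<Longrightarrow> frames s st l q"
proof (induction rule: run.induct)
  case run_refl
  then show ?case by (auto intro: frames_root sub_refl)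
next
  case (run_eps st l q r)
  have "frames s st (l @ place st []) r"
    by (rule frames_extend[OF run_eps.IH]) (use run_eps in \<open>auto intro: sub_eps\<close>)
  then show ?case by simp
next
  case (run_lab st l q t h r)
  have "frames s st (l @ place st [(([], t), h)]) r"
    by (rule frames_extend[OF run_lab.IH]) (use run_lab in \<open>auto intro: sub_lab\<close>)
  then show ?case by simp
next
  case (run_mov st l q d r)
  show ?case
  proof (cases "st \<noteq> [] \<and> d = opp (hd st)")
    case True
    then obtain e st' where st: "st = e # st'" "d = opp e" by (cases st) auto
    from run_mov.IH[unfolded st] show ?thesis
    proof cases
      case (frames_push l1 q1 q' n l')
      have "frames s st' (l1 @ place st' (shift e l')) r"
      proof (rule frames_extend[OF frames_push(2)])
        fix n2 b p m assume m: "sub n2 b p m q1" "st' = [] \<and> b = opp 0 \<or> st' \<noteq> [] \<and> b = opp (hd st')"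
        \<comment> \<open>At the root b is 1, while directions of moves are at least 2; elsewhere
          the frame records that e does not turn back.\<close>
        have "e \<noteq> b" using m(2) frames_push(4) mov_ok[OF frames_push(3)] by (auto simp: opp_def)
        have "sub (Suc (max n2 n)) b p m q1" "sub (max n2 n) (opp e) q' l' q"
          using m(1) frames_push(5) by (auto intro: sub_mono_le)
        from sub_exc[OF this(1) \<open>e \<noteq> b\<close> frames_push(3) this(2)] run_mov.hyps(2) st(2)
        show "\<exists>n'. sub n' b p (m @ shift e l') r" by blast
      qed
      then show ?thesis using frames_push(1) st by (simp add: mv_def)
    qed
  next
    case False
    then have "mv d st = d # st" by (cases st) (auto simp: mv_def)
    then show ?thesis
      using frames_push[OF run_mov.IH run_mov.hyps(2) _ sub_refl] False by auto
  qed
qed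

lemma reach_iff_run: "reach s F \<longleftrightarrow> (\<exists>l. \<exists>r\<in>F. run eps lab mov s [] l r \<and> trivial l)"
proof
  assume "reach s F"
  then obtain n l r where r: "sub n (opp 0) s l r" "r \<in> F" "trivial l" by (auto simp: reach_def)
  from run_if_sub[OF r(1) run_refl] have "run eps lab mov s [] l r" by simp
  then show "\<exists>l. \<exists>r\<in>F. run eps lab mov s [] l r \<and> trivial l" using r by blast
next
  assume "\<exists>l. \<exists>r\<in>F. run eps lab mov s [] l r \<and> trivial l"
  then obtain l r where r: "run eps lab mov s [] l r" "r \<in> F" "trivial l" by blast
  from frames_if_run[OF r(1)] obtain n where "sub n (opp 0) s l r" by cases auto
  then show "reach s F" using r unfolding reach_def by blast
qed

end


section \<open>Wreath products in coordinates\<close>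

definition single :: "('h, 'm) monoid_scheme \<Rightarrow> ('g, 'n) monoid_scheme \<Rightarrow> 'g \<Rightarrow> 'h \<Rightarrow> 'g \<Rightarrow> 'h" where
  "single H G a h = (\<lambda>v\<in>carrier G. if v = a then h else \<one>\<^bsub>H\<^esub>)"

lemma wreath_simps:
  "carrier (wreath_product H G) = finsupp_maps H G \<times> carrier G"
  "(f1, g1) \<otimes>\<^bsub>wreath_product H G\<^esub> (f2, g2) =
    (\<lambda>a\<in>carrier G. f1 a \<otimes>\<^bsub>H\<^esub> f2 (inv\<^bsub>G\<^esub> g1 \<otimes>\<^bsub>G\<^esub> a), g1 \<otimes>\<^bsub>G\<^esub> g2)"
  "\<one>\<^bsub>wreath_product H G\<^esub> = (\<lambda>a\<in>carrier G. \<one>\<^bsub>H\<^esub>, \<one>\<^bsub>G\<^esub>)"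
  by (simp_all add: wreath_product_def)

locale two_groups = H: group H + V: group V
  for H :: "('h, 'm) monoid_scheme" and V :: "('v, 'n) monoid_scheme"
begin

abbreviation wr where "wr \<equiv> wreath_product H V"

sublocale W: group wr by (rule group_wreath_product) unfold_locales

abbreviation one_map where "one_map \<equiv> (\<lambda>a\<in>carrier V. \<one>\<^bsub>H\<^esub>)"

lemma finsupp_val: "f \<in> finsupp_maps H V \<Longrightarrow> v \<in> carrier V \<Longrightarrow> f v \<in> carrier H"
  by (auto simp: finsupp_maps_def)

lemma finsupp_ext: "f \<in> finsupp_maps H V \<Longrightarrow> restrict f (carrier V) = f"
  by (auto simp: finsupp_maps_def intro: extensional_restrict)

lemma one_map_finsupp: "one_map \<in> finsupp_maps H V"
  by (auto simp: finsupp_maps_def)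

lemma single_finsupp: "h \<in> carrier H \<Longrightarrow> single H V a h \<in> finsupp_maps H V"
  by (auto simp: finsupp_maps_def single_def intro: finite_subset[of _ "{a}"])

lemma single_conj:
  assumes "a \<in> carrier V" "h \<in> carrier H"
  shows "(single H V a h, \<one>\<^bsub>V\<^esub>) = (one_map, a) \<otimes>\<^bsub>wr\<^esub> (single H V \<one>\<^bsub>V\<^esub> h, \<one>\<^bsub>V\<^esub>) \<otimes>\<^bsub>wr\<^esub> (one_map, inv\<^bsub>V\<^esub> a)"
proof -
  have "inv\<^bsub>V\<^esub> a \<otimes>\<^bsub>V\<^esub> v = \<one>\<^bsub>V\<^esub> \<longleftrightarrow> v = a" if "v \<in> carrier V" for v
    using that assms(1) by (metis V.inv_closed V.inv_equality V.inv_inv V.l_inv)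
  then show ?thesis using assms
    by (auto simp: wreath_simps single_def intro!: restrict_ext)
qed

text \<open>A map of finite support is a product of labels at single points, and a label at a is the
  conjugate by a of a label at the identity. The principle serves for finite generation and for
  realizing elements by operations.\<close>

lemma wreath_induct:
  assumes x: "x \<in> carrier wr"
    and mult: "\<And>x y. x \<in> carrier wr \<Longrightarrow> y \<in> carrier wr \<Longrightarrow> P x \<Longrightarrow> P y \<Longrightarrow> P (x \<otimes>\<^bsub>wr\<^esub> y)"
    and single: "\<And>h. h \<in> carrier H \<Longrightarrow> P (single H V \<one>\<^bsub>V\<^esub> h, \<one>\<^bsub>V\<^esub>)"
    and pos: "\<And>v. v \<in> carrier V \<Longrightarrow> P (one_map, v)"
  shows "P x"
proof -
  have P_single: "P (single H V a h, \<one>\<^bsub>V\<^esub>)" if "a \<in> carrier V" "h \<in> carrier H" for a h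
    unfolding single_conj[OF that] using that
    by (intro mult single pos W.m_closed)
      (auto simp: wreath_simps(1) one_map_finsupp single_finsupp)
  have P_map: "P (f, \<one>\<^bsub>V\<^esub>)"
    if "finite A" "f \<in> finsupp_maps H V" "\<And>v. v \<in> carrier V \<Longrightarrow> v \<notin> A \<Longrightarrow> f v = \<one>\<^bsub>H\<^esub>" "A \<subseteq> carrier V" for A f
    using that
  proof (induction A arbitrary: f rule: finite_induct)
    case empty
    then have "restrict f (carrier V) = one_map" by (intro restrict_ext) simp
    then have "f = one_map" using finsupp_ext[OF empty.prems(1)] by simp
    then show ?case using pos[OF V.one_closed] by (simp only:)
  next
    case (insert a A)
    define f' where "f' = (\<lambda>v\<in>carrier V. if v = a then \<one>\<^bsub>H\<^esub> else f v)"
    have a: "a \<in> carrier V" using insert.prems by simp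
    have f': "f' \<in> finsupp_maps H V"
      using insert.prems(1) finsupp_val[OF insert.prems(1)]
      by (auto simp: finsupp_maps_def f'_def intro: rev_finite_subset)
    have "(f, \<one>\<^bsub>V\<^esub>) = (single H V a (f a), \<one>\<^bsub>V\<^esub>) \<otimes>\<^bsub>wr\<^esub> (f', \<one>\<^bsub>V\<^esub>)"
    proof -
      have "(\<lambda>v\<in>carrier V. single H V a (f a) v \<otimes>\<^bsub>H\<^esub> f' (inv\<^bsub>V\<^esub> \<one>\<^bsub>V\<^esub> \<otimes>\<^bsub>V\<^esub> v)) = restrict f (carrier V)"
        by (rule restrict_ext) (auto simp: single_def f'_def finsupp_val[OF insert.prems(1)])
      then show ?thesis using finsupp_ext[OF insert.prems(1)] by (simp add: wreath_simps)
    qed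
    moreover have "P (f', \<one>\<^bsub>V\<^esub>)"
    proof (rule insert.IH[OF f'])
      show "A \<subseteq> carrier V" using insert.prems by simp
      show "f' v = \<one>\<^bsub>H\<^esub>" if "v \<in> carrier V" "v \<notin> A" for v
        using that insert.prems(2)[of v] by (simp add: f'_def)
    qed
    ultimately show ?case
      using P_single[OF a finsupp_val[OF insert.prems(1) a]] f' single_finsupp[OF finsupp_val[OF insert.prems(1) a]]
      by (auto simp: wreath_simps(1) intro!: mult)
  qed
  obtain f g where fg: "x = (f, g)" "f \<in> finsupp_maps H V" "g \<in> carrier V"
    using x by (auto simp: wreath_simps(1))
  have "P (f, \<one>\<^bsub>V\<^esub>)"
    by (rule P_map[of "{a \<in> carrier V. f a \<noteq> \<one>\<^bsub>H\<^esub>}"]) (use fg(2) in \<open>auto simp: finsupp_maps_def\<close>)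
  moreover have "x = (f, \<one>\<^bsub>V\<^esub>) \<otimes>\<^bsub>wr\<^esub> (one_map, g)"
  proof -
    have "(\<lambda>a\<in>carrier V. f a \<otimes>\<^bsub>H\<^esub> one_map (inv\<^bsub>V\<^esub> \<one>\<^bsub>V\<^esub> \<otimes>\<^bsub>V\<^esub> a)) = restrict f (carrier V)"
      by (rule restrict_ext) (use finsupp_val[OF fg(2)] in auto)
    then show ?thesis using fg finsupp_ext[OF fg(2)] by (simp add: wreath_simps)
  qed
  ultimately show ?thesis
    using fg pos by (auto simp: wreath_simps(1) one_map_finsupp intro!: mult)
qed

lemma pos_mult:
  "v \<in> carrier V \<Longrightarrow> w \<in> carrier V \<Longrightarrow> (one_map, v) \<otimes>\<^bsub>wr\<^esub> (one_map, w) = (one_map, v \<otimes>\<^bsub>V\<^esub> w)"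
  by (auto simp: wreath_simps intro!: restrict_ext)

lemma pos_carrier: "v \<in> carrier V \<Longrightarrow> (one_map, v) \<in> carrier wr"
  by (simp add: wreath_simps one_map_finsupp)

lemma finitely_generated_wreath:
  assumes "finite (carrier H)" "finitely_generated V"
  shows "finitely_generated wr"
proof -
  obtain X where X: "finite X" "X \<subseteq> carrier V" "generate V X = carrier V"
    using assms(2) by (auto simp: finitely_generated_def)
  define Y where "Y = (\<lambda>h. (single H V \<one>\<^bsub>V\<^esub> h, \<one>\<^bsub>V\<^esub>)) ` carrier H \<union> (\<lambda>v. (one_map, v)) ` X"
  have Y: "Y \<subseteq> carrier wr"
    using X(2) by (auto simp: Y_def wreath_simps(1) one_map_finsupp single_finsupp)
  have pos: "(one_map, v) \<in> generate wr Y" if "v \<in> generate V X" for v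
    using that
  proof (induction rule: generate.induct)
    case one
    show ?case using generate.one[of wr Y] unfolding wreath_simps(3) .
  next
    case (incl h)
    then show ?case unfolding Y_def by (intro generate.incl UnI2 imageI)
  next
    case (inv h)
    then have h: "h \<in> carrier V" using X(2) by auto
    have "inv\<^bsub>wr\<^esub> (one_map, h) = (one_map, inv\<^bsub>V\<^esub> h)"
      using pos_mult[of "inv\<^bsub>V\<^esub> h" h] h by (intro W.inv_equality) (auto simp: pos_carrier wreath_simps(3))
    moreover have "(one_map, h) \<in> Y" unfolding Y_def by (intro UnI2 imageI inv)
    ultimately show ?case using generate.inv[of "(one_map, h)" Y wr] by (simp only:)
  next
    case (eng h1 h2)
    then have h: "h1 \<in> carrier V" "h2 \<in> carrier V" using X(2,3) by auto
    from generate.eng[OF eng.IH] show ?case unfolding pos_mult[OF h] .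
  qed
  have "x \<in> generate wr Y" if "x \<in> carrier wr" for x
    using that
  proof (rule wreath_induct)
    show "(one_map, v) \<in> generate wr Y" if "v \<in> carrier V" for v using pos X(3) that by simp
    show "(single H V \<one>\<^bsub>V\<^esub> h, \<one>\<^bsub>V\<^esub>) \<in> generate wr Y" if "h \<in> carrier H" for h
      using that by (intro generate.incl) (simp add: Y_def)
  qed (rule generate.eng)
  then have "generate wr Y = carrier wr"
    using W.generate_incl[OF Y] by blast
  moreover have "finite Y" using X(1) assms(1) by (simp add: Y_def)
  ultimately show ?thesis using Y unfolding finitely_generated_def by blast
qed

end

text \<open>Operations on a pair of a stack and a log: \<open>(1, t, h)\<close> logs the label \<open>h\<close> at the
  coset \<open>t\<close>, and \<open>(2, d, 0)\<close> moves in the direction \<open>d\<close>.\<close>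

type_synonym oper = "nat \<times> nat \<times> nat"

fun act :: "oper \<Rightarrow> nat list \<times> log \<Rightarrow> nat list \<times> log" where
  "act (k, a, b) (st, l) = (if k = 1 then (st, l @ [((st, a), b)]) else (mv a st, l))"

definition acts :: "oper list \<Rightarrow> nat list \<times> log \<Rightarrow> nat list \<times> log" where
  "acts ys = fold act ys"

lemma acts_simps [simp]: "acts [] c = c" "acts (y # ys) c = acts ys (act y c)"
  "acts (ys @ zs) c = acts zs (acts ys c)"
  by (simp_all add: acts_def)

fun reduced :: "nat list \<Rightarrow> bool" where
  "reduced (d # e # st) \<longleftrightarrow> d \<noteq> opp e \<and> reduced (e # st)"
| "reduced _ \<longleftrightarrow> True"

lemma reduced_tl: "reduced (e # st) \<Longrightarrow> reduced st"
  by (cases st) auto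

lemma reduced_mv: "reduced st \<Longrightarrow> reduced (mv d st)"
  by (cases st) (auto simp: mv_def intro: reduced_tl)

text \<open>The stacks are to stand for the elements of the free subgroup and \<open>tv\<close> for
  representatives of its right cosets. In the \<open>foldr\<close> the head of a stack is the last
  factor, so a move multiplies on the right by changing the top only. Uniqueness is asked of reduced
  stacks, the form that \<open>mv\<close> preserves.\<close>

locale wreath_coords = two_groups H V for H :: "('h, 'm) monoid_scheme" and V :: "('v, 'n) monoid_scheme" +
  fixes hv :: "nat \<Rightarrow> 'h" and Hc :: "nat set" and tv :: "nat \<Rightarrow> 'v" and T :: "nat set"
    and dv :: "nat \<Rightarrow> 'v" and D :: "nat set"
  assumes hv: "bij_betw hv Hc (carrier H)" and finite_Hc: "finite Hc" and finite_T: "finite T"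
    and tv_closed: "t \<in> T \<Longrightarrow> tv t \<in> carrier V"
    and dv_closed: "d \<in> D \<Longrightarrow> dv d \<in> carrier V" and D_ge: "d \<in> D \<Longrightarrow> 2 \<le> d"
    and dv_opp: "d \<in> D \<Longrightarrow> dv (opp d) = inv\<^bsub>V\<^esub> dv d"
    and coords: "v \<in> carrier V \<Longrightarrow> \<exists>st t. set st \<subseteq> D \<and> t \<in> T \<and>
      v = foldr (\<lambda>d x. x \<otimes>\<^bsub>V\<^esub> dv d) st \<one>\<^bsub>V\<^esub> \<otimes>\<^bsub>V\<^esub> tv t"
    and coords_inj: "set st \<subseteq> D \<Longrightarrow> set st' \<subseteq> D \<Longrightarrow> reduced st \<Longrightarrow> reduced st' \<Longrightarrow> t \<in> T \<Longrightarrow> t' \<in> T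
      \<Longrightarrow> foldr (\<lambda>d x. x \<otimes>\<^bsub>V\<^esub> dv d) st \<one>\<^bsub>V\<^esub> \<otimes>\<^bsub>V\<^esub> tv t = foldr (\<lambda>d x. x \<otimes>\<^bsub>V\<^esub> dv d) st' \<one>\<^bsub>V\<^esub> \<otimes>\<^bsub>V\<^esub> tv t'
      \<Longrightarrow> st = st' \<and> t = t'"
begin

section \<open>Stacks and places as elements of the virtually free group\<close>

definition val :: "nat list \<Rightarrow> 'v" where
  "val st = foldr (\<lambda>d x. x \<otimes>\<^bsub>V\<^esub> dv d) st \<one>\<^bsub>V\<^esub>"

definition pt :: "nat list \<times> nat \<Rightarrow> 'v" where
  "pt x = val (fst x) \<otimes>\<^bsub>V\<^esub> tv (snd x)"

lemma val_simps [simp]: "val [] = \<one>\<^bsub>V\<^esub>" "val (d # st) = val st \<otimes>\<^bsub>V\<^esub> dv d"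
  by (simp_all add: val_def)

lemma val_closed: "set st \<subseteq> D \<Longrightarrow> val st \<in> carrier V"
  by (induction st) (auto intro: dv_closed)

lemma pt_closed: "set st \<subseteq> D \<Longrightarrow> t \<in> T \<Longrightarrow> pt (st, t) \<in> carrier V"
  by (simp add: pt_def val_closed tv_closed)

lemma hv_closed: "h \<in> Hc \<Longrightarrow> hv h \<in> carrier H"
  using hv by (auto simp: bij_betw_def)

lemma val_mv:
  assumes "set st \<subseteq> D" "d \<in> D"
  shows "val (mv d st) = val st \<otimes>\<^bsub>V\<^esub> dv d"
proof (cases "st \<noteq> [] \<and> d = opp (hd st)")
  case True
  then obtain e st' where st: "st = e # st'" "d = opp e" by (cases st) auto
  have "val st' \<otimes>\<^bsub>V\<^esub> dv e \<otimes>\<^bsub>V\<^esub> inv\<^bsub>V\<^esub> dv e = val st'"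
    using assms st by (simp add: V.m_assoc val_closed dv_closed)
  then show ?thesis using assms st by (simp add: mv_def dv_opp)
next
  case False
  then have "mv d st = d # st" by (cases st) (auto simp: mv_def)
  then show ?thesis by simp
qed

lemma set_mv: "set st \<subseteq> D \<Longrightarrow> d \<in> D \<Longrightarrow> set (mv d st) \<subseteq> D"
  by (cases st) (auto simp: mv_def)

definition oper_ok :: "oper \<Rightarrow> bool" where
  "oper_ok y \<longleftrightarrow> (\<exists>t\<in>T. \<exists>h\<in>Hc. y = (1, t, h)) \<or> (\<exists>d\<in>D. y = (2, d, 0))"

definition conf_ok :: "nat list \<times> log \<Rightarrow> bool" where
  "conf_ok c \<longleftrightarrow> set (fst c) \<subseteq> D \<and> reduced (fst c) \<and>
    (\<forall>e\<in>set (snd c). set (fst (fst e)) \<subseteq> D \<and> reduced (fst (fst e)) \<and> snd (fst e) \<in> T \<and> snd e \<in> Hc)"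

lemma conf_ok_Nil: "conf_ok ([], [])"
  by (simp add: conf_ok_def)

lemma act_ok: "oper_ok y \<Longrightarrow> conf_ok c \<Longrightarrow> conf_ok (act y c)"
proof -
  assume y: "oper_ok y" and c: "conf_ok c"
  obtain st l where sl: "c = (st, l)" by (cases c)
  from y consider t h where "t \<in> T" "h \<in> Hc" "y = (1, t, h)" | d where "d \<in> D" "y = (2, d, 0)"
    unfolding oper_ok_def by blast
  then show ?thesis
  proof cases
    case 1
    then show ?thesis using c unfolding sl conf_ok_def by simp
  next
    case 2
    then show ?thesis using c set_mv[of st d] reduced_mv[of st d] unfolding sl conf_ok_def by simp
  qed
qed

lemma acts_ok: "\<forall>y\<in>set ys. oper_ok y \<Longrightarrow> conf_ok c \<Longrightarrow> conf_ok (acts ys c)"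
  by (induction ys arbitrary: c) (auto simp: act_ok)

section \<open>Configurations as elements of the wreath product\<close>

definition label :: "log \<Rightarrow> 'v \<Rightarrow> 'h" where
  "label l = (\<lambda>v\<in>carrier V. list_mult H (map (\<lambda>e. hv (snd e)) (filter (\<lambda>e. pt (fst e) = v) l)))"

definition elt :: "nat list \<times> log \<Rightarrow> nat \<Rightarrow> ('v \<Rightarrow> 'h) \<times> 'v" where
  "elt c t = (label (snd c), pt (fst c, t))"

lemma conf_hv: "conf_ok (st, l) \<Longrightarrow> set (map (\<lambda>e. hv (snd e)) (filter P l)) \<subseteq> carrier H"
  by (auto simp: conf_ok_def intro!: hv_closed)

lemma label_finsupp:
  assumes "conf_ok (st, l)" shows "label l \<in> finsupp_maps H V"
proof -
  have "list_mult H (map (\<lambda>e. hv (snd e)) (filter (\<lambda>e. pt (fst e) = v) l)) \<in> carrier H" for v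
    by (rule H.list_mult_closed'[OF conf_hv[OF assms]])
  moreover have "{a \<in> carrier V. label l a \<noteq> \<one>\<^bsub>H\<^esub>} \<subseteq> (\<lambda>e. pt (fst e)) ` set l"
  proof
    fix a assume a: "a \<in> {a \<in> carrier V. label l a \<noteq> \<one>\<^bsub>H\<^esub>}"
    show "a \<in> (\<lambda>e. pt (fst e)) ` set l"
    proof (rule ccontr)
      assume "\<not> ?thesis"
      then have "filter (\<lambda>e. pt (fst e) = a) l = []" by (auto simp: filter_empty_conv)
      then have "label l a = \<one>\<^bsub>H\<^esub>"
        using a unfolding label_def by (subst restrict_apply') (simp_all only: list.map list_mult_Nil mem_Collect_eq)
      then show False using a by simp
    qed
  qed
  then have "finite {a \<in> carrier V. label l a \<noteq> \<one>\<^bsub>H\<^esub>}" by (rule finite_subset) simp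
  ultimately show ?thesis unfolding finsupp_maps_def by (auto simp: label_def)
qed

lemma elt_closed: "conf_ok c \<Longrightarrow> t \<in> T \<Longrightarrow> elt c t \<in> carrier wr"
  by (cases c) (auto simp: elt_def wreath_simps(1) conf_ok_def intro!: label_finsupp pt_closed)

text \<open>The same operations serve for all configurations in the coset t. This uniformity is what
  allows a finite machine to multiply by a generator: it only has to remember the coset.\<close>

definition realizes :: "oper list \<Rightarrow> nat \<Rightarrow> nat \<Rightarrow> ('v \<Rightarrow> 'h) \<times> 'v \<Rightarrow> bool" where
  "realizes ys t t' x \<longleftrightarrow> t' \<in> T \<and> (\<forall>y\<in>set ys. oper_ok y) \<and>
    (\<forall>c. conf_ok c \<longrightarrow> elt (acts ys c) t' = elt c t \<otimes>\<^bsub>wr\<^esub> x)"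

lemma realizes_mult:
  assumes "realizes ys t t' x" "realizes zs t' t'' x'" "t \<in> T" "x \<in> carrier wr" "x' \<in> carrier wr"
  shows "realizes (ys @ zs) t t'' (x \<otimes>\<^bsub>wr\<^esub> x')"
proof -
  have "elt (acts (ys @ zs) c) t'' = elt c t \<otimes>\<^bsub>wr\<^esub> (x \<otimes>\<^bsub>wr\<^esub> x')" if c: "conf_ok c" for c
  proof -
    have c': "conf_ok (acts ys c)" using assms(1) c by (intro acts_ok) (auto simp: realizes_def)
    have "elt (acts ys c) t' = elt c t \<otimes>\<^bsub>wr\<^esub> x"
      using assms(1) c unfolding realizes_def by blast
    moreover have "elt (acts zs (acts ys c)) t'' = elt (acts ys c) t' \<otimes>\<^bsub>wr\<^esub> x'"
      using assms(2) c' unfolding realizes_def by blast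
    ultimately have "elt (acts (ys @ zs) c) t'' = elt c t \<otimes>\<^bsub>wr\<^esub> x \<otimes>\<^bsub>wr\<^esub> x'" by simp
    then show ?thesis using assms(3-5) elt_closed[OF c] by (simp add: W.m_assoc)
  qed
  then show ?thesis using assms(1,2) unfolding realizes_def by auto
qed

lemma realizes_single:
  assumes t: "t \<in> T" and h: "h \<in> Hc"
  shows "realizes [(1, t, h)] t t (single H V \<one>\<^bsub>V\<^esub> (hv h), \<one>\<^bsub>V\<^esub>)"
proof -
  have "elt (st, l @ [((st, t), h)]) t = elt (st, l) t \<otimes>\<^bsub>wr\<^esub> (single H V \<one>\<^bsub>V\<^esub> (hv h), \<one>\<^bsub>V\<^esub>)"
    if c: "conf_ok (st, l)" for st l
  proof -
    have p: "pt (st, t) \<in> carrier V" using c t by (auto simp: conf_ok_def pt_closed)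
    have "label (l @ [((st, t), h)]) =
      (\<lambda>v\<in>carrier V. label l v \<otimes>\<^bsub>H\<^esub> single H V \<one>\<^bsub>V\<^esub> (hv h) (inv\<^bsub>V\<^esub> pt (st, t) \<otimes>\<^bsub>V\<^esub> v))"
      unfolding label_def[of "l @ _"]
    proof (rule restrict_ext)
      fix v assume v: "v \<in> carrier V"
      have "inv\<^bsub>V\<^esub> pt (st, t) \<otimes>\<^bsub>V\<^esub> v = \<one>\<^bsub>V\<^esub> \<longleftrightarrow> pt (st, t) = v"
        using v p by (metis V.inv_closed V.inv_equality V.inv_inv V.l_inv)
      moreover have "list_mult H (map (\<lambda>e. hv (snd e)) (filter (\<lambda>e. pt (fst e) = v) l)) \<in> carrier H"
        by (rule H.list_mult_closed'[OF conf_hv[OF c]])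
      ultimately show "list_mult H (map (\<lambda>e. hv (snd e)) (filter (\<lambda>e. pt (fst e) = v) (l @ [((st, t), h)])))
        = label l v \<otimes>\<^bsub>H\<^esub> single H V \<one>\<^bsub>V\<^esub> (hv h) (inv\<^bsub>V\<^esub> pt (st, t) \<otimes>\<^bsub>V\<^esub> v)"
        using v p conf_hv[OF c] h
        by (auto simp: label_def single_def H.list_mult_append hv_closed)
    qed
    then show ?thesis using p by (simp add: elt_def wreath_simps)
  qed
  then show ?thesis using assms unfolding realizes_def by (auto simp: oper_ok_def)
qed

lemma acts_moves:
  assumes "set w \<subseteq> D" "set st \<subseteq> D"
  shows "\<exists>st'. acts (map (\<lambda>d. (2, d, 0)) (rev w)) (st, l) = (st', l) \<and> set st' \<subseteq> D \<and> val st' = val st \<otimes>\<^bsub>V\<^esub> val w"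
  using assms(1)
proof (induction w)
  case Nil
  then show ?case using assms(2) by (simp add: val_closed)
next
  case (Cons d w)
  then obtain st' where st': "acts (map (\<lambda>d. (2, d, 0)) (rev w)) (st, l) = (st', l)" "set st' \<subseteq> D"
    "val st' = val st \<otimes>\<^bsub>V\<^esub> val w" by auto
  then show ?case using Cons.prems assms(2)
    by (auto simp: val_mv V.m_assoc val_closed dv_closed dest: subsetD[OF set_mv])
qed

text \<open>\<open>tv t\<close> times v is rewritten as a path w followed by a representative
  \<open>tv t'\<close>. The path depends on t and v but not on the vertex, and right multiplication
  by its value is a sequence of moves. As paths list the last direction first, the moves are made in
  reverse.\<close>

lemma realizes_pos:
  assumes t: "t \<in> T" and v: "v \<in> carrier V"
  shows "\<exists>ys t'. realizes ys t t' (one_map, v)"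
proof -
  obtain w t' where w: "set w \<subseteq> D" "t' \<in> T" "tv t \<otimes>\<^bsub>V\<^esub> v = val w \<otimes>\<^bsub>V\<^esub> tv t'"
    using coords[of "tv t \<otimes>\<^bsub>V\<^esub> v"] tv_closed[OF t] v unfolding val_def[symmetric] by auto
  define ys :: "oper list" where "ys = map (\<lambda>d. (2, d, 0)) (rev w)"
  have "elt (acts ys (st, l)) t' = elt (st, l) t \<otimes>\<^bsub>wr\<^esub> (one_map, v)" if c: "conf_ok (st, l)" for st l
  proof -
    have st: "set st \<subseteq> D" using c by (simp add: conf_ok_def)
    obtain st' where st': "acts ys (st, l) = (st', l)" "set st' \<subseteq> D" "val st' = val st \<otimes>\<^bsub>V\<^esub> val w"
      using acts_moves[OF w(1) st] unfolding ys_def by blast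
    have "pt (st', t') = val st \<otimes>\<^bsub>V\<^esub> (val w \<otimes>\<^bsub>V\<^esub> tv t')"
      using st' st w by (simp add: pt_def V.m_assoc val_closed tv_closed)
    also have "\<dots> = pt (st, t) \<otimes>\<^bsub>V\<^esub> v"
      unfolding w(3)[symmetric] using st t v by (simp add: pt_def V.m_assoc val_closed tv_closed)
    finally have "pt (st', t') = pt (st, t) \<otimes>\<^bsub>V\<^esub> v" .
    moreover have "(\<lambda>a\<in>carrier V. label l a \<otimes>\<^bsub>H\<^esub> one_map (inv\<^bsub>V\<^esub> pt (st, t) \<otimes>\<^bsub>V\<^esub> a)) = restrict (label l) (carrier V)"
      using finsupp_val[OF label_finsupp[OF c]] pt_closed[OF st t] by (intro restrict_ext) simp
    ultimately show ?thesis
      using st'(1) finsupp_ext[OF label_finsupp[OF c]] by (simp add: elt_def wreath_simps)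
  qed
  then have "realizes ys t t' (one_map, v)"
    using w unfolding realizes_def by (auto simp: ys_def oper_ok_def)
  then show ?thesis by blast
qed

lemma realizes_exists: "x \<in> carrier wr \<Longrightarrow> \<forall>t\<in>T. \<exists>ys t'. realizes ys t t' x"
proof (rule wreath_induct)
  fix x y
  assume xy: "x \<in> carrier wr" "y \<in> carrier wr" "\<forall>t\<in>T. \<exists>ys t'. realizes ys t t' x" "\<forall>t\<in>T. \<exists>ys t'. realizes ys t t' y"
  show "\<forall>t\<in>T. \<exists>ys t'. realizes ys t t' (x \<otimes>\<^bsub>wr\<^esub> y)"
  proof
    fix t assume t: "t \<in> T"
    then obtain ys t' where ys: "realizes ys t t' x" using xy(3) by blast
    then have "t' \<in> T" by (simp add: realizes_def)
    then obtain zs t'' where "realizes zs t' t'' y" using xy(4) by blast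
    from realizes_mult[OF ys this t xy(1,2)] show "\<exists>ys t'. realizes ys t t' (x \<otimes>\<^bsub>wr\<^esub> y)" by blast
  qed
next
  fix h assume "h \<in> carrier H"
  then obtain hc where "hc \<in> Hc" "h = hv hc" using hv by (auto simp: bij_betw_def)
  then show "\<forall>t\<in>T. \<exists>ys t'. realizes ys t t' (single H V \<one>\<^bsub>V\<^esub> h, \<one>\<^bsub>V\<^esub>)"
    using realizes_single by blast
next
  fix v assume "v \<in> carrier V"
  then show "\<forall>t\<in>T. \<exists>ys t'. realizes ys t t' (one_map, v)" using realizes_pos by blast
qed

lemma pt_inj:
  assumes "set (fst x) \<subseteq> D" "reduced (fst x)" "snd x \<in> T" "set (fst y) \<subseteq> D" "reduced (fst y)" "snd y \<in> T"
    "pt x = pt y"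
  shows "x = y"
  using coords_inj[OF assms(1,4,2,5,3,6)] assms(7) by (simp add: pt_def val_def prod_eq_iff)

text \<open>The stacks in a log are reduced, so different places are different elements of the
  group; collecting log entries by element or by place gives the same factors.\<close>

lemma label_eq_eff:
  assumes "conf_ok (st, l)" "e \<in> set l"
  shows "label l (pt (fst e)) = eff H hv l (fst e)"
proof -
  have "filter (\<lambda>e'. pt (fst e') = pt (fst e)) l = filter (\<lambda>e'. fst e' = fst e) l"
  proof (rule filter_cong[OF refl])
    fix e' assume "e' \<in> set l"
    then show "pt (fst e') = pt (fst e) \<longleftrightarrow> fst e' = fst e"
      using assms pt_inj[of "fst e'" "fst e"] unfolding conf_ok_def by auto
  qed
  moreover have "pt (fst e) \<in> carrier V"
    using assms pt_closed[of "fst (fst e)" "snd (fst e)"] by (simp add: conf_ok_def)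
  ultimately show ?thesis by (simp add: label_def eff_def)
qed

lemma label_one_iff:
  assumes "conf_ok (st, l)"
  shows "label l = one_map \<longleftrightarrow> (\<forall>x. eff H hv l x = \<one>\<^bsub>H\<^esub>)"
proof
  assume l: "label l = one_map"
  show "\<forall>x. eff H hv l x = \<one>\<^bsub>H\<^esub>"
  proof
    fix x
    show "eff H hv l x = \<one>\<^bsub>H\<^esub>"
    proof (cases "\<exists>e\<in>set l. fst e = x")
      case True
      then obtain e where e: "e \<in> set l" "fst e = x" by blast
      then have "pt x \<in> carrier V"
        using assms pt_closed[of "fst x" "snd x"] by (auto simp: conf_ok_def)
      then show ?thesis using label_eq_eff[OF assms e(1)] e(2) l by simp
    next
      case False
      then have "filter (\<lambda>e. fst e = x) l = []" by (auto simp: filter_empty_conv)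
      then show ?thesis by (simp add: eff_def)
    qed
  qed
next
  assume e: "\<forall>x. eff H hv l x = \<one>\<^bsub>H\<^esub>"
  have "list_mult H (map (\<lambda>e. hv (snd e)) (filter (\<lambda>e. pt (fst e) = v) l)) = \<one>\<^bsub>H\<^esub>"
    if v: "v \<in> carrier V" for v
  proof (cases "\<exists>e\<in>set l. pt (fst e) = v")
    case True
    then obtain e' where "e' \<in> set l" "pt (fst e') = v" by blast
    then show ?thesis using label_eq_eff[OF assms, of e'] e v by (auto simp: label_def)
  next
    case False
    then have "filter (\<lambda>e. pt (fst e) = v) l = []" by (auto simp: filter_empty_conv)
    then show ?thesis by simp
  qed
  then show "label l = one_map" unfolding label_def by (intro restrict_ext)
qed

lemma elt_eq_start_iff:
  assumes "conf_ok (st, l)" "t \<in> T" "t0 \<in> T"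
  shows "elt (st, l) t = elt ([], []) t0 \<longleftrightarrow> st = [] \<and> t = t0 \<and> (\<forall>x. eff H hv l x = \<one>\<^bsub>H\<^esub>)"
proof -
  have "label [] = one_map" by (simp add: label_def)
  moreover have "pt (st, t) = pt ([], t0) \<longleftrightarrow> st = [] \<and> t = t0"
    using pt_inj[of "(st, t)" "([], t0)"] assms by (auto simp: conf_ok_def)
  ultimately show ?thesis using label_one_iff[OF assms(1)] by (auto simp: elt_def)
qed

end


section \<open>Coordinates on a virtually free group\<close>

text \<open>Needed for numbering a basis of the free subgroup: all elements are values of words over
  a finite alphabet.\<close>

lemma countable_carrier:
  assumes "group G" "finitely_generated G" shows "countable (carrier G)"
proof -
  interpret group G by fact
  obtain X where X: "finite X" "X \<subseteq> carrier G" "generate G X = carrier G"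
    using assms(2) by (auto simp: finitely_generated_def)
  let ?val = "\<lambda>w. list_mult G (map (letter_val G) w)"
  have closed: "set (map (letter_val G) w) \<subseteq> carrier G" if "w \<in> lists (UNIV \<times> X)" for w
    using that X(2) by (induction w) auto
  have "x \<in> ?val ` lists (UNIV \<times> X)" if "x \<in> generate G X" for x
    using that
  proof (induction rule: generate.induct)
    case one
    show ?case by (rule image_eqI[of _ _ "[]"]) auto
  next
    case (incl h)
    then show ?case using X(2) by (intro image_eqI[of _ _ "[(True, h)]"]) auto
  next
    case (inv h)
    then show ?case using X(2) by (intro image_eqI[of _ _ "[(False, h)]"]) auto
  next
    case (eng h1 h2)
    then obtain w1 w2 where w: "w1 \<in> lists (UNIV \<times> X)" "w2 \<in> lists (UNIV \<times> X)" "h1 = ?val w1" "h2 = ?val w2"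
      by blast
    then show ?case
      using list_mult_append[OF closed closed, of w1 w2] by (intro image_eqI[of _ _ "w1 @ w2"]) auto
  qed
  then have "carrier G \<subseteq> ?val ` lists (UNIV \<times> X)" using X(3) by blast
  moreover have "countable (lists ((UNIV :: bool set) \<times> X))"
    using X(1) by (intro countable_lists countable_SIGMA) (auto intro: countable_finite)
  ultimately show ?thesis by (meson countable_image countable_subset)
qed

lemma coset_transversal:
  fixes G :: "('a, 'b) monoid_scheme" (structure)
  assumes "group G" "subgroup F G" "finite (rcosets\<^bsub>G\<^esub> F)"
  obtains n :: nat and tv where "\<And>t. t < n \<Longrightarrow> tv t \<in> carrier G"
    "\<And>v. v \<in> carrier G \<Longrightarrow> \<exists>f\<in>F. \<exists>t<n. v = f \<otimes>\<^bsub>G\<^esub> tv t"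
    "\<And>f f' t t'. f \<in> F \<Longrightarrow> f' \<in> F \<Longrightarrow> t < n \<Longrightarrow> t' < n \<Longrightarrow> f \<otimes>\<^bsub>G\<^esub> tv t = f' \<otimes>\<^bsub>G\<^esub> tv t' \<Longrightarrow> f = f' \<and> t = t'"
proof -
  interpret group G by fact
  interpret F: subgroup F G by fact
  obtain C :: "nat \<Rightarrow> 'a set" and n where C: "rcosets F = C ` {i. i < n}" "inj_on C {i. i < n}"
    using finite_imp_nat_seg_image_inj_on[OF assms(3)] by blast
  define tv where "tv i = (SOME v. v \<in> C i)" for i
  have tv: "tv i \<in> carrier G \<and> F #> tv i = C i" if "i < n" for i
  proof -
    have "C i \<in> rcosets F" using C(1) that by auto
    then obtain v where v: "v \<in> carrier G" "C i = F #> v" by (auto simp: RCOSETS_def)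
    then have "v \<in> C i" using rcos_self[OF v(1) assms(2)] by simp
    then have "tv i \<in> C i" unfolding tv_def by (rule someI)
    then have t: "tv i \<in> F #> v" using v by simp
    then have "tv i \<in> carrier G" using F.subset v(1) r_coset_subset_G by blast
    moreover have "F #> v = F #> tv i" by (rule repr_independence[OF t v(1) assms(2)])
    ultimately show ?thesis using v(2) by simp
  qed
  show thesis
  proof
    show "tv t \<in> carrier G" if "t < n" for t using tv[OF that] by simp
  next
    fix v assume v: "v \<in> carrier G"
    then have "F #> v \<in> rcosets F" by (rule rcosetsI[OF F.subset])
    then obtain t where t: "t < n" "F #> v = C t" using C(1) by auto
    then have "v \<in> F #> tv t" using tv[OF t(1)] rcos_self[OF v assms(2)] by simp
    then show "\<exists>f\<in>F. \<exists>t<n. v = f \<otimes> tv t" using t(1) by (auto simp: r_coset_def)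
  next
    fix f f' t t' assume f: "f \<in> F" "f' \<in> F" and t: "t < n" "t' < n" and eq: "f \<otimes> tv t = f' \<otimes> tv t'"
    have c: "tv t \<in> carrier G" "tv t' \<in> carrier G" "f \<in> carrier G" "f' \<in> carrier G" using tv t f by auto
    have "f \<otimes> tv t \<in> F #> tv t" "f' \<otimes> tv t' \<in> F #> tv t'" using f by (auto simp: r_coset_def)
    then have "F #> tv t = F #> tv t'"
      using repr_independence[OF _ c(1) assms(2)] repr_independence[OF _ c(2) assms(2)] eq by metis
    then have "t = t'" using tv t C(2) by (auto dest: inj_onD)
    then show "f = f' \<and> t = t'" using eq c by simp
  qed
qed

section \<open>Reduced stacks and reduced words of the free subgroup\<close>

lemma reduced_successively: "reduced st \<longleftrightarrow> successively (\<lambda>d e. d \<noteq> opp e) st"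
  by (induction st rule: reduced.induct) auto

lemma opp_div2: "opp d div 2 = d div 2"
  by (auto simp: opp_def elim: oddE evenE)

lemma even_opp: "even (opp d) \<longleftrightarrow> odd d"
  by (auto simp: opp_def)

lemma eq_if_div2: "d div 2 = e div 2 \<Longrightarrow> even d = even e \<Longrightarrow> d = (e::nat)"
  by (metis even_two_times_div_two odd_two_times_div_two_succ)

text \<open>A stack read from its end becomes a word over the basis. Since \<open>opp\<close>
  exchanges a generator with its inverse, reduced stacks become reduced words, and freeness makes
  their values distinct. The basis may be infinite, as may D; each machine uses finitely many
  directions.\<close>

lemma free_coordinates:
  fixes G :: "('a, 'b) monoid_scheme" (structure)
  assumes G: "group G" and F: "subgroup F G" and free: "free_group_on (G\<lparr>carrier := F\<rparr>) S" and S: "countable S"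
  obtains dv and D :: "nat set" where "\<And>d. d \<in> D \<Longrightarrow> dv d \<in> carrier G \<and> 2 \<le> d \<and> dv (opp d) = inv\<^bsub>G\<^esub> dv d"
    "\<And>st. set st \<subseteq> D \<Longrightarrow> foldr (\<lambda>d x. x \<otimes>\<^bsub>G\<^esub> dv d) st \<one>\<^bsub>G\<^esub> \<in> F"
    "\<And>f. f \<in> F \<Longrightarrow> \<exists>st. set st \<subseteq> D \<and> f = foldr (\<lambda>d x. x \<otimes>\<^bsub>G\<^esub> dv d) st \<one>\<^bsub>G\<^esub>"
    "inj_on (\<lambda>st. foldr (\<lambda>d x. x \<otimes>\<^bsub>G\<^esub> dv d) st \<one>\<^bsub>G\<^esub>) {st. set st \<subseteq> D \<and> reduced st}"
proof -
  interpret group G by fact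
  interpret F: subgroup F G by fact
  let ?G = "G\<lparr>carrier := F\<rparr>"
  have SF: "S \<subseteq> F" and bij: "bij_betw (\<lambda>w. list_mult ?G (map (letter_val ?G) w)) (reduced_words S) F"
    using free by (auto simp: free_group_on_def)
  have lv: "letter_val ?G x = letter_val G x" if "snd x \<in> S" for x
    using that SF m_inv_consistent[OF F] by (cases x) auto
  have lm: "list_mult ?G w = list_mult G w" for w
    by (induction w) auto
  \<comment> \<open>The generator with number k gets the direction 2k + 2 and its inverse the
    direction 2k + 3, which leaves 0 and 1 to the root.\<close>
  define dl where "dl d = (even d, from_nat_into S (d div 2 - 1))" for d
  define D where "D = {d. 2 \<le> d \<and> d div 2 - 1 \<in> to_nat_on S ` S}"
  define dv where "dv d = letter_val G (dl d)" for d
  have dl_S: "snd (dl d) \<in> S" if "d \<in> D" for d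
    using that S by (auto simp: D_def dl_def)
  have dl_inj: "d = e" if "d \<in> D" "e \<in> D" "dl d = dl e" for d e
  proof (rule eq_if_div2)
    have "d div 2 - 1 = e div 2 - 1"
      using that S by (auto simp: D_def dl_def)
    moreover have "1 \<le> d div 2" "1 \<le> e div 2" using that by (auto simp: D_def)
    ultimately show "d div 2 = e div 2" by linarith
    show "even d = even e" using that(3) by (simp add: dl_def)
  qed
  have dl_opp: "dl (opp d) = (\<not> fst (dl d), snd (dl d))" for d
    by (simp add: dl_def opp_div2 even_opp)
  have opp_D: "opp d \<in> D" if "d \<in> D" for d
    using that opp_div2[of d] by (auto simp: D_def opp_def elim: oddE)
  have dl_surj: "\<exists>d\<in>D. dl d = x" if "snd x \<in> S" for x
    using that S
    by (intro bexI[of _ "2 * (to_nat_on S (snd x) + 1) + (if fst x then 0 else 1)"])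
      (cases x; auto simp: D_def dl_def)+
  have dv_F: "dv d \<in> F" if "d \<in> D" for d
    using dl_S[OF that] SF by (cases "dl d") (auto simp: dv_def)
  have val: "foldr (\<lambda>d x. x \<otimes> dv d) st \<one> = list_mult ?G (map (letter_val ?G) (map dl (rev st)))"
    if "set st \<subseteq> D" for st
    using that
  proof (induction st)
    case (Cons d st)
    have "set (map (letter_val G) (map dl (rev st))) \<subseteq> carrier G"
      using Cons.prems dv_F F.subset by (auto simp: dv_def)
    moreover have "dv d \<in> carrier G" using Cons.prems dv_F F.subset by auto
    ultimately have e1: "list_mult G (map (letter_val G) (map dl (rev st)) @ [dv d])
        = list_mult G (map (letter_val G) (map dl (rev st))) \<otimes> dv d"
      by (subst list_mult_append) auto
    have e2: "map (letter_val ?G) (map dl (rev st)) = map (letter_val G) (map dl (rev st))"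
      by (rule map_cong[OF refl], rule lv) (use Cons.prems dl_S in auto)
    have e3: "letter_val ?G (dl d) = dv d"
      unfolding dv_def by (rule lv) (use Cons.prems dl_S in auto)
    have "foldr (\<lambda>d x. x \<otimes> dv d) st \<one> = list_mult G (map (letter_val G) (map dl (rev st)))"
      using Cons unfolding lm e2 by simp
    then have "foldr (\<lambda>d x. x \<otimes> dv d) (d # st) \<one> = list_mult G (map (letter_val G) (map dl (rev st)) @ [dv d])"
      by (simp only: foldr.simps o_apply e1)
    then show ?case unfolding lm rev.simps map_append list.map e2 e3 .
  qed simp
  have red: "map dl (rev st) \<in> reduced_words S" if "set st \<subseteq> D" "reduced st" for st
  proof -
    have "successively (\<lambda>d e. case (dl e, dl d) of ((a, s), b, t) \<Rightarrow> s = t \<longrightarrow> a = b) st"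
      using that(2)[unfolded reduced_successively]
    proof (rule successively_mono)
      fix d e assume de: "d \<in> set st" "e \<in> set st" "d \<noteq> opp e"
      have "dl d \<noteq> dl (opp e)" using dl_inj[of d "opp e"] de that(1) opp_D by auto
      then show "case (dl e, dl d) of ((a, s), b, t) \<Rightarrow> s = t \<longrightarrow> a = b"
        unfolding dl_opp by (cases "dl d"; cases "dl e") auto
    qed
    then have "successively (\<lambda>(a, s) (b, t). s = t \<longrightarrow> a = b) (map dl (rev st))"
      by (simp add: successively_map case_prod_beta)
    then show ?thesis using that(1) dl_S by (auto simp: reduced_words_def)
  qed
  show thesis
  proof
    show "dv d \<in> carrier G \<and> 2 \<le> d \<and> dv (opp d) = inv dv d" if d: "d \<in> D" for d
    proof (intro conjI)
      show "dv d \<in> carrier G" using dv_F[OF d] by simp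
      show "2 \<le> d" using d by (simp add: D_def)
      show "dv (opp d) = inv dv d"
        using dl_S[OF d] SF F.subset unfolding dv_def dl_opp by (cases "dl d") auto
    qed
  next
    fix st assume "set st \<subseteq> D"
    then show "foldr (\<lambda>d x. x \<otimes> dv d) st \<one> \<in> F"
      by (induction st) (auto intro: dv_F)
  next
    fix f assume "f \<in> F"
    then obtain w where w: "w \<in> reduced_words S" "f = list_mult ?G (map (letter_val ?G) w)"
      using bij by (auto simp: bij_betw_def)
    have "\<forall>x\<in>set w. \<exists>d. d \<in> D \<and> dl d = x" using w(1) dl_surj by (fastforce simp: reduced_words_def)
    then obtain cd where cd: "\<And>x. x \<in> set w \<Longrightarrow> cd x \<in> D \<and> dl (cd x) = x" by metis
    let ?st = "rev (map cd w)"
    have "set ?st \<subseteq> D" using cd by auto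
    moreover have "map dl (rev ?st) = w" using cd by (simp add: map_idI)
    ultimately show "\<exists>st. set st \<subseteq> D \<and> f = foldr (\<lambda>d x. x \<otimes> dv d) st \<one>"
      using val[of ?st] w(2) by (intro exI[of _ ?st]) simp
  next
    show "inj_on (\<lambda>st. foldr (\<lambda>d x. x \<otimes> dv d) st \<one>) {st. set st \<subseteq> D \<and> reduced st}"
    proof (rule inj_onI)
      fix st st' assume a: "st \<in> {st. set st \<subseteq> D \<and> reduced st}" "st' \<in> {st. set st \<subseteq> D \<and> reduced st}"
        and eq: "foldr (\<lambda>d x. x \<otimes> dv d) st \<one> = foldr (\<lambda>d x. x \<otimes> dv d) st' \<one>"
      have "map dl (rev st) = map dl (rev st')"
        using bij eq val[of st] val[of st'] red[of st] red[of st'] a unfolding bij_betw_def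
        by (auto dest: inj_onD simp del: map_map)
      moreover have "inj_on dl (set (rev st) \<union> set (rev st'))"
        using a dl_inj by (intro inj_onI) auto
      ultimately show "st = st'" by (metis inj_on_map_eq_map rev_rev_ident)
    qed
  qed
qed

theorem wreath_coords_exist:
  assumes H: "group H" "finite (carrier H)" and V: "group V" "finitely_generated V" "virtually_free V"
  obtains hv Hc tv T dv D where "wreath_coords H V hv Hc tv T dv D"
proof -
  interpret H: group H by fact
  interpret V: group V by fact
  obtain hv where hv: "bij_betw hv {0..<card (carrier H)} (carrier H)"
    using ex_bij_betw_nat_finite[OF H(2)] by blast
  obtain F S where F: "subgroup F V" "free_group_on (V\<lparr>carrier := F\<rparr>) S" "finite (rcosets\<^bsub>V\<^esub> F)"
    using V(3) by (auto simp: virtually_free_def free_group_def)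
  interpret F: subgroup F V by fact
  have "S \<subseteq> carrier V" using F(2) F.subset by (auto simp: free_group_on_def)
  then have "countable S" using countable_carrier[OF V(1,2)] countable_subset by blast
  then obtain dv D where D:
    "\<And>d. d \<in> D \<Longrightarrow> dv d \<in> carrier V \<and> 2 \<le> d \<and> dv (opp d) = inv\<^bsub>V\<^esub> dv d"
    "\<And>st. set st \<subseteq> D \<Longrightarrow> foldr (\<lambda>d x. x \<otimes>\<^bsub>V\<^esub> dv d) st \<one>\<^bsub>V\<^esub> \<in> F"
    "\<And>f. f \<in> F \<Longrightarrow> \<exists>st. set st \<subseteq> D \<and> f = foldr (\<lambda>d x. x \<otimes>\<^bsub>V\<^esub> dv d) st \<one>\<^bsub>V\<^esub>"
    "inj_on (\<lambda>st. foldr (\<lambda>d x. x \<otimes>\<^bsub>V\<^esub> dv d) st \<one>\<^bsub>V\<^esub>) {st. set st \<subseteq> D \<and> reduced st}"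
    by (rule free_coordinates[OF V(1) F(1,2)]) (rule that; assumption)
  obtain n :: nat and tv where T:
    "\<And>t. t < n \<Longrightarrow> tv t \<in> carrier V"
    "\<And>v. v \<in> carrier V \<Longrightarrow> \<exists>f\<in>F. \<exists>t<n. v = f \<otimes>\<^bsub>V\<^esub> tv t"
    "\<And>f f' t t'. f \<in> F \<Longrightarrow> f' \<in> F \<Longrightarrow> t < n \<Longrightarrow> t' < n \<Longrightarrow> f \<otimes>\<^bsub>V\<^esub> tv t = f' \<otimes>\<^bsub>V\<^esub> tv t' \<Longrightarrow> f = f' \<and> t = t'"
    by (rule coset_transversal[OF V(1) F(1,3)]) (rule that; assumption)
  have "wreath_coords H V hv {0..<card (carrier H)} tv {..<n} dv D"
  proof unfold_locales
    fix v assume "v \<in> carrier V"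
    then obtain f t where ft: "f \<in> F" "t < n" "v = f \<otimes>\<^bsub>V\<^esub> tv t" using T(2) by blast
    with D(3) obtain st where "set st \<subseteq> D" "f = foldr (\<lambda>d x. x \<otimes>\<^bsub>V\<^esub> dv d) st \<one>\<^bsub>V\<^esub>" by blast
    then show "\<exists>st t. set st \<subseteq> D \<and> t \<in> {..<n} \<and> v = foldr (\<lambda>d x. x \<otimes>\<^bsub>V\<^esub> dv d) st \<one>\<^bsub>V\<^esub> \<otimes>\<^bsub>V\<^esub> tv t"
      using ft by (intro exI[of _ st] exI[of _ t]) simp
  next
    fix st st' t t' assume *: "set st \<subseteq> D" "set st' \<subseteq> D" "reduced st" "reduced st'" "t \<in> {..<n}" "t' \<in> {..<n}"
      "foldr (\<lambda>d x. x \<otimes>\<^bsub>V\<^esub> dv d) st \<one>\<^bsub>V\<^esub> \<otimes>\<^bsub>V\<^esub> tv t = foldr (\<lambda>d x. x \<otimes>\<^bsub>V\<^esub> dv d) st' \<one>\<^bsub>V\<^esub> \<otimes>\<^bsub>V\<^esub> tv t'"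
    have "foldr (\<lambda>d x. x \<otimes>\<^bsub>V\<^esub> dv d) st \<one>\<^bsub>V\<^esub> = foldr (\<lambda>d x. x \<otimes>\<^bsub>V\<^esub> dv d) st' \<one>\<^bsub>V\<^esub> \<and> t = t'"
      using T(3)[OF D(2)[OF *(1)] D(2)[OF *(2)] _ _ *(7)] *(5,6) by simp
    then show "st = st' \<and> t = t'"
      using D(4) *(1-4) by (auto dest!: inj_onD)
  qed (use hv T(1) D(1) in auto)
  then show thesis by (rule that)
qed


section \<open>The machine of an automaton\<close>

lemma path_append: "path A p (gs @ hs) r \<longleftrightarrow> (\<exists>q. path A p gs q \<and> path A q hs r)"
  by (induction gs arbitrary: p) auto

type_synonym mstate = "oper list \<times> nat list \<times> nat \<times> nat"

text \<open>In the state \<open>(y, u, q, t)\<close> the operations \<open>y\<close> and then the generators \<open>u\<close> are still to be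
  performed before the automaton is in state \<open>q\<close>; the position is in the coset \<open>t\<close> after \<open>y\<close>.\<close>

abbreviation ms :: "oper list \<Rightarrow> nat list \<Rightarrow> nat \<Rightarrow> nat \<Rightarrow> nat" where
  "ms y u q t \<equiv> encode (y, u, q, t)"

locale wreath_instance = wreath_coords H V hv Hc tv T dv D
  for H :: "('h, 'm) monoid_scheme" and V :: "('v, 'n) monoid_scheme" and hv Hc tv T dv D +
  fixes xs :: "(('v \<Rightarrow> 'h) \<times> 'v) list" and tab :: "nat \<Rightarrow> nat \<Rightarrow> oper list \<times> nat"
    and iv :: "nat \<Rightarrow> nat" and t0 :: nat
  assumes xs: "set xs \<subseteq> carrier wr"
    and tab: "i < length xs \<Longrightarrow> t \<in> T \<Longrightarrow> realizes (fst (tab i t)) t (snd (tab i t)) (xs ! i)"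
    and iv: "i < length xs \<Longrightarrow> iv i < length xs \<and> xs ! iv i = inv\<^bsub>wr\<^esub> (xs ! i)"
    and t0: "t0 \<in> T"
begin

definition meps :: "(nat \<times> nat list \<times> nat) list \<Rightarrow> (nat \<times> nat) set" where
  "meps es = {(ms [] (i # u) q t, ms (fst (tab i t)) u q (snd (tab i t))) | i u q t. i < length xs \<and> t \<in> T}
    \<union> {(ms [] [] p t, ms [] u q t) | p u q t. (p, u, q) \<in> set es \<and> t \<in> T}"

definition mlab :: "(nat \<times> nat \<times> nat \<times> nat) set" where
  "mlab = {(ms ((1, a, h) # y) u q t, a, h, ms y u q t) | a h y u q t. a \<in> T \<and> h \<in> Hc}"

text \<open>The bound on d is a condition that a program can test, unlike membership in D. In states
  that a run reaches, the pending directions lie in D by \<open>run_invariant\<close>.\<close>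

definition mmov :: "(nat \<times> nat \<times> nat) set" where
  "mmov = {(ms ((2, d, 0) # y) u q t, d, ms y u q t) | d y u q t. 2 \<le> d}"

abbreviation mrun where "mrun es \<equiv> run (meps es) mlab mmov"

definition word_ok :: "nat list \<Rightarrow> bool" where
  "word_ok u \<longleftrightarrow> set u \<subseteq> {..<length xs}"

lemma word_ok_simps [simp]: "word_ok []" "word_ok (i # u) \<longleftrightarrow> i < length xs \<and> word_ok u"
  "word_ok (u @ v) \<longleftrightarrow> word_ok u \<and> word_ok v"
  by (auto simp: word_ok_def)

lemma word_val_simps [simp]: "word_val wr xs [] = \<one>\<^bsub>wr\<^esub>"
  "word_val wr xs (i # u) = xs ! i \<otimes>\<^bsub>wr\<^esub> word_val wr xs u"
  by (simp_all add: word_val_def)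

lemma xs_closed: "i < length xs \<Longrightarrow> xs ! i \<in> carrier wr"
  using xs nth_mem by blast

lemma word_val_closed: "word_ok u \<Longrightarrow> word_val wr xs u \<in> carrier wr"
  by (induction u) (auto simp: xs_closed)

lemma word_val_append:
  "word_ok u \<Longrightarrow> word_ok v \<Longrightarrow> word_val wr xs (u @ v) = word_val wr xs u \<otimes>\<^bsub>wr\<^esub> word_val wr xs v"
  by (induction u) (auto simp: xs_closed word_val_closed W.m_assoc)

text \<open>The machine multiplies by the inverse of w before it follows the automaton, which turns
  membership of w into a return to the starting point.\<close>

definition inv_word :: "nat list \<Rightarrow> nat list" where
  "inv_word w = rev (map iv w)"

lemma inv_word_ok: "word_ok w \<Longrightarrow> word_ok (inv_word w)"
  by (induction w) (auto simp: inv_word_def iv)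

lemma word_val_inv_word: "word_ok w \<Longrightarrow> word_val wr xs (inv_word w) = inv\<^bsub>wr\<^esub> word_val wr xs w"
proof (induction w)
  case (Cons i w)
  have "inv_word (i # w) = inv_word w @ [iv i]" by (simp add: inv_word_def)
  then show ?case using Cons inv_word_ok[of w]
    by (simp add: word_val_append iv xs_closed word_val_closed W.inv_mult_group)
qed (simp add: inv_word_def)

section \<open>Simulation of the automaton by the machine\<close>

lemma run_opers:
  "mrun es s st l (ms y u q t) \<Longrightarrow> \<forall>a\<in>set y. oper_ok a
    \<Longrightarrow> mrun es s (fst (acts y (st, l))) (snd (acts y (st, l))) (ms [] u q t)"
proof (induction y arbitrary: st l)
  case (Cons a y)
  have "mrun es s (fst (act a (st, l))) (snd (act a (st, l))) (ms y u q t)"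
  proof (cases "\<exists>d\<in>D. a = (2, d, 0)")
    case True
    then obtain d where d: "d \<in> D" "a = (2, d, 0)" by blast
    then have "(ms (a # y) u q t, d, ms y u q t) \<in> mmov"
      unfolding mmov_def using D_ge by blast
    then show ?thesis using run_mov[OF Cons.prems(1)] d by simp
  next
    case False
    then obtain b h where b: "b \<in> T" "h \<in> Hc" "a = (1, b, h)"
      using Cons.prems(2) by (auto simp: oper_ok_def)
    then have "(ms (a # y) u q t, b, h, ms y u q t) \<in> mlab"
      unfolding mlab_def by blast
    then show ?thesis using run_lab[OF Cons.prems(1)] b by simp
  qed
  then have "mrun es s (fst (acts y (act a (st, l)))) (snd (acts y (act a (st, l)))) (ms [] u q t)"
    using Cons.IH[of "fst (act a (st, l))" "snd (act a (st, l))"] Cons.prems(2) by simp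
  then show ?case by simp
qed simp

lemma run_word:
  assumes "mrun es s st l (ms [] u q t)" "t \<in> T" "conf_ok (st, l)" "word_ok u"
  shows "\<exists>st' l' t'. mrun es s st' l' (ms [] [] q t') \<and> t' \<in> T \<and> conf_ok (st', l') \<and>
    elt (st', l') t' = elt (st, l) t \<otimes>\<^bsub>wr\<^esub> word_val wr xs u"
  using assms
proof (induction u arbitrary: st l t)
  case Nil
  then have "elt (st, l) t = elt (st, l) t \<otimes>\<^bsub>wr\<^esub> word_val wr xs []" by (simp add: elt_closed)
  then show ?case using Nil by blast
next
  case (Cons i u)
  define y t1 where "y = fst (tab i t)" and "t1 = snd (tab i t)"
  have i: "i < length xs" "word_ok u" using Cons.prems by auto
  have r: "realizes y t t1 (xs ! i)" using tab[OF i(1) Cons.prems(2)] by (simp add: y_def t1_def)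
  have "(ms [] (i # u) q t, ms y u q t1) \<in> meps es"
    unfolding meps_def y_def t1_def using i Cons.prems(2) by blast
  from run_eps[OF Cons.prems(1) this]
  have "mrun es s st l (ms y u q t1)" .
  then have r1: "mrun es s (fst (acts y (st, l))) (snd (acts y (st, l))) (ms [] u q t1)"
    by (rule run_opers) (use r in \<open>simp add: realizes_def\<close>)
  have ok: "conf_ok (acts y (st, l))" using r Cons.prems(3) by (intro acts_ok) (auto simp: realizes_def)
  have t1: "t1 \<in> T" using r by (simp add: realizes_def)
  obtain st' l' t' where *: "mrun es s st' l' (ms [] [] q t')" "t' \<in> T" "conf_ok (st', l')"
    "elt (st', l') t' = elt (acts y (st, l)) t1 \<otimes>\<^bsub>wr\<^esub> word_val wr xs u"
    using Cons.IH[OF r1 t1 _ i(2)] ok by auto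
  have "elt (acts y (st, l)) t1 = elt (st, l) t \<otimes>\<^bsub>wr\<^esub> xs ! i"
    using r Cons.prems(3) unfolding realizes_def by blast
  then have "elt (st', l') t' = elt (st, l) t \<otimes>\<^bsub>wr\<^esub> word_val wr xs (i # u)"
    using *(4) Cons.prems i by (simp add: W.m_assoc elt_closed xs_closed word_val_closed)
  then show ?case using *(1-3) by blast
qed

context
  fixes n :: nat and es :: "(nat \<times> nat list \<times> nat) list" and q0 :: nat and fs :: "nat list"
  assumes es: "\<And>p u q. (p, u, q) \<in> set es \<Longrightarrow> word_ok u"
begin

abbreviation aut where "aut \<equiv> automaton_of_code wr xs (n, es, q0, fs)"

lemma trans_iff: "(p, g, q) \<in> transitions aut \<longleftrightarrow> (\<exists>u. (p, u, q) \<in> set es \<and> g = word_val wr xs u)"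
  by (force simp: image_iff)

lemma path_closed: "path aut p gs q \<Longrightarrow> set gs \<subseteq> carrier wr"
  by (induction gs arbitrary: p) (auto simp: trans_iff word_val_closed es simp del: automaton_of_code.simps)

lemma run_path:
  assumes "path aut p gs q" "mrun es s st l (ms [] [] p t)" "t \<in> T" "conf_ok (st, l)"
  shows "\<exists>st' l' t'. mrun es s st' l' (ms [] [] q t') \<and> t' \<in> T \<and> conf_ok (st', l') \<and>
    elt (st', l') t' = elt (st, l) t \<otimes>\<^bsub>wr\<^esub> list_mult wr gs"
  using assms
proof (induction gs arbitrary: p st l t)
  case Nil
  then have "elt (st, l) t = elt (st, l) t \<otimes>\<^bsub>wr\<^esub> list_mult wr []" "p = q" by (simp_all add: elt_closed)
  then show ?case using Nil by blast
next
  case (Cons g gs)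
  obtain q1 where q1: "(p, g, q1) \<in> transitions aut" "path aut q1 gs q"
    using Cons.prems(1) unfolding path.simps by blast
  then obtain u where u: "(p, u, q1) \<in> set es" "g = word_val wr xs u" unfolding trans_iff by blast
  have "(ms [] [] p t, ms [] u q1 t) \<in> meps es"
    unfolding meps_def using u(1) Cons.prems(3) by blast
  from run_word[OF run_eps[OF Cons.prems(2) this] Cons.prems(3,4) es[OF u(1)]]
  obtain st1 l1 t1 where 1: "mrun es s st1 l1 (ms [] [] q1 t1)" "t1 \<in> T" "conf_ok (st1, l1)"
    "elt (st1, l1) t1 = elt (st, l) t \<otimes>\<^bsub>wr\<^esub> g" using u(2) by blast
  obtain st' l' t' where *: "mrun es s st' l' (ms [] [] q t')" "t' \<in> T" "conf_ok (st', l')"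
    "elt (st', l') t' = elt (st1, l1) t1 \<otimes>\<^bsub>wr\<^esub> list_mult wr gs"
    using Cons.IH[OF q1(2) 1(1-3)] by blast
  have "g \<in> carrier wr" "list_mult wr gs \<in> carrier wr"
    using path_closed[OF Cons.prems(1)] W.list_mult_closed'[of gs] by auto
  then have "elt (st', l') t' = elt (st, l) t \<otimes>\<^bsub>wr\<^esub> list_mult wr (g # gs)"
    unfolding *(4) 1(4) using elt_closed[OF Cons.prems(4,3)] by (simp add: W.m_assoc)
  then show ?case using *(1-3) by blast
qed

text \<open>The coset \<open>t0\<close> need not represent the identity, so a run is compared with
  its own starting element, which later cancels on the left.\<close>

definition start_elt where "start_elt = elt ([], []) t0"

lemma start_elt_closed: "start_elt \<in> carrier wr"
  unfolding start_elt_def by (intro elt_closed conf_ok_Nil t0)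

text \<open>If the pending operations and generators were carried out, the configuration would equal
  the starting element times the value of w' times the labels of the automaton path chosen so far.
  The list \<open>gs\<close> already includes the transition whose word is still being
  performed.\<close>

lemma run_invariant:
  assumes w': "word_ok w'" and run: "mrun es (ms [] w' q0 t0) st l k"
  shows "\<exists>y u q t gs. k = ms y u q t \<and> t \<in> T \<and> (\<forall>a\<in>set y. oper_ok a) \<and> word_ok u \<and> conf_ok (st, l) \<and>
    path aut q0 gs q \<and> elt (acts y (st, l)) t \<otimes>\<^bsub>wr\<^esub> word_val wr xs u
      = start_elt \<otimes>\<^bsub>wr\<^esub> word_val wr xs w' \<otimes>\<^bsub>wr\<^esub> list_mult wr gs"
  using run
proof (induction rule: run.induct)
  case run_refl
  have "elt (acts [] ([], [])) t0 \<otimes>\<^bsub>wr\<^esub> word_val wr xs w'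
      = start_elt \<otimes>\<^bsub>wr\<^esub> word_val wr xs w' \<otimes>\<^bsub>wr\<^esub> list_mult wr []"
    using start_elt_closed word_val_closed[OF w'] by (simp add: start_elt_def)
  then show ?case using t0 w' conf_ok_Nil
    by (intro exI[of _ "[]"] exI[of _ w'] exI[of _ q0] exI[of _ t0]) (simp del: automaton_of_code.simps)
next
  case (run_eps st l k k')
  obtain y u q t gs where IH: "k = ms y u q t" "t \<in> T" "\<forall>a\<in>set y. oper_ok a" "word_ok u" "conf_ok (st, l)"
    "path aut q0 gs q" "elt (acts y (st, l)) t \<otimes>\<^bsub>wr\<^esub> word_val wr xs u
      = start_elt \<otimes>\<^bsub>wr\<^esub> word_val wr xs w' \<otimes>\<^bsub>wr\<^esub> list_mult wr gs"
    using run_eps.IH by blast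
  have gs: "set gs \<subseteq> carrier wr" "list_mult wr gs \<in> carrier wr"
    using path_closed[OF IH(6)] W.list_mult_closed' by blast+
  note c = gs(2) start_elt_closed word_val_closed[OF w'] elt_closed[OF IH(5,2)]
  from run_eps.hyps(2) consider
    i u' where "y = []" "u = i # u'" "k' = ms (fst (tab i t)) u' q (snd (tab i t))" "i < length xs"
    | u' q' where "y = []" "u = []" "(q, u', q') \<in> set es" "k' = ms [] u' q' t"
    unfolding meps_def IH(1) by auto
  then show ?case
  proof cases
    case (1 i u')
    have r: "realizes (fst (tab i t)) t (snd (tab i t)) (xs ! i)" by (rule tab[OF 1(4) IH(2)])
    then have "elt (acts (fst (tab i t)) (st, l)) (snd (tab i t)) = elt (st, l) t \<otimes>\<^bsub>wr\<^esub> xs ! i"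
      using IH(5) unfolding realizes_def by blast
    moreover have "word_ok u'" using IH(4) 1 by simp
    ultimately have "elt (acts (fst (tab i t)) (st, l)) (snd (tab i t)) \<otimes>\<^bsub>wr\<^esub> word_val wr xs u'
       = start_elt \<otimes>\<^bsub>wr\<^esub> word_val wr xs w' \<otimes>\<^bsub>wr\<^esub> list_mult wr gs"
      using IH(7) 1 c by (simp add: W.m_assoc xs_closed word_val_closed)
    moreover have "snd (tab i t) \<in> T" "\<forall>a\<in>set (fst (tab i t)). oper_ok a"
      using r by (simp_all add: realizes_def)
    ultimately show ?thesis using 1(3) IH(5,6) \<open>word_ok u'\<close> by blast
  next
    case (2 u' q')
    have u': "word_val wr xs u' \<in> carrier wr" by (rule word_val_closed[OF es[OF 2(3)]])
    have "path aut q0 (gs @ [word_val wr xs u']) q'"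
      using IH(6) 2(3) unfolding path_append path.simps trans_iff by blast
    moreover have "elt (acts [] (st, l)) t \<otimes>\<^bsub>wr\<^esub> word_val wr xs u'
       = start_elt \<otimes>\<^bsub>wr\<^esub> word_val wr xs w' \<otimes>\<^bsub>wr\<^esub> list_mult wr (gs @ [word_val wr xs u'])"
      using IH(7) 2(1,2) c u' W.list_mult_append[OF gs(1), of "[word_val wr xs u']"] by (simp add: W.m_assoc)
    ultimately show ?thesis using 2(4) es[OF 2(3)] IH(2,5)
      by (intro exI[of _ "[]"] exI[of _ u'] exI[of _ q'] exI[of _ t] exI[of _ "gs @ [word_val wr xs u']"])
        (simp del: automaton_of_code.simps)
  qed
next
  case (run_lab st l k b h k')
  obtain y u q t gs where IH: "k = ms y u q t" "t \<in> T" "\<forall>a\<in>set y. oper_ok a" "word_ok u" "conf_ok (st, l)"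
    "path aut q0 gs q" "elt (acts y (st, l)) t \<otimes>\<^bsub>wr\<^esub> word_val wr xs u
      = start_elt \<otimes>\<^bsub>wr\<^esub> word_val wr xs w' \<otimes>\<^bsub>wr\<^esub> list_mult wr gs"
    using run_lab.IH by blast
  from run_lab.hyps(2) obtain y' where y': "y = (1, b, h) # y'" "k' = ms y' u q t"
    unfolding mlab_def IH(1) by auto
  have "conf_ok (act (1, b, h) (st, l))" using IH(3,5) y'(1) by (intro act_ok) auto
  then show ?case using IH y' by (intro exI[of _ y'] exI[of _ u] exI[of _ q] exI[of _ t] exI[of _ gs])
    (simp del: automaton_of_code.simps)
next
  case (run_mov st l k d k')
  obtain y u q t gs where IH: "k = ms y u q t" "t \<in> T" "\<forall>a\<in>set y. oper_ok a" "word_ok u" "conf_ok (st, l)"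
    "path aut q0 gs q" "elt (acts y (st, l)) t \<otimes>\<^bsub>wr\<^esub> word_val wr xs u
      = start_elt \<otimes>\<^bsub>wr\<^esub> word_val wr xs w' \<otimes>\<^bsub>wr\<^esub> list_mult wr gs"
    using run_mov.IH by blast
  from run_mov.hyps(2) obtain y' where y': "y = (2, d, 0) # y'" "k' = ms y' u q t"
    unfolding mmov_def IH(1) by auto
  have "conf_ok (act (2, d, 0) (st, l))" using IH(3,5) y'(1) by (intro act_ok) auto
  then show ?case using IH y' by (intro exI[of _ y'] exI[of _ u] exI[of _ q] exI[of _ t] exI[of _ gs])
    (simp del: automaton_of_code.simps)
qed

theorem in_lang_iff_run:
  assumes w: "word_ok w"
  shows "word_val wr xs w \<in> lang wr aut \<longleftrightarrow>
    (\<exists>l. \<exists>f\<in>set fs. mrun es (ms [] (inv_word w) q0 t0) [] l (ms [] [] f t0) \<and> (\<forall>x. eff H hv l x = \<one>\<^bsub>H\<^esub>))"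
proof
  assume "word_val wr xs w \<in> lang wr aut"
  then obtain gs f where gs: "word_val wr xs w = list_mult wr gs" "path aut q0 gs f" "f \<in> set fs"
    unfolding lang_def by auto
  from run_word[OF run_refl t0 conf_ok_Nil inv_word_ok[OF w]]
  obtain st1 l1 t1 where 1: "mrun es (ms [] (inv_word w) q0 t0) st1 l1 (ms [] [] q0 t1)" "t1 \<in> T" "conf_ok (st1, l1)"
    "elt (st1, l1) t1 = start_elt \<otimes>\<^bsub>wr\<^esub> word_val wr xs (inv_word w)"
    unfolding start_elt_def by blast
  from run_path[OF gs(2) 1(1-3)]
  obtain st l t where 2: "mrun es (ms [] (inv_word w) q0 t0) st l (ms [] [] f t)" "t \<in> T" "conf_ok (st, l)"
    "elt (st, l) t = elt (st1, l1) t1 \<otimes>\<^bsub>wr\<^esub> list_mult wr gs" by blast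
  have "elt (st, l) t = elt ([], []) t0"
    unfolding 2(4) 1(4) word_val_inv_word[OF w] gs(1)[symmetric]
    using start_elt_closed word_val_closed[OF w] by (simp add: W.m_assoc) (simp add: start_elt_def)
  then have "st = []" "t = t0" "\<forall>x. eff H hv l x = \<one>\<^bsub>H\<^esub>"
    using elt_eq_start_iff[OF 2(3,2) t0] by auto
  then show "\<exists>l. \<exists>f\<in>set fs. mrun es (ms [] (inv_word w) q0 t0) [] l (ms [] [] f t0) \<and> (\<forall>x. eff H hv l x = \<one>\<^bsub>H\<^esub>)"
    using 2(1) gs(3) by blast
next
  assume "\<exists>l. \<exists>f\<in>set fs. mrun es (ms [] (inv_word w) q0 t0) [] l (ms [] [] f t0) \<and> (\<forall>x. eff H hv l x = \<one>\<^bsub>H\<^esub>)"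
  then obtain l f where l: "f \<in> set fs" "mrun es (ms [] (inv_word w) q0 t0) [] l (ms [] [] f t0)" "\<forall>x. eff H hv l x = \<one>\<^bsub>H\<^esub>"
    by blast
  from run_invariant[OF inv_word_ok[OF w] l(2)] obtain gs where gs: "conf_ok ([], l)" "path aut q0 gs f"
    "elt ([], l) t0 \<otimes>\<^bsub>wr\<^esub> \<one>\<^bsub>wr\<^esub> = start_elt \<otimes>\<^bsub>wr\<^esub> word_val wr xs (inv_word w) \<otimes>\<^bsub>wr\<^esub> list_mult wr gs"
    by (auto simp del: automaton_of_code.simps)
  have c: "list_mult wr gs \<in> carrier wr" using path_closed[OF gs(2)] W.list_mult_closed' by blast
  have "elt ([], l) t0 = start_elt"
    unfolding start_elt_def using elt_eq_start_iff[OF gs(1) t0 t0] l(3) by simp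
  then have "start_elt \<otimes>\<^bsub>wr\<^esub> (inv\<^bsub>wr\<^esub> word_val wr xs w \<otimes>\<^bsub>wr\<^esub> list_mult wr gs) = start_elt \<otimes>\<^bsub>wr\<^esub> \<one>\<^bsub>wr\<^esub>"
    using gs(3) start_elt_closed word_val_closed[OF w] c unfolding word_val_inv_word[OF w]
    by (simp add: W.m_assoc)
  then have "inv\<^bsub>wr\<^esub> word_val wr xs w \<otimes>\<^bsub>wr\<^esub> list_mult wr gs = \<one>\<^bsub>wr\<^esub>"
    using start_elt_closed word_val_closed[OF w] c by simp
  then have "word_val wr xs w = list_mult wr gs"
    using word_val_closed[OF w] c by (metis W.inv_closed W.inv_equality W.inv_inv)
  then show "word_val wr xs w \<in> lang wr aut"
    unfolding lang_def using gs(2) l(1) by auto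
qed

end

end


section \<open>Decidability\<close>

lemma computable_opp: "computable f \<Longrightarrow> computable (\<lambda>x. opp (f x))"
proof -
  assume f: "computable f"
  have par: "rec_nat 0 (\<lambda>_ y. 1 - y) n = n mod 2" for n :: nat
    by (induction n) (auto simp: mod_Suc)
  have "computable (\<lambda>x. if rec_nat 0 (\<lambda>_ y. 1 - y) (f x) = (0::nat) then Suc (f x) else f x - 1)"
    by (intro computable_case_nat computable_Suc f computable_diff computable_const computable_rec_nat
        computable_snd computable_id)
  moreover have "(if rec_nat 0 (\<lambda>_ y. 1 - y) (f x) = (0::nat) then Suc (f x) else f x - 1) = opp (f x)" for x
    unfolding par opp_def by (simp add: even_iff_mod_2_eq_zero)
  ultimately show ?thesis by simp
qed

lemmas computable_intros = computable_id computable_pair computable_fst computable_snd computable_Suc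
  computable_Cons computable_tl computable_head computable_append computable_encode computable_decode
  computable_opp computable_const

lemmas dec_intros = dec_conj dec_disj dec_imp dec_not dec_Ball dec_Bex dec_member dec_eq dec_less
  computable_intros dec_const

lemma mv_code: "mv d st = (if st = [] then [d] else if d = opp (head st) then tl st else d # st)"
  by (cases st) (auto simp: mv_def head_def)

lemma computable_mv:
  assumes "computable d" "computable st" shows "computable (\<lambda>x. mv (d x) (st x))"
  unfolding mv_code by (intro computable_if dec_intros assms)

context wreath_instance
begin

text \<open>The group data enter programs only through finite constants. Any fixed list is a
  computable constant, and quantification over it preserves decidability.\<close>

definition T_list where "T_list = sorted_list_of_set T"
definition Hc_list where "Hc_list = sorted_list_of_set Hc"
definition tab_list :: "(nat \<times> nat \<times> oper list \<times> nat) list" where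
  "tab_list = map (\<lambda>(i, t). (i, t, tab i t)) (List.product [0..<length xs] T_list)"
definition mult_list :: "(nat \<times> nat \<times> nat) list" where
  "mult_list = filter (\<lambda>(h, h', h''). hv h'' = hv h \<otimes>\<^bsub>H\<^esub> hv h') (List.product Hc_list (List.product Hc_list Hc_list))"
definition iv_list :: "(nat \<times> nat) list" where
  "iv_list = map (\<lambda>i. (i, iv i)) [0..<length xs]"
definition one_code :: nat where "one_code = (SOME h. h \<in> Hc \<and> hv h = \<one>\<^bsub>H\<^esub>)"

lemma set_T_list [simp]: "set T_list = T" and set_Hc_list [simp]: "set Hc_list = Hc"
  using finite_T finite_Hc by (simp_all add: T_list_def Hc_list_def)

lemma set_tab_list: "(i, t, y, t') \<in> set tab_list \<longleftrightarrow> i < length xs \<and> t \<in> T \<and> y = fst (tab i t) \<and> t' = snd (tab i t)"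
  by (auto simp: tab_list_def image_iff prod_eq_iff)

lemma set_mult_list: "(h, h', h'') \<in> set mult_list \<longleftrightarrow> h \<in> Hc \<and> h' \<in> Hc \<and> h'' \<in> Hc \<and> hv h'' = hv h \<otimes>\<^bsub>H\<^esub> hv h'"
  by (auto simp: mult_list_def)

lemma hv_inj: "h \<in> Hc \<Longrightarrow> h' \<in> Hc \<Longrightarrow> hv h = hv h' \<Longrightarrow> h = h'"
  using hv by (auto simp: bij_betw_def dest: inj_onD)

lemma hv_surj: "x \<in> carrier H \<Longrightarrow> \<exists>h\<in>Hc. hv h = x"
  unfolding bij_betw_imp_surj_on[OF hv, symmetric] by blast

lemma one_code: "one_code \<in> Hc" "hv one_code = \<one>\<^bsub>H\<^esub>"
  using someI_ex[of "\<lambda>h. h \<in> Hc \<and> hv h = \<one>\<^bsub>H\<^esub>"] hv_surj[OF H.one_closed] unfolding one_code_def by blast+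

lemma one_code_iff: "h \<in> Hc \<Longrightarrow> hv h = \<one>\<^bsub>H\<^esub> \<longleftrightarrow> h = one_code"
  using hv_inj one_code by auto

text \<open>A lookup in the multiplication table. The default 0 is returned only for numbers that
  are not both codes of elements of \<open>H\<close>.\<close>

definition mult_code :: "nat \<Rightarrow> nat \<Rightarrow> nat" where
  "mult_code a b = foldr (\<lambda>z r. if fst z = a \<and> fst (snd z) = b then snd (snd z) else r) mult_list 0"

lemma mult_code:
  assumes "a \<in> Hc" "b \<in> Hc" shows "mult_code a b \<in> Hc" "hv (mult_code a b) = hv a \<otimes>\<^bsub>H\<^esub> hv b"
proof -
  let ?f = "\<lambda>z r. if fst z = a \<and> fst (snd z) = b then snd (snd z) else r"
  have *: "(\<exists>c. (a, b, c) \<in> set l) \<Longrightarrow> (a, b, foldr ?f l 0) \<in> set l" for l :: "(nat \<times> nat \<times> nat) list"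
    by (induction l) auto
  obtain c where "c \<in> Hc" "hv c = hv a \<otimes>\<^bsub>H\<^esub> hv b"
    using hv_surj[of "hv a \<otimes>\<^bsub>H\<^esub> hv b"] assms hv_closed by auto
  then have "(a, b, c) \<in> set mult_list" using assms by (simp add: set_mult_list)
  then have "(a, b, mult_code a b) \<in> set mult_list" unfolding mult_code_def by (intro *) blast
  then show "mult_code a b \<in> Hc" "hv (mult_code a b) = hv a \<otimes>\<^bsub>H\<^esub> hv b" by (simp_all add: set_mult_list)
qed

definition eff_code :: "log \<Rightarrow> nat list \<times> nat \<Rightarrow> nat" where
  "eff_code l x = foldr (\<lambda>e r. if fst e = x then mult_code (snd e) r else r) l one_code"

lemma eff_code: "snd ` set l \<subseteq> Hc \<Longrightarrow> eff_code l x \<in> Hc \<and> hv (eff_code l x) = eff H hv l x"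
  by (induction l) (auto simp: eff_code_def eff_def one_code mult_code)

definition iv_code :: "nat \<Rightarrow> nat" where
  "iv_code i = foldr (\<lambda>z r. if fst z = i then snd z else r) iv_list 0"

lemma iv_code: "i < length xs \<Longrightarrow> iv_code i = iv i"
proof -
  assume i: "i < length xs"
  have *: "(\<exists>c. (i, c) \<in> set l) \<Longrightarrow> (i, foldr (\<lambda>z r. if fst z = i then snd z else r) l 0) \<in> set l" for l :: "(nat \<times> nat) list"
    by (induction l) auto
  have "(i, iv i) \<in> set iv_list" using i by (auto simp: iv_list_def)
  then have "(i, iv_code i) \<in> set iv_list" unfolding iv_code_def by (intro *) blast
  then show ?thesis by (auto simp: iv_list_def)
qed

lemma inv_word_code: "word_ok w \<Longrightarrow> rev (map iv_code w) = inv_word w"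
  unfolding inv_word_def word_ok_def by (auto simp: iv_code)


subsection \<open>Steps of the machine\<close>

text \<open>Pattern matching is expressed by computable functions: \<open>u = i # tl u\<close> says
  that u begins with i, for i taken from a finite table.\<close>

definition stepE :: "(nat \<times> nat list \<times> nat) list \<Rightarrow> nat \<Rightarrow> nat \<Rightarrow> bool" where
  "stepE es k k' \<longleftrightarrow> (case decode k :: mstate of (y, u, q, t) \<Rightarrow> y = [] \<and>
     ((\<exists>(i, t1, y1, t2)\<in>set tab_list. u = i # tl u \<and> t = t1 \<and> k' = ms y1 (tl u) q t2) \<or>
      (u = [] \<and> t \<in> set T_list \<and> (\<exists>(p, u1, q1)\<in>set es. p = q \<and> k' = ms [] u1 q1 t))))"

definition stepL :: "nat \<Rightarrow> nat \<Rightarrow> nat \<Rightarrow> nat \<Rightarrow> bool" where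
  "stepL k a h k' \<longleftrightarrow> (case decode k :: mstate of (y, u, q, t) \<Rightarrow>
     y = (1, a, h) # tl y \<and> a \<in> set T_list \<and> h \<in> set Hc_list \<and> k' = ms (tl y) u q t)"

text \<open>The direction of a move is determined by the state in which it is made. So the checks
  need no quantifier over the possibly infinite set of directions.\<close>

definition mdir :: "nat \<Rightarrow> nat" where
  "mdir k = fst (snd (head (fst (decode k :: mstate))))"

definition stepM :: "nat \<Rightarrow> nat \<Rightarrow> bool" where
  "stepM k k' \<longleftrightarrow> (case decode k :: mstate of (y, u, q, t) \<Rightarrow>
     y = (2, mdir k, 0) # tl y \<and> 1 < mdir k \<and> k' = ms (tl y) u q t)"

lemma ms_cases:
  obtains y u q t where "k = ms y u q t"
proof -
  obtain y u q t where "(decode k :: mstate) = (y, u, q, t)" by (cases "decode k :: mstate")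
  then have "k = ms y u q t" by (metis encode_decode)
  then show thesis by (rule that)
qed

lemma stepE_iff: "stepE es k k' \<longleftrightarrow> (k, k') \<in> meps es"
proof -
  obtain y u q t where k: "k = ms y u q t" by (rule ms_cases)
  have tab_list: "(\<exists>(i, t1, y1, t2)\<in>set tab_list. u = i # tl u \<and> t = t1 \<and> k' = ms y1 (tl u) q t2) \<longleftrightarrow>
      (\<exists>i u'. u = i # u' \<and> i < length xs \<and> t \<in> T \<and> k' = ms (fst (tab i t)) u' q (snd (tab i t)))" (is "?L \<longleftrightarrow> ?R")
  proof
    assume ?L
    then show ?R by (auto simp: set_tab_list)
  next
    assume ?R
    then obtain i u' where i: "u = i # u'" "i < length xs" "t \<in> T" "k' = ms (fst (tab i t)) u' q (snd (tab i t))"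
      by blast
    obtain y1 t2 where p: "tab i t = (y1, t2)" by (cases "tab i t")
    then have "(i, t, y1, t2) \<in> set tab_list" using i(2,3) by (simp add: set_tab_list)
    then show ?L using i(1,4) p by (intro bexI[of _ "(i, t, y1, t2)"]) simp_all
  qed
  have es: "(\<exists>(p, u1, q1)\<in>set es. p = q \<and> k' = ms [] u1 q1 t) \<longleftrightarrow>
      (\<exists>u1 q1. (q, u1, q1) \<in> set es \<and> k' = ms [] u1 q1 t)"
    by auto
  have "stepE es k k' \<longleftrightarrow> y = [] \<and> ((\<exists>i u'. u = i # u' \<and> i < length xs \<and> t \<in> T \<and> k' = ms (fst (tab i t)) u' q (snd (tab i t)))
     \<or> (u = [] \<and> t \<in> T \<and> (\<exists>u1 q1. (q, u1, q1) \<in> set es \<and> k' = ms [] u1 q1 t)))"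
    unfolding k stepE_def decode_encode prod.case tab_list es set_T_list ..
  also have "\<dots> \<longleftrightarrow> (k, k') \<in> meps es"
    unfolding k meps_def by (cases u) auto
  finally show ?thesis .
qed

lemma stepL_iff: "stepL k a h k' \<longleftrightarrow> (k, a, h, k') \<in> mlab"
proof -
  obtain y u q t where k: "k = ms y u q t" by (rule ms_cases)
  show ?thesis unfolding k stepL_def mlab_def by (cases y) auto
qed

lemma stepM_iff: "(k, d, k') \<in> mmov \<longleftrightarrow> d = mdir k \<and> stepM k k'"
proof -
  obtain y u q t where k: "k = ms y u q t" by (rule ms_cases)
  show ?thesis unfolding k stepM_def mmov_def mdir_def by (cases y) (auto simp: head_def)
qed

lemma dec_stepE:
  assumes "computable es" "computable k" "computable k'" shows "dec (\<lambda>x. stepE (es x) (k x) (k' x))"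
  unfolding stepE_def case_prod_beta
  by (intro dec_intros computable_compose[OF assms(1)] computable_compose[OF assms(2)] computable_compose[OF assms(3)])

lemma dec_stepL:
  assumes "computable k" "computable a" "computable h" "computable k'" shows "dec (\<lambda>x. stepL (k x) (a x) (h x) (k' x))"
  unfolding stepL_def case_prod_beta by (intro dec_intros assms)

lemma computable_mdir:
  assumes "computable k" shows "computable (\<lambda>x. mdir (k x))"
  unfolding mdir_def by (intro dec_intros assms)

lemma dec_stepM:
  assumes "computable k" "computable k'" shows "dec (\<lambda>x. stepM (k x) (k' x))"
  unfolding stepM_def case_prod_beta by (intro dec_intros computable_mdir assms)

lemmas step_intros = dec_stepE dec_stepL dec_stepM computable_mdir dec_intros


subsection \<open>Runs are semidecidable\<close>

text \<open>A run is witnessed by a finite set of configurations with time stamps, each of which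
  is initial or follows from one in the set; no order of the list is needed.\<close>

definition timed_step :: "(nat \<times> nat list \<times> nat) list \<Rightarrow> nat \<times> nat list \<times> log \<times> nat \<Rightarrow> nat \<times> nat list \<times> log \<times> nat \<Rightarrow> bool" where
  "timed_step es z' z \<longleftrightarrow> (case z' of (i', st', l', k') \<Rightarrow> case z of (i, st, l, k) \<Rightarrow> i = Suc i' \<and>
     ((stepE es k' k \<and> st = st' \<and> l = l') \<or>
      (\<exists>a\<in>set T_list. \<exists>h\<in>set Hc_list. stepL k' a h k \<and> st = st' \<and> l = l' @ [((st', a), h)]) \<or>
      (stepM k' k \<and> st = mv (mdir k') st' \<and> l = l')))"

definition run_check :: "(nat \<times> nat list \<times> nat) list \<Rightarrow> nat \<Rightarrow> (nat \<times> nat list \<times> log \<times> nat) list \<Rightarrow> bool" where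
  "run_check es s Z \<longleftrightarrow> (\<forall>z\<in>set Z. z = (0, [], [], s) \<or> (\<exists>z'\<in>set Z. timed_step es z' z))"

lemma run_timed_step:
  assumes r: "mrun es s st' l' k'" and "timed_step es (i', st', l', k') (i, st, l, k)"
  shows "mrun es s st l k"
proof -
  consider "stepE es k' k" "st = st'" "l = l'"
    | a h where "stepL k' a h k" "st = st'" "l = l' @ [((st', a), h)]"
    | "stepM k' k" "st = mv (mdir k') st'" "l = l'"
    using assms(2) by (auto simp: timed_step_def)
  then show ?thesis
  proof cases
    case 1
    then show ?thesis using run_eps[OF r, of k] by (simp add: stepE_iff)
  next
    case (2 a h)
    then show ?thesis using run_lab[OF r, of a h k] by (simp add: stepL_iff)
  next
    case 3
    then show ?thesis using run_mov[OF r, of "mdir k'" k] by (simp add: stepM_iff)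
  qed
qed

text \<open>Induction on the time stamp, which strictly decreases from a configuration to the one
  justifying it and so excludes circular justification.\<close>

lemma run_check_sound:
  assumes "run_check es s Z" "(i, st, l, k) \<in> set Z"
  shows "mrun es s st l k"
  using assms(2)
proof (induction i arbitrary: st l k)
  case 0
  have "\<not> timed_step es z' (0, st, l, k)" for z' by (cases z') (simp add: timed_step_def)
  then have "(0, st, l, k) = (0, [], [], s)" using assms(1) 0 unfolding run_check_def by blast
  then show ?case by (simp add: run_refl)
next
  case (Suc i)
  have "(Suc i, st, l, k) \<noteq> (0, [], [], s)" by simp
  then obtain i' st' l' k' where *: "(i', st', l', k') \<in> set Z" "timed_step es (i', st', l', k') (Suc i, st, l, k)"
    using assms(1) Suc.prems unfolding run_check_def by (metis prod_cases4)
  then have "i' = i" by (simp add: timed_step_def)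
  then show ?case using run_timed_step[OF Suc.IH *(2)] *(1) by simp
qed

lemma run_check_Cons:
  assumes "run_check es s Z" "z' \<in> set Z" "timed_step es z' z"
  shows "run_check es s (z # Z)"
  using assms unfolding run_check_def by auto

lemma run_check_complete:
  "mrun es s st l k \<Longrightarrow> \<exists>Z i. run_check es s Z \<and> (i, st, l, k) \<in> set Z"
proof (induction rule: run.induct)
  case run_refl
  show ?case by (intro exI[of _ "[(0, [], [], s)]"] exI[of _ 0]) (simp add: run_check_def)
next
  case (run_eps st l k r)
  then obtain Z i where Z: "run_check es s Z" "(i, st, l, k) \<in> set Z" by blast
  have "timed_step es (i, st, l, k) (Suc i, st, l, r)"
    using run_eps(2) by (simp add: timed_step_def stepE_iff)
  from run_check_Cons[OF Z this] show ?case by (meson list.set_intros(1))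
next
  case (run_lab st l k t h r)
  then obtain Z i where Z: "run_check es s Z" "(i, st, l, k) \<in> set Z" by blast
  have "t \<in> T" "h \<in> Hc" using run_lab(2) by (auto simp: mlab_def)
  then have "timed_step es (i, st, l, k) (Suc i, st, l @ [((st, t), h)], r)"
    using run_lab(2) by (auto simp: timed_step_def stepL_iff)
  from run_check_Cons[OF Z this] show ?case by (meson list.set_intros(1))
next
  case (run_mov st l k d r)
  then obtain Z i where Z: "run_check es s Z" "(i, st, l, k) \<in> set Z" by blast
  have "timed_step es (i, st, l, k) (Suc i, mv d st, l, r)"
    using run_mov(2) by (simp add: timed_step_def stepM_iff)
  from run_check_Cons[OF Z this] show ?case by (meson list.set_intros(1))
qed

lemma run_log: "mrun es s st l k \<Longrightarrow> snd ` set l \<subseteq> Hc"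
  by (induction rule: run.induct) (auto simp: mlab_def)

definition accept_check :: "nat list \<Rightarrow> (nat \<times> nat list \<times> log \<times> nat) list \<Rightarrow> bool" where
  "accept_check fs Z \<longleftrightarrow> (\<exists>(i, st, l, k)\<in>set Z. st = [] \<and> (\<exists>f\<in>set fs. k = ms [] [] f t0) \<and>
     (\<forall>e\<in>set l. eff_code l (fst e) = one_code))"

text \<open>A place that does not occur in the log has effect one, so finitely many places decide
  triviality.\<close>

lemma trivial_code:
  assumes "snd ` set l \<subseteq> Hc"
  shows "(\<forall>e\<in>set l. eff_code l (fst e) = one_code) \<longleftrightarrow> (\<forall>x. eff H hv l x = \<one>\<^bsub>H\<^esub>)"
proof -
  have *: "eff_code l x = one_code \<longleftrightarrow> eff H hv l x = \<one>\<^bsub>H\<^esub>" for x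
    using eff_code[OF assms, of x] one_code_iff[of "eff_code l x"] by simp
  have "eff H hv l x = \<one>\<^bsub>H\<^esub>" if "x \<notin> fst ` set l" for x
  proof -
    have "filter (\<lambda>e. fst e = x) l = []" using that by (auto simp: filter_empty_conv)
    then show ?thesis by (simp add: eff_def)
  qed
  then have "(\<forall>x\<in>fst ` set l. eff H hv l x = \<one>\<^bsub>H\<^esub>) \<longleftrightarrow> (\<forall>x. eff H hv l x = \<one>\<^bsub>H\<^esub>)" by blast
  then show ?thesis unfolding * by simp
qed

lemma accept_iff:
  "(\<exists>l. \<exists>f\<in>set fs. mrun es s [] l (ms [] [] f t0) \<and> (\<forall>x. eff H hv l x = \<one>\<^bsub>H\<^esub>)) \<longleftrightarrow>
    (\<exists>Z. run_check es s Z \<and> accept_check fs Z)"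
proof
  assume "\<exists>l. \<exists>f\<in>set fs. mrun es s [] l (ms [] [] f t0) \<and> (\<forall>x. eff H hv l x = \<one>\<^bsub>H\<^esub>)"
  then obtain l f where l: "f \<in> set fs" "mrun es s [] l (ms [] [] f t0)" "\<forall>x. eff H hv l x = \<one>\<^bsub>H\<^esub>" by blast
  obtain Z i where Z: "run_check es s Z" "(i, [], l, ms [] [] f t0) \<in> set Z"
    using run_check_complete[OF l(2)] by blast
  have "\<forall>e\<in>set l. eff_code l (fst e) = one_code" using trivial_code[OF run_log[OF l(2)]] l(3) by simp
  then have "accept_check fs Z" unfolding accept_check_def using Z(2) l(1)
    by (intro bexI[of _ "(i, [], l, ms [] [] f t0)"]) auto
  then show "\<exists>Z. run_check es s Z \<and> accept_check fs Z" using Z(1) by blast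
next
  assume "\<exists>Z. run_check es s Z \<and> accept_check fs Z"
  then obtain Z i l f where Z: "run_check es s Z" "(i, [], l, ms [] [] f t0) \<in> set Z" "f \<in> set fs"
    "\<forall>e\<in>set l. eff_code l (fst e) = one_code" unfolding accept_check_def by auto
  have r: "mrun es s [] l (ms [] [] f t0)" by (rule run_check_sound[OF Z(1,2)])
  then show "\<exists>l. \<exists>f\<in>set fs. mrun es s [] l (ms [] [] f t0) \<and> (\<forall>x. eff H hv l x = \<one>\<^bsub>H\<^esub>)"
    using trivial_code[OF run_log[OF r]] Z(3,4) by blast
qed

lemma dec_timed_step:
  assumes "computable es" "computable z" "computable z'"
  shows "dec (\<lambda>x. timed_step (es x) (z x) (z' x))"
  unfolding timed_step_def case_prod_beta
  by (intro step_intros computable_mv computable_compose[OF assms(1)] computable_compose[OF assms(2)]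
      computable_compose[OF assms(3)])

lemma dec_run_check:
  assumes "computable es" "computable s" "computable Z"
  shows "dec (\<lambda>x. run_check (es x) (s x) (Z x))"
  unfolding run_check_def
  by (intro dec_timed_step dec_intros computable_compose[OF assms(1)] computable_compose[OF assms(2)]
      computable_compose[OF assms(3)])

lemma computable_mult_code:
  assumes "computable a" "computable b" shows "computable (\<lambda>x. mult_code (a x) (b x))"
  unfolding mult_code_def
  by (intro computable_foldr computable_if dec_intros computable_compose[OF assms(1)] computable_compose[OF assms(2)])

lemma computable_eff_code:
  assumes "computable l" "computable y" shows "computable (\<lambda>x. eff_code (l x) (y x))"
  unfolding eff_code_def
  by (intro computable_foldr computable_if computable_mult_code dec_intros
      computable_compose[OF assms(1)] computable_compose[OF assms(2)])

lemma dec_accept_check: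
  assumes "computable fs" "computable Z"
  shows "dec (\<lambda>x. accept_check (fs x) (Z x))"
  unfolding accept_check_def case_prod_beta
  by (intro computable_eff_code dec_intros computable_compose[OF assms(1)] computable_compose[OF assms(2)])

lemma computable_iv_code:
  assumes "computable a" shows "computable (\<lambda>x. iv_code (a x))"
  unfolding iv_code_def
  by (intro computable_foldr computable_if dec_intros computable_compose[OF assms])

end


context wreath_instance
begin

subsection \<open>Certificates are semidecidable\<close>

text \<open>The step relations are infinite. A finite list of states closed under them contains all
  that a run starting in it can reach; as part of a certificate it bounds the quantifiers over
  states in the other checks.\<close>

definition closed_check :: "(nat \<times> nat list \<times> nat) list \<Rightarrow> nat list \<Rightarrow> bool" where
  "closed_check es Qs \<longleftrightarrow> (\<forall>k\<in>set Qs. case decode k :: mstate of (y, u, q, t) \<Rightarrow>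
     (y \<noteq> [] \<longrightarrow> ms (tl y) u q t \<in> set Qs) \<and>
     (y = [] \<longrightarrow> (\<forall>(i, t1, y1, t2)\<in>set tab_list. u = i # tl u \<longrightarrow> t = t1 \<longrightarrow> ms y1 (tl u) q t2 \<in> set Qs)) \<and>
     (y = [] \<longrightarrow> u = [] \<longrightarrow> t \<in> set T_list \<longrightarrow> (\<forall>(p, u1, q1)\<in>set es. p = q \<longrightarrow> ms [] u1 q1 t \<in> set Qs)))"

lemma closed_check_ms:
  assumes "closed_check es Qs" "ms y u q t \<in> set Qs"
  shows "y \<noteq> [] \<Longrightarrow> ms (tl y) u q t \<in> set Qs"
    "y = [] \<Longrightarrow> u = i # u' \<Longrightarrow> i < length xs \<Longrightarrow> t \<in> T \<Longrightarrow> ms (fst (tab i t)) u' q (snd (tab i t)) \<in> set Qs"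
    "y = [] \<Longrightarrow> u = [] \<Longrightarrow> t \<in> T \<Longrightarrow> (q, u1, q1) \<in> set es \<Longrightarrow> ms [] u1 q1 t \<in> set Qs"
proof -
  note * = bspec[OF assms(1)[unfolded closed_check_def] assms(2), unfolded decode_encode prod.case set_T_list]
  show "y \<noteq> [] \<Longrightarrow> ms (tl y) u q t \<in> set Qs" using * by blast
  show "ms (fst (tab i t)) u' q (snd (tab i t)) \<in> set Qs"
    if "y = []" "u = i # u'" "i < length xs" "t \<in> T"
  proof -
    have "(i, t, fst (tab i t), snd (tab i t)) \<in> set tab_list" unfolding set_tab_list using that by blast
    then show ?thesis using * that(1,2) by fastforce
  qed
  show "ms [] u1 q1 t \<in> set Qs" if "y = []" "u = []" "t \<in> T" "(q, u1, q1) \<in> set es"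
    using * that by fastforce
qed

lemma closed_check_step:
  assumes "closed_check es Qs" "k \<in> set Qs"
  shows "(k, k') \<in> meps es \<Longrightarrow> k' \<in> set Qs" "(k, a, h, k') \<in> mlab \<Longrightarrow> k' \<in> set Qs"
    "(k, d, k') \<in> mmov \<Longrightarrow> k' \<in> set Qs"
proof -
  obtain y u q t where k: "k = ms y u q t" by (rule ms_cases)
  note c = closed_check_ms[OF assms[unfolded k]]
  show "(k, k') \<in> meps es \<Longrightarrow> k' \<in> set Qs" unfolding meps_def k using c(2,3) by auto
  show "(k, a, h, k') \<in> mlab \<Longrightarrow> k' \<in> set Qs" unfolding mlab_def k using c(1) by auto
  show "(k, d, k') \<in> mmov \<Longrightarrow> k' \<in> set Qs" unfolding mmov_def k using c(1) by auto
qed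

text \<open>Pending operations are always suffixes of table entries, and pending generators are
  suffixes of w or of transition words; there are finitely many of both.\<close>

lemma closed_check_exists:
  assumes "t \<in> T" shows "\<exists>Qs. closed_check es Qs \<and> ms [] w q t \<in> set Qs"
proof -
  define Ys where "Ys = insert [] (\<Union>z\<in>set tab_list. set (suffixes (fst (snd (snd z)))))"
  define Us where "Us = set (suffixes w) \<union> (\<Union>z\<in>set es. set (suffixes (fst (snd z))))"
  define Ps where "Ps = insert q ((\<lambda>z. snd (snd z)) ` set es)"
  define Q where "Q = (\<lambda>(y, u, p, t). ms y u p t) ` (Ys \<times> Us \<times> Ps \<times> T)"
  have "finite Q" unfolding Q_def Ys_def Us_def Ps_def using finite_T by simp
  then obtain Qs where Qs: "set Qs = Q" using finite_list by blast
  have Q_iff: "ms y u p t \<in> set Qs \<longleftrightarrow> y \<in> Ys \<and> u \<in> Us \<and> p \<in> Ps \<and> t \<in> T" for y u p t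
    unfolding Qs Q_def by auto
  have suffix_tl: "suffix (tl x) x" for x :: "'z list" by (cases x) (auto simp: suffix_Cons)
  have Ys_tl: "tl y \<in> Ys" if "y \<in> Ys" for y
    using that suffix_order.trans[OF suffix_tl] unfolding Ys_def by auto
  have Us_tl: "tl u \<in> Us" if "u \<in> Us" for u
    using that suffix_order.trans[OF suffix_tl] unfolding Us_def by auto
  have "closed_check es Qs"
    unfolding closed_check_def
  proof
    fix k assume "k \<in> set Qs"
    moreover obtain y u p t where k: "k = ms y u p t" by (rule ms_cases)
    ultimately have *: "y \<in> Ys" "u \<in> Us" "p \<in> Ps" "t \<in> T" by (simp_all add: Q_iff)
    have "ms y1 (tl u) p t2 \<in> set Qs" if "(i, t1, y1, t2) \<in> set tab_list" for i t1 y1 t2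
    proof -
      have "y1 \<in> Ys" unfolding Ys_def using that by force
      moreover have "t2 \<in> T" using that tab by (auto simp: set_tab_list realizes_def)
      ultimately show ?thesis using * Us_tl by (simp add: Q_iff)
    qed
    moreover have "ms [] u1 q1 t \<in> set Qs" if "(p1, u1, q1) \<in> set es" for p1 u1 q1
    proof -
      have "u1 \<in> Us" "q1 \<in> Ps" unfolding Us_def Ps_def using that by force+
      then show ?thesis using * by (simp add: Q_iff Ys_def)
    qed
    moreover have "ms (tl y) u p t \<in> set Qs" using * Ys_tl by (simp add: Q_iff)
    ultimately show "case decode k :: mstate of (y, u, q, t) \<Rightarrow>
     (y \<noteq> [] \<longrightarrow> ms (tl y) u q t \<in> set Qs) \<and>
     (y = [] \<longrightarrow> (\<forall>(i, t1, y1, t2)\<in>set tab_list. u = i # tl u \<longrightarrow> t = t1 \<longrightarrow> ms y1 (tl u) q t2 \<in> set Qs)) \<and>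
     (y = [] \<longrightarrow> u = [] \<longrightarrow> t \<in> set T_list \<longrightarrow> (\<forall>(p, u1, q1)\<in>set es. p = q \<longrightarrow> ms [] u1 q1 t \<in> set Qs))"
      unfolding k decode_encode prod.case by blast
  qed
  moreover have "ms [] w q t \<in> set Qs"
    using assms by (simp add: Q_iff Ys_def Us_def Ps_def)
  ultimately show ?thesis by blast
qed

section \<open>Restriction of the machine to finitely many states\<close>

definition epsQ where "epsQ es Qs = {(k, k') \<in> meps es. k \<in> set Qs \<and> k' \<in> set Qs}"
definition labQ where "labQ Qs = {(k, a, h, k') \<in> mlab. k \<in> set Qs \<and> k' \<in> set Qs}"
definition movQ where "movQ Qs = {(k, d, k') \<in> mmov. k \<in> set Qs \<and> k' \<in> set Qs}"

lemma machine_Q: "machine H hv Hc T (epsQ es Qs) (labQ Qs) (movQ Qs)"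
proof unfold_locales
  show "finite (epsQ es Qs)"
    by (rule finite_subset[of _ "set Qs \<times> set Qs"]) (auto simp: epsQ_def)
  show "finite (labQ Qs)"
    by (rule finite_subset[of _ "set Qs \<times> T \<times> Hc \<times> set Qs"]) (auto simp: labQ_def mlab_def finite_T finite_Hc)
  show "finite (movQ Qs)"
    by (rule finite_subset[of _ "(\<lambda>(k, k'). (k, mdir k, k')) ` (set Qs \<times> set Qs)"])
      (auto simp: movQ_def stepM_iff)
qed (auto simp: hv finite_Hc finite_T labQ_def mlab_def movQ_def mmov_def)

lemma run_Q:
  assumes "closed_check es Qs" "s \<in> set Qs"
  shows "run (epsQ es Qs) (labQ Qs) (movQ Qs) s st l k \<longleftrightarrow> mrun es s st l k"
proof
  assume "run (epsQ es Qs) (labQ Qs) (movQ Qs) s st l k"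
  then show "mrun es s st l k"
    by (induction rule: run.induct) (auto simp: epsQ_def labQ_def movQ_def intro: run.intros)
next
  assume "mrun es s st l k"
  then have "run (epsQ es Qs) (labQ Qs) (movQ Qs) s st l k \<and> k \<in> set Qs"
  proof (induction rule: run.induct)
    case run_refl
    then show ?case using assms(2) by (auto intro: run.run_refl)
  next
    case (run_eps st l q r)
    then have "r \<in> set Qs" using closed_check_step(1)[OF assms(1)] by blast
    then have "(q, r) \<in> epsQ es Qs" using run_eps by (simp add: epsQ_def)
    then show ?case using run.run_eps run_eps.IH \<open>r \<in> set Qs\<close> by blast
  next
    case (run_lab st l q t h r)
    then have "r \<in> set Qs" using closed_check_step(2)[OF assms(1)] by blast
    then have "(q, t, h, r) \<in> labQ Qs" using run_lab by (simp add: labQ_def)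
    then show ?case using run.run_lab run_lab.IH \<open>r \<in> set Qs\<close> by blast
  next
    case (run_mov st l q d r)
    then have "r \<in> set Qs" using closed_check_step(3)[OF assms(1)] by blast
    then have "(q, d, r) \<in> movQ Qs" using run_mov by (simp add: movQ_def)
    then show ?case using run.run_mov run_mov.IH \<open>r \<in> set Qs\<close> by blast
  qed
  then show "run (epsQ es Qs) (labQ Qs) (movQ Qs) s st l k" by blast
qed

type_synonym trans = "(nat \<times> letter \<times> nat) list"
type_synonym inside = "((nat \<times> nat \<times> nat) \<times> nat \<times> nat) list"

section \<open>The conditions on a certificate as bounded quantifications\<close>

definition commute_check :: "trans \<Rightarrow> bool" where
  "commute_check \<Delta> \<longleftrightarrow> (\<forall>(c, a, c1)\<in>set \<Delta>. \<forall>(c1', b, c2)\<in>set \<Delta>. c1 = c1' \<longrightarrow> fst a \<noteq> fst b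
    \<longrightarrow> (\<exists>(c', b', c3)\<in>set \<Delta>. c' = c \<and> b' = b \<and> (c3, a, c2) \<in> set \<Delta>))"

text \<open>As \<open>hv\<close> is injective on codes, the unit of \<open>H\<close> has the single
  code \<open>one_code\<close>, and products are read off the finite multiplication table.\<close>

definition lab_check :: "trans \<Rightarrow> bool" where
  "lab_check \<Delta> \<longleftrightarrow> (\<forall>(c, a, c1)\<in>set \<Delta>. \<forall>t\<in>set T_list. (a = Lab t one_code \<longrightarrow> c1 = c) \<and>
    (\<forall>(c1', b, c2)\<in>set \<Delta>. \<forall>(h, h', h'')\<in>set mult_list. c1 = c1' \<longrightarrow> a = Lab t h \<longrightarrow> b = Lab t h'
      \<longrightarrow> (c, Lab t h'', c2) \<in> set \<Delta>))"

definition outside_check :: "nat list \<Rightarrow> nat list \<Rightarrow> nat \<Rightarrow> (nat \<times> nat \<times> nat) list \<Rightarrow> inside \<Rightarrow> bool" where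
  "outside_check Qs Acc c0 I J \<longleftrightarrow>
    (\<forall>c\<in>set Acc. \<forall>p\<in>set Qs. \<forall>p'\<in>set Qs. stepM p p' \<longrightarrow> (mdir p, c, c0) \<in> set I) \<and>
    (\<forall>(d, c, c')\<in>set I. (c' \<in> set Acc \<longrightarrow> c \<in> set Acc) \<and>
      (\<forall>p\<in>set Qs. \<forall>p'\<in>set Qs. stepM p p' \<longrightarrow> d = mdir p \<longrightarrow> ((d, c, p), p', c') \<in> set J))"

definition inside_check :: "(nat \<times> nat list \<times> nat) list \<Rightarrow> nat list \<Rightarrow> trans \<Rightarrow> inside \<Rightarrow> bool" where
  "inside_check es Qs \<Delta> J \<longleftrightarrow> (\<forall>(k, r, c')\<in>set J. r \<in> set Qs \<longrightarrow> (\<forall>r'\<in>set Qs.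
    (stepE es r r' \<longrightarrow> (k, r', c') \<in> set J) \<and>
    (\<forall>t\<in>set T_list. \<forall>h\<in>set Hc_list. stepL r t h r'
      \<longrightarrow> (\<exists>(c1, a, c'')\<in>set \<Delta>. c1 = c' \<and> a = Lab t h \<and> (k, r', c'') \<in> set J)) \<and>
    (\<forall>q\<in>set Qs. \<forall>r1\<in>set Qs. stepM r q \<longrightarrow> stepM r1 r' \<longrightarrow> mdir r1 = opp (mdir r) \<longrightarrow> mdir r \<noteq> opp (fst k)
      \<longrightarrow> (\<exists>(c1, a, c'')\<in>set \<Delta>. c1 = c' \<and> a = Exc (mdir r) r r' \<and> (k, r', c'') \<in> set J))))"

definition close_check :: "nat list \<Rightarrow> trans \<Rightarrow> (nat \<times> nat \<times> nat) list \<Rightarrow> inside \<Rightarrow> bool" where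
  "close_check Qs \<Delta> I J \<longleftrightarrow> (\<forall>(k, r, c')\<in>set J. r \<in> set Qs \<longrightarrow> (\<forall>q\<in>set Qs. \<forall>(c, a, c2)\<in>set \<Delta>.
    stepM r q \<longrightarrow> mdir r = opp (fst k) \<longrightarrow> c = fst (snd k) \<longrightarrow> a = Exc (fst k) (snd (snd k)) q
      \<longrightarrow> (fst k, c2, c') \<in> set I))"

definition final_check :: "nat list \<Rightarrow> nat \<Rightarrow> nat list \<Rightarrow> nat \<Rightarrow> inside \<Rightarrow> bool" where
  "final_check fs s Acc c0 J \<longleftrightarrow> c0 \<in> set Acc \<and> ((0, 0, 0), s, c0) \<in> set J \<and>
    (\<forall>(k, r, c')\<in>set J. k = (0, 0, 0) \<longrightarrow> (\<exists>f\<in>set fs. r = ms [] [] f t0) \<longrightarrow> c' \<notin> set Acc)"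

definition cert_check ::
  "(nat \<times> nat list \<times> nat) list \<Rightarrow> nat list \<Rightarrow> nat \<Rightarrow> nat list \<Rightarrow> trans \<Rightarrow> nat list \<Rightarrow> nat
    \<Rightarrow> (nat \<times> nat \<times> nat) list \<Rightarrow> inside \<Rightarrow> bool" where
  "cert_check es fs s Qs \<Delta> Acc c0 I J \<longleftrightarrow> closed_check es Qs \<and> s \<in> set Qs \<and> commute_check \<Delta> \<and> lab_check \<Delta> \<and>
    outside_check Qs Acc c0 I J \<and> inside_check es Qs \<Delta> J \<and> close_check Qs \<Delta> I J \<and> final_check fs s Acc c0 J"

definition fin_states :: "nat list \<Rightarrow> nat set" where
  "fin_states fs = (\<lambda>f. ms [] [] f t0) ` set fs"

lemma epsQ_iff: "(k, k') \<in> epsQ es Qs \<longleftrightarrow> k \<in> set Qs \<and> k' \<in> set Qs \<and> stepE es k k'"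
  by (auto simp: epsQ_def stepE_iff)

lemma labQ_iff: "(k, a, h, k') \<in> labQ Qs \<longleftrightarrow> k \<in> set Qs \<and> k' \<in> set Qs \<and> stepL k a h k'"
  by (auto simp: labQ_def stepL_iff)

lemma movQ_iff: "(k, d, k') \<in> movQ Qs \<longleftrightarrow> k \<in> set Qs \<and> k' \<in> set Qs \<and> d = mdir k \<and> stepM k k'"
  by (auto simp: movQ_def stepM_iff)

lemma stepL_ok: "stepL k a h k' \<Longrightarrow> a \<in> T \<and> h \<in> Hc"
  by (auto simp: stepL_def split: prod.splits)

lemma certificate_if_check:
  assumes "cert_check es fs s Qs \<Delta> Acc c0 I J"
  shows "certificate H hv Hc T (epsQ es Qs) (labQ Qs) (movQ Qs) s (fin_states fs)
    (set \<Delta>) (set Acc) c0 (set I) (set J)"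
proof (rule certificate.intro[OF machine_Q], rule certificate_axioms.intro)
  note chk = assms[unfolded cert_check_def]
  have cm: "commute_check \<Delta>" and lc: "lab_check \<Delta>" and oc: "outside_check Qs Acc c0 I J"
    and ic: "inside_check es Qs \<Delta> J" and cc: "close_check Qs \<Delta> I J" and fc: "final_check fs s Acc c0 J"
    using chk by blast+
  show "c0 \<in> set Acc" "((0, 0, 0), s, c0) \<in> set J" using fc by (auto simp: final_check_def)
  show "\<exists>c3. (c, b, c3) \<in> set \<Delta> \<and> (c3, a, c2) \<in> set \<Delta>"
    if "(c, a, c1) \<in> set \<Delta>" "(c1, b, c2) \<in> set \<Delta>" "fst a \<noteq> fst b" for c a c1 b c2
    using bspec[OF bspec[OF cm[unfolded commute_check_def] that(1), unfolded prod.case] that(2)] that(3) by auto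
  show "c' = c" if "t \<in> T" "h \<in> Hc" "hv h = \<one>\<^bsub>H\<^esub>" "(c, Lab t h, c') \<in> set \<Delta>" for t h c c'
    using bspec[OF lc[unfolded lab_check_def] that(4)] that one_code_iff[OF that(2)] by auto
  show "(c, Lab t h'', c2) \<in> set \<Delta>"
    if "t \<in> T" "h \<in> Hc" "h' \<in> Hc" "h'' \<in> Hc" "hv h'' = hv h \<otimes>\<^bsub>H\<^esub> hv h'"
      "(c, Lab t h, c1) \<in> set \<Delta>" "(c1, Lab t h', c2) \<in> set \<Delta>" for t h h' h'' c c1 c2
  proof -
    have "(h, h', h'') \<in> set mult_list" using that by (simp add: set_mult_list)
    then show ?thesis using bspec[OF lc[unfolded lab_check_def] that(6)] that(1,7) by fastforce
  qed
  show "(d, c, c0) \<in> set I" if "c \<in> set Acc" "(p, d, p') \<in> movQ Qs" for c p d p'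
    using oc that unfolding outside_check_def movQ_iff by blast
  show "((d, c, p), p', c') \<in> set J" if "(d, c, c') \<in> set I" "(p, d, p') \<in> movQ Qs" for d c c' p p'
    using bspec[OF conjunct2[OF oc[unfolded outside_check_def]] that(1)] that(2) unfolding movQ_iff by simp
  show "c \<in> set Acc" if "(d, c, c') \<in> set I" "c' \<in> set Acc" for d c c'
    using bspec[OF conjunct2[OF oc[unfolded outside_check_def]] that(1)] that(2) by simp
  show "(k, r', c') \<in> set J" if "(k, r, c') \<in> set J" "(r, r') \<in> epsQ es Qs" for k r c' r'
    using bspec[OF ic[unfolded inside_check_def] that(1)] that(2) unfolding epsQ_iff by simp
  show "\<exists>c''. (c', Lab t h, c'') \<in> set \<Delta> \<and> (k, r', c'') \<in> set J"
    if "(k, r, c') \<in> set J" "(r, t, h, r') \<in> labQ Qs" for k r c' t h r'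
  proof -
    have l: "r \<in> set Qs" "r' \<in> set Qs" "stepL r t h r'" "t \<in> T" "h \<in> Hc"
      using that(2) stepL_ok unfolding labQ_iff by blast+
    have "\<exists>(c1, a, c'')\<in>set \<Delta>. c1 = c' \<and> a = Lab t h \<and> (k, r', c'') \<in> set J"
      using bspec[OF ic[unfolded inside_check_def] that(1)] l by simp
    then show ?thesis by auto
  qed
  show "\<exists>c''. (c', Exc e r r', c'') \<in> set \<Delta> \<and> (k, r', c'') \<in> set J"
    if "(k, r, c') \<in> set J" "(r, e, q) \<in> movQ Qs" "(r1, opp e, r') \<in> movQ Qs" "e \<noteq> opp (fst k)"
    for k r c' e q r1 r'
  proof -
    have m: "r \<in> set Qs" "q \<in> set Qs" "r1 \<in> set Qs" "r' \<in> set Qs" "stepM r q" "stepM r1 r'"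
      "e = mdir r" "mdir r1 = opp (mdir r)" "mdir r \<noteq> opp (fst k)"
      using that(2-4) unfolding movQ_iff by auto
    have "\<exists>(c1, a, c'')\<in>set \<Delta>. c1 = c' \<and> a = Exc (mdir r) r r' \<and> (k, r', c'') \<in> set J"
      using bspec[OF ic[unfolded inside_check_def] that(1), unfolded prod.case] m(1-6,8,9) by blast
    then show ?thesis using m(7) by auto
  qed
  show "(d, c2, c') \<in> set I"
    if "((d, c, p), r, c') \<in> set J" "(r, opp d, q) \<in> movQ Qs" "(c, Exc d p q, c2) \<in> set \<Delta>" for d c p r c' q c2
    using bspec[OF cc[unfolded close_check_def] that(1)] that(2,3) unfolding movQ_iff by fastforce
  show "c' \<notin> set Acc" if "((0, 0, 0), r, c') \<in> set J" "r \<in> fin_states fs" for r c'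
    using conjunct2[OF conjunct2[OF fc[unfolded final_check_def]]] that unfolding fin_states_def by fastforce
qed

lemma check_if_certificate:
  assumes cl: "closed_check es Qs" "s \<in> set Qs"
    and cert: "certificate H hv Hc T (epsQ es Qs) (labQ Qs) (movQ Qs) s (fin_states fs)
      (set \<Delta>) (set Acc) c0 (set I) (set J)"
  shows "cert_check es fs s Qs \<Delta> Acc c0 I J"
proof -
  interpret C: certificate H hv Hc T "epsQ es Qs" "labQ Qs" "movQ Qs" s "fin_states fs" "set \<Delta>" "set Acc" c0 "set I" "set J"
    by fact
  have "commute_check \<Delta>"
    unfolding commute_check_def using C.commute by fastforce
  moreover have "lab_check \<Delta>"
  proof -
    have u: "c1 = c" if "(c, Lab t one_code, c1) \<in> set \<Delta>" "t \<in> T" for c c1 t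
      by (rule C.lab_unit[OF that(2) one_code that(1)])
    have m: "(c, Lab t h'', c2) \<in> set \<Delta>"
      if "(c, Lab t h, c1) \<in> set \<Delta>" "(c1, Lab t h', c2) \<in> set \<Delta>" "t \<in> T" "(h, h', h'') \<in> set mult_list" for c c1 c2 t h h' h''
      using C.lab_mult[OF that(3) _ _ _ _ that(1,2), of h''] that(4) by (simp add: set_mult_list)
    show ?thesis unfolding lab_check_def by (auto dest: u intro: m)
  qed
  moreover have "outside_check Qs Acc c0 I J"
    unfolding outside_check_def using C.I_start C.J_open C.I_Acc by (fastforce simp: movQ_iff)
  moreover have "inside_check es Qs \<Delta> J"
    unfolding inside_check_def
  proof (clarify, intro conjI ballI impI)
    fix k1 k2 k3 r c' r' assume J: "((k1, k2, k3), r, c') \<in> set J" and r: "r \<in> set Qs" "r' \<in> set Qs"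
    show "((k1, k2, k3), r', c') \<in> set J" if "stepE es r r'"
      using C.J_eps[OF J] r that by (simp add: epsQ_iff)
    show "\<exists>(c1, a, c'')\<in>set \<Delta>. c1 = c' \<and> a = Lab t h \<and> ((k1, k2, k3), r', c'') \<in> set J"
      if "stepL r t h r'" for t h
      using C.J_lab[OF J, of t h r'] r that by (fastforce simp: labQ_iff)
    show "\<exists>(c1, a, c'')\<in>set \<Delta>. c1 = c' \<and> a = Exc (mdir r) r r' \<and> ((k1, k2, k3), r', c'') \<in> set J"
      if "q \<in> set Qs" "r1 \<in> set Qs" "stepM r q" "stepM r1 r'" "mdir r1 = opp (mdir r)"
        "mdir r \<noteq> opp (fst (k1, k2, k3))" for q r1
      using C.J_exc[OF J, of "mdir r" q r1 r'] r that by (fastforce simp: movQ_iff)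
  qed
  moreover have "close_check Qs \<Delta> I J"
    unfolding close_check_def using C.I_close by (fastforce simp: movQ_iff)
  moreover have "final_check fs s Acc c0 J"
    unfolding final_check_def using C.c0_Acc C.J_root C.J_final by (fastforce simp: fin_states_def)
  ultimately show ?thesis using cl unfolding cert_check_def by blast
qed

text \<open>Both directions pass through the restricted machine: a closed list of states has the
  same runs from the start, so soundness and completeness of certificates for a finite machine
  apply.\<close>

lemma reject_iff:
  assumes "t \<in> T"
  shows "(\<nexists>l. \<exists>f\<in>set fs. mrun es (ms [] w q t) [] l (ms [] [] f t0) \<and> (\<forall>x. eff H hv l x = \<one>\<^bsub>H\<^esub>)) \<longleftrightarrow>
    (\<exists>Qs \<Delta> Acc c0 I J. cert_check es fs (ms [] w q t) Qs \<Delta> Acc c0 I J)" (is "?L \<longleftrightarrow> ?R")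
proof -
  let ?s = "ms [] w q t"
  have reach: "machine.reach H hv (epsQ es Qs) (labQ Qs) (movQ Qs) ?s (fin_states fs) \<longleftrightarrow> \<not> ?L"
    if "closed_check es Qs" "?s \<in> set Qs" for Qs
  proof -
    interpret M: machine H hv Hc T "epsQ es Qs" "labQ Qs" "movQ Qs" by (rule machine_Q)
    show ?thesis
      unfolding M.reach_iff_run run_Q[OF that] M.trivial_def fin_states_def by auto
  qed
  show ?thesis
  proof
    assume L: ?L
    obtain Qs where Qs: "closed_check es Qs" "?s \<in> set Qs" using closed_check_exists[OF assms] by blast
    interpret M: machine H hv Hc T "epsQ es Qs" "labQ Qs" "movQ Qs" by (rule machine_Q)
    have "\<not> M.reach ?s (fin_states fs)" using reach[OF Qs] L by blast
    from M.certificate_exists[OF this] obtain \<Delta> Acc c0 I J where c: "finite \<Delta>" "finite Acc" "finite I" "finite J"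
      "certificate H hv Hc T (epsQ es Qs) (labQ Qs) (movQ Qs) ?s (fin_states fs) \<Delta> Acc c0 I J" by blast
    obtain dl al il jl where l: "set dl = \<Delta>" "set al = Acc" "set il = I" "set jl = J"
      using c(1-4) finite_list by metis
    have "cert_check es fs ?s Qs dl al c0 il jl"
      by (rule check_if_certificate[OF Qs]) (use c(5) l in simp)
    then show ?R by blast
  next
    assume ?R
    then obtain Qs \<Delta> Acc c0 I J where c: "cert_check es fs ?s Qs \<Delta> Acc c0 I J" by blast
    then have Qs: "closed_check es Qs" "?s \<in> set Qs" by (simp_all add: cert_check_def)
    show ?L using certificate.not_reach[OF certificate_if_check[OF c]] reach[OF Qs] by blast
  qed
qed

lemma dec_closed_check:
  assumes "computable es" "computable Qs" shows "dec (\<lambda>x. closed_check (es x) (Qs x))"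
  unfolding closed_check_def case_prod_beta
  by (intro dec_intros computable_compose[OF assms(1)] computable_compose[OF assms(2)])

lemma dec_commute_check:
  assumes "computable d" shows "dec (\<lambda>x. commute_check (d x))"
  unfolding commute_check_def case_prod_beta by (intro dec_intros computable_compose[OF assms(1)])

lemma dec_lab_check:
  assumes "computable d" shows "dec (\<lambda>x. lab_check (d x))"
  unfolding lab_check_def case_prod_beta by (intro dec_intros computable_compose[OF assms(1)])

lemma dec_outside_check:
  assumes "computable Qs" "computable a" "computable c" "computable i" "computable j"
  shows "dec (\<lambda>x. outside_check (Qs x) (a x) (c x) (i x) (j x))"
  unfolding outside_check_def case_prod_beta
  by (intro step_intros computable_compose[OF assms(1)] computable_compose[OF assms(2)]
     computable_compose[OF assms(3)] computable_compose[OF assms(4)] computable_compose[OF assms(5)])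

lemma dec_inside_check:
  assumes "computable es" "computable Qs" "computable d" "computable j"
  shows "dec (\<lambda>x. inside_check (es x) (Qs x) (d x) (j x))"
  unfolding inside_check_def case_prod_beta
  by (intro step_intros computable_compose[OF assms(1)] computable_compose[OF assms(2)]
     computable_compose[OF assms(3)] computable_compose[OF assms(4)])

lemma dec_close_check:
  assumes "computable Qs" "computable d" "computable i" "computable j"
  shows "dec (\<lambda>x. close_check (Qs x) (d x) (i x) (j x))"
  unfolding close_check_def case_prod_beta
  by (intro step_intros computable_compose[OF assms(1)] computable_compose[OF assms(2)]
     computable_compose[OF assms(3)] computable_compose[OF assms(4)])

lemma dec_final_check:
  assumes "computable fs" "computable s" "computable a" "computable c" "computable j"
  shows "dec (\<lambda>x. final_check (fs x) (s x) (a x) (c x) (j x))"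
  unfolding final_check_def case_prod_beta
  by (intro step_intros computable_compose[OF assms(1)] computable_compose[OF assms(2)]
     computable_compose[OF assms(3)] computable_compose[OF assms(4)] computable_compose[OF assms(5)])

lemma dec_cert_check:
  assumes "computable es" "computable fs" "computable s" "computable Qs" "computable d" "computable a"
    "computable c" "computable i" "computable j"
  shows "dec (\<lambda>x. cert_check (es x) (fs x) (s x) (Qs x) (d x) (a x) (c x) (i x) (j x))"
  unfolding cert_check_def
  by (intro dec_conj dec_member dec_closed_check dec_commute_check dec_lab_check dec_outside_check dec_inside_check
      dec_close_check dec_final_check assms)


subsection \<open>The decision procedure\<close>

fun parse_list :: "nat list \<Rightarrow> automaton_code \<times> nat list" where
  "parse_list l = ((head l, decode (head (tl l)), head (tl (tl l)), decode (head (tl (tl (tl l))))),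
     decode (head (tl (tl (tl (tl l))))))"

definition parse :: "nat \<Rightarrow> automaton_code \<times> nat list" where
  "parse N = parse_list (decode N)"

text \<open>\<open>parse\<close> is defined on all numbers. A number that encodes no instance is
  recognised by not being recovered when its parse is encoded again.\<close>

definition unparse :: "automaton_code \<times> nat list \<Rightarrow> nat" where
  "unparse z = encode [fst (fst z), encode (fst (snd (fst z))), fst (snd (snd (fst z))),
     encode (snd (snd (snd (fst z)))), encode (snd z)]"

lemma unparse: "unparse z = instance_encode z"
proof -
  have t: "transition_encode x = encode x" for x :: "nat \<times> nat list \<times> nat"
    by (cases x) (simp add: encode_prod_def)
  have "list_encode (map transition_encode es) = encode es" for es :: "(nat \<times> nat list \<times> nat) list"
    unfolding encode_list_def by (simp add: t[abs_def])
  then show ?thesis by (cases z) (auto simp: unparse_def)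
qed

lemma parse_instance_encode: "parse (instance_encode z) = z"
  unfolding unparse[symmetric] unparse_def parse_def
  by (cases z) (simp add: head_def del: encode_nat_list)

lemma computable_parse: "computable parse"
  unfolding parse_def parse_list.simps by (intro computable_intros)

lemma computable_unparse: "computable f \<Longrightarrow> computable (\<lambda>x. unparse (f x))"
  unfolding unparse_def by (intro computable_intros)

definition inv_code :: "nat list \<Rightarrow> nat list" where
  "inv_code w = rev (map iv_code w)"

lemma computable_inv_code: "computable f \<Longrightarrow> computable (\<lambda>x. inv_code (f x))"
  unfolding inv_code_def
  by (intro computable_rev computable_map computable_iv_code computable_snd computable_id)

definition valid_code :: "automaton_code \<times> nat list \<Rightarrow> bool" where
  "valid_code z \<longleftrightarrow> (case z of ((n, es, q0, fs), w) \<Rightarrow>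
     (\<forall>(p, u, q)\<in>set es. p < n \<and> (\<forall>i\<in>set u. i < length xs) \<and> q < n) \<and> q0 < n \<and> (\<forall>f\<in>set fs. f < n) \<and>
     (\<forall>i\<in>set w. i < length xs))"

definition member :: "automaton_code \<times> nat list \<Rightarrow> bool" where
  "member z \<longleftrightarrow> valid_code z \<and> word_val wr xs (snd z) \<in> lang wr (automaton_of_code wr xs (fst z))"

definition start_code :: "automaton_code \<times> nat list \<Rightarrow> nat" where
  "start_code z = ms [] (inv_code (snd z)) (fst (snd (snd (fst z)))) t0"

lemma member_iff_run:
  assumes "valid_code z"
  shows "member z \<longleftrightarrow> (\<exists>l. \<exists>f\<in>set (snd (snd (snd (fst z)))).
    mrun (fst (snd (fst z))) (start_code z) [] l (ms [] [] f t0) \<and> (\<forall>x. eff H hv l x = \<one>\<^bsub>H\<^esub>))"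
proof -
  obtain n es q0 fs w where z: "z = ((n, es, q0, fs), w)" by (metis prod.exhaust)
  have es: "word_ok u" if "(p, u, q) \<in> set es" for p u q
    using assms that by (fastforce simp: z valid_code_def word_ok_def)
  have w: "word_ok w" using assms by (auto simp: z valid_code_def word_ok_def)
  show ?thesis
    using in_lang_iff_run[of es w n q0 fs, OF es w] assms inv_word_code[OF w]
    by (simp add: z member_def start_code_def inv_code_def del: automaton_of_code.simps)
qed

lemma dec_valid_code: "dec valid_code"
  unfolding valid_code_def case_prod_beta by (intro dec_intros)

lemma computable_start_code: "computable f \<Longrightarrow> computable (\<lambda>x. start_code (f x))"
  unfolding start_code_def by (intro computable_inv_code computable_intros)

text \<open>Both sides are searched for: a time-stamped accepting run witnesses membership, and a
  certificate witnesses its failure. An invalid instance counts as a failure with any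
  witness.\<close>

lemma dec_member: "dec member"
proof (rule dec_if_semidec)
  show "semidec member"
  proof (rule semidecI)
    show "dec (\<lambda>x. valid_code (fst x) \<and> run_check (fst (snd (fst (fst x)))) (start_code (fst x)) (snd x)
        \<and> accept_check (snd (snd (snd (fst (fst x))))) (snd x))"
      by (intro dec_conj dec_compose[OF dec_valid_code] dec_run_check dec_accept_check computable_start_code
          computable_fst computable_snd computable_id)
    show "member z \<longleftrightarrow> (\<exists>Z. valid_code z \<and> run_check (fst (snd (fst z))) (start_code z) Z
        \<and> accept_check (snd (snd (snd (fst z)))) Z)" for z
      using member_iff_run[of z] unfolding accept_iff by (auto simp: member_def)
  qed
  show "semidec (\<lambda>z. \<not> member z)"
  proof (rule semidecI)
    show "dec (\<lambda>x. \<not> valid_code (fst x) \<or> cert_check (fst (snd (fst (fst x)))) (snd (snd (snd (fst (fst x)))))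
       (start_code (fst x)) (fst (snd x)) (fst (snd (snd x))) (fst (snd (snd (snd x))))
       (fst (snd (snd (snd (snd x))))) (fst (snd (snd (snd (snd (snd x)))))) (snd (snd (snd (snd (snd (snd x)))))))"
      by (intro dec_disj dec_not dec_compose[OF dec_valid_code] dec_cert_check computable_start_code
          computable_fst computable_snd computable_id)
    show "\<not> member z \<longleftrightarrow> (\<exists>y. \<not> valid_code z \<or> cert_check (fst (snd (fst z))) (snd (snd (snd (fst z))))
       (start_code z) (fst y) (fst (snd y)) (fst (snd (snd y)))
       (fst (snd (snd (snd y)))) (fst (snd (snd (snd (snd y))))) (snd (snd (snd (snd (snd y))))))" for z
    proof (cases "valid_code z")
      case True
      then show ?thesis
        using reject_iff[OF t0] member_iff_run[OF True] unfolding start_code_def by simp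
    qed (auto simp: member_def)
  qed
qed

theorem decidable_membership: "decidable (rational_subset_membership wr xs)"
proof (rule decidableI)
  have mem: "N \<in> rational_subset_membership wr xs \<longleftrightarrow> N = unparse (parse N) \<and> member (parse N)" for N
  proof -
    have valid: "valid_code (c, w) \<longleftrightarrow> valid_automaton_code (length xs) c \<and> set w \<subseteq> {..<length xs}" for c w
      by (cases c) (auto simp: valid_code_def)
    have "N \<in> rational_subset_membership wr xs \<longleftrightarrow> (\<exists>z. N = instance_encode z \<and> member z)"
      unfolding rational_subset_membership_def member_def by (auto simp: valid)
    also have "\<dots> \<longleftrightarrow> N = instance_encode (parse N) \<and> member (parse N)"
      using parse_instance_encode by metis
    finally show ?thesis by (simp add: unparse)
  qed
  show "dec (\<lambda>N. N \<notin> rational_subset_membership wr xs)"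
    unfolding mem
    by (intro dec_not dec_conj dec_eq computable_id computable_unparse computable_parse
        dec_compose[OF dec_member])
qed

end

theorem theorem3:
  fixes H :: "('h, 'm) monoid_scheme" and V :: "('v, 'n) monoid_scheme"
  assumes "group H" and "finite (carrier H)"
    and "group V" and "finitely_generated V" and "virtually_free V"
  shows "rational_subset_membership_decidable (wreath_product H V)"
  unfolding rational_subset_membership_decidable_def
proof (intro conjI allI impI)
  interpret G: two_groups H V using assms(1,3) by (simp add: two_groups_def)
  show "finitely_generated (wreath_product H V)"
    by (rule G.finitely_generated_wreath[OF assms(2,4)])
  fix xs assume xs: "symmetric_generating_list (wreath_product H V) xs"
  obtain hv Hc tv T dv D where "wreath_coords H V hv Hc tv T dv D"
    by (rule wreath_coords_exist[OF assms])
  then interpret C: wreath_coords H V hv Hc tv T dv D .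
  have xs_carrier: "set xs \<subseteq> carrier G.wr" and xs_inv: "\<forall>x\<in>set xs. inv\<^bsub>G.wr\<^esub> x \<in> set xs"
    using xs by (simp_all add: symmetric_generating_list_def)
  \<comment> \<open>T is nonempty because the identity of \<open>V\<close> has coordinates.\<close>
  obtain t0 where t0: "t0 \<in> T" using C.coords[OF G.V.one_closed] by blast
  \<comment> \<open>An arbitrary choice does not harm computability: the procedure uses only the
    finitely many entries at indices of generators and elements of T, as a constant list.\<close>
  define tab where "tab i t = (SOME p. C.realizes (fst p) t (snd p) (xs ! i))" for i t
  have tab: "C.realizes (fst (tab i t)) t (snd (tab i t)) (xs ! i)" if "i < length xs" "t \<in> T" for i t
  proof -
    have "\<exists>p. C.realizes (fst p) t (snd p) (xs ! i)"
    proof -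
      have "xs ! i \<in> carrier G.wr" using xs_carrier nth_mem[OF that(1)] by blast
      from bspec[OF C.realizes_exists[OF this] that(2)]
      obtain ys t' where "C.realizes ys t t' (xs ! i)" by blast
      then show ?thesis by (intro exI[of _ "(ys, t')"]) simp
    qed
    then show ?thesis unfolding tab_def by (rule someI_ex)
  qed
  define iv where "iv i = (SOME j. j < length xs \<and> xs ! j = inv\<^bsub>G.wr\<^esub> (xs ! i))" for i
  have iv: "iv i < length xs \<and> xs ! iv i = inv\<^bsub>G.wr\<^esub> (xs ! i)" if "i < length xs" for i
  proof -
    have "\<exists>j. j < length xs \<and> xs ! j = inv\<^bsub>G.wr\<^esub> (xs ! i)"
      using xs_inv that by (metis in_set_conv_nth nth_mem)
    then show ?thesis unfolding iv_def by (rule someI_ex)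
  qed
  interpret I: wreath_instance H V hv Hc tv T dv D xs tab iv t0
    by unfold_locales (use xs_carrier tab iv t0 in auto)
  show "decidable (rational_subset_membership (wreath_product H V) xs)"
    by (rule I.decidable_membership)
qed

end
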